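(* (i) For every $L\in\mathbf T_{S_m}^{q}$, $\mathcal V_L=U_L\setminus\bigcup_{L'\succ L,\ L'\in\mathbf T_{S_m}^{q}}U_{L'}$. (ii) For every $L\in\mathbf B_{S_m}^{q}$, $\mathcal U_L=\mathcal O(U_L)\setminus\bigcup_{L'\succ L,\ L'\in\mathbf B_{S_m}^{q}}\mathcal O(U_{L'})$. (iii) $\{\mathcal V_L\}_{L\in\mathbf T_{S_m}^{q}}$ and $\{\mathcal U_L\}_{L\in\mathbf B_{S_m}^{q}}$ are two stratifications of $\mathbf{Gr}_{S_m}^{q}$ consisting of locally closed subsets. Moreover, if $W$ is a closed and irreducible subset of $\mathbf{Gr}_{S_m}^{q}$, then: (a) $W\cap\mathcal V_{\mathbf{in}(W)}$ is a dense open subset of $W$, while $W\cap\mathcal V_L$ is empty if $L\succ\mathbf{in}(W)$. (b) If $W$ is also stable under the action of $\mathrm{GL}$, then $W\cap\mathcal U_{\mathbf{gin}(W)}=W\cap\mathcal O(\mathcal V_{\mathbf{gin}(W)})=W\cap\mathcal O(\mathcal V_{\mathbf{in}(W)})$ is a dense open subset of $W$, while $W\cap\mathcal U_L$ is empty if $L\succ\mathbf{gin}(W)$.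
   Context: $K$ is an infinite field, $S=K[x_0,\dots,x_n]$ with the standard grading, $S_m$ is its degree $m$ component, a term is a monic monomial, $\prec$ is a term order on $S$ with $x_0\prec\dots\prec x_n$, $m,q$ are positive integers. $\mathbf{Gr}_{S_m}^{q}$ is the Grassmannian scheme over $K$ of $q$-dimensional subspaces of $S_m$, embedded in $\mathbb P(\wedge^qS_m)$ by Plücker. Subsets $W$ are non-empty sets of (not necessarily closed) points of the scheme. $\mathbf T_{S_m}^{q}$ is the set of $\tau_1\wedge\dots\wedge\tau_q$ with $\tau_i$ terms in $S_m$, $\tau_1\succ\dots\succ\tau_q$, totally ordered by: $\tau_1\wedge\dots\wedge\tau_q\prec\sigma_1\wedge\dots\wedge\sigma_q$ iff for some $j$, $\tau_i=\sigma_i$ for $i<j$ and $\tau_j\prec\sigma_j$. For $L\in\mathbf T_{S_m}^{q}$, $U_L\subseteq\mathbf{Gr}_{S_m}^{q}$ is the open set where the Plücker coordinate $\Delta_L$ is invertible. $\mathrm{GL}=\mathrm{GL}_K(n+1)$ acts on $S$ by $g(f)=f(\sum_j g_{0j}x_j,\dots,\sum_j g_{nj}x_j)$ and correspondingly on $\wedge^qS_m$ and, by automorphisms, on $\mathbf{Gr}_{S_m}^{q}$; $W$ is stable if $g(W)=W$ for all $g\in\mathrm{GL}$; $\mathcal O(W)=\{g(V):V\in W,\ g\in\mathrm{GL}\}$. $L$ is Borel if $g(L)\in\langle L\rangle$ for every upper-triangular $g\in\mathrm{GL}$; $\mathbf B_{S_m}^{q}$ is the set of Borel terms. $\mathbf{in}(W)=\max_\prec\{L\in\mathbf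 T_{S_m}^{q}:U_L\cap W\ne\emptyset\}$, $\mathbf{gin}(W)=\mathbf{in}(\mathcal O(W))$; for $W=\{V\}$ one writes $\mathbf{in}(V),\mathbf{gin}(V)$. $\mathcal V_L:=\{V\in\mathbf{Gr}_{S_m}^{q}\mid\mathbf{in}(V)=L\}$ for $L\in\mathbf T_{S_m}^{q}$, and $\mathcal U_L:=\{V\in\mathbf{Gr}_{S_m}^{q}\mid\mathbf{gin}(V)=L\}$, considered for $L\in\mathbf B_{S_m}^{q}$. A stratification means here a partition into subsets. *)

theory Defs
  imports
    "HOL-Library.Poly_Mapping"
    "HOL-Library.Disjoint_Sets"
    "HOL-Algebra.Ideal"
    "HOL-Analysis.Abstract_Topology"
    "Jordan_Normal_Form.Determinant"
begin

section \<open>Polynomials\<close>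

text \<open>A polynomial over \<open>'k\<close> in variables from \<open>'v\<close> is an element of
  \<open>('v \<Rightarrow>\<^sub>0 nat) \<Rightarrow>\<^sub>0 'k\<close> (exponent vectors mapped to coefficients) with the convolution
  product of HOL-Library. The monomial with exponent vector \<open>t\<close> is \<open>single t 1\<close>, so the product
  of monomials is addition of exponent vectors.\<close>

type_synonym ('v, 'k) mpoly = "('v \<Rightarrow>\<^sub>0 nat) \<Rightarrow>\<^sub>0 'k"

definition mdeg :: "('v \<Rightarrow>\<^sub>0 nat) \<Rightarrow> nat" where
  "mdeg t = (\<Sum>i\<in>Poly_Mapping.keys t. Poly_Mapping.lookup t i)"

definition Var :: "'v \<Rightarrow> ('v, 'k::comm_ring_1) mpoly" where
  "Var v = Poly_Mapping.single (Poly_Mapping.single v 1) 1"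

definition hom_component :: "nat \<Rightarrow> ('v, 'k::comm_ring_1) mpoly \<Rightarrow> ('v, 'k) mpoly" where
  "hom_component d f =
     (\<Sum>t\<in>{t \<in> Poly_Mapping.keys f. mdeg t = d}. Poly_Mapping.single t (Poly_Mapping.lookup f t))"

text \<open>\<open>subst \<phi>\<close> is the \<open>'k\<close>-algebra homomorphism sending the variable \<open>v\<close> to \<open>\<phi> v\<close>.\<close>

definition subst :: "('v \<Rightarrow> ('w, 'k::comm_ring_1) mpoly) \<Rightarrow> ('v, 'k) mpoly \<Rightarrow> ('w, 'k) mpoly" where
  "subst \<phi> f = (\<Sum>t\<in>Poly_Mapping.keys f. Poly_Mapping.single 0 (Poly_Mapping.lookup f t) *
     (\<Prod>v\<in>Poly_Mapping.keys t. \<phi> v ^ Poly_Mapping.lookup t v))"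

section \<open>Terms, term orders, and the group action on \<open>S\<close>\<close>

text \<open>\<open>S = K[x\<^sub>0,\<dots>,x\<^sub>n]\<close> has variables indexed by \<open>nat\<close>, and a term of \<open>S\<close> is identified with its
  exponent vector, supported in \<open>{0..n}\<close>.\<close>

type_synonym trm = "nat \<Rightarrow>\<^sub>0 nat"

definition S_terms :: "nat \<Rightarrow> trm set" where
  "S_terms n = {t. Poly_Mapping.keys t \<subseteq> {0..n}}"

definition terms :: "nat \<Rightarrow> nat \<Rightarrow> trm set" where
  "terms n m = {t \<in> S_terms n. mdeg t = m}"

definition term_order :: "nat \<Rightarrow> (trm \<Rightarrow> trm \<Rightarrow> bool) \<Rightarrow> bool" where
  "term_order n lt \<longleftrightarrow>
     irreflp_on (S_terms n) lt \<and> transp_on (S_terms n) lt \<and> totalp_on (S_terms n) lt \<and>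
     (\<forall>a\<in>S_terms n. \<forall>b\<in>S_terms n. \<forall>c\<in>S_terms n. lt a b \<longrightarrow> lt (a + c) (b + c)) \<and>
     (\<forall>a\<in>S_terms n. a \<noteq> 0 \<longrightarrow> lt 0 a)"

definition GL :: "nat \<Rightarrow> 'k::field mat set" where
  "GL n = {g \<in> carrier_mat (n + 1) (n + 1). invertible_mat g}"

definition act_poly :: "nat \<Rightarrow> 'k::field mat \<Rightarrow> (nat, 'k) mpoly \<Rightarrow> (nat, 'k) mpoly" where
  "act_poly n g = subst (\<lambda>i. \<Sum>j\<le>n. Poly_Mapping.single 0 (g $$ (i, j)) * Var j)"

section \<open>The exterior power and the Grassmannian\<close>

text \<open>The wedge \<open>\<tau>\<^sub>1 \<and> \<dots> \<and> \<tau>\<^sub>q\<close> with \<open>\<tau>\<^sub>1 \<succ> \<dots> \<succ> \<tau>\<^sub>q\<close> is encoded by the list \<open>[\<tau>\<^sub>1, \<dots>, \<tau>\<^sub>q]\<close>.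
  An element of \<open>\<and>\<^sup>q S\<^sub>m\<close> is encoded by its coordinates in this basis, as a finitely
  supported function on such lists.\<close>

type_synonym wedge_trm = "trm list"

text \<open>If \<open>f\<^sub>i = (\<Sum>\<tau>. c i \<tau> * \<tau>)\<close> for \<open>i < q\<close>, then \<open>plucker_coord q c L\<close> is the coordinate of
  \<open>f\<^sub>0 \<and> \<dots> \<and> f\<^bsub>q-1\<^esub>\<close> at the basis element \<open>L\<close>.\<close>

definition plucker_coord :: "nat \<Rightarrow> (nat \<Rightarrow> trm \<Rightarrow> 'r::comm_ring_1) \<Rightarrow> wedge_trm \<Rightarrow> 'r" where
  "plucker_coord q c L = det (mat q q (\<lambda>(i, j). c i (L ! j)))"

text \<open>A point of the projective space \<open>\<bbbP>(\<and>\<^sup>q S\<^sub>m)\<close>, not necessarily closed, is a homogeneous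
  prime ideal of the coordinate ring \<open>K[\<Delta>\<^sub>L]\<close>, where \<open>\<Delta>\<^sub>L\<close> is \<open>Var L\<close>.\<close>

type_synonym 'k point = "(wedge_trm, 'k) mpoly set"

definition irreducible_in :: "'a topology \<Rightarrow> 'a set \<Rightarrow> bool" where
  "irreducible_in X W \<longleftrightarrow> W \<subseteq> topspace X \<and> W \<noteq> {} \<and>
     (\<forall>A B. closedin (subtopology X W) A \<and> closedin (subtopology X W) B \<and> A \<union> B = W
        \<longrightarrow> A = W \<or> B = W)"

definition locally_closed_in :: "'a topology \<Rightarrow> 'a set \<Rightarrow> bool" where
  "locally_closed_in X A \<longleftrightarrow> (\<exists>U C. openin X U \<and> closedin X C \<and> A = U \<inter> C)"

definition dense_open_in :: "'a topology \<Rightarrow> 'a set \<Rightarrow> 'a set \<Rightarrow> bool" where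
  "dense_open_in X W A \<longleftrightarrow>
     openin (subtopology X W) A \<and> (subtopology X W) closure_of A = topspace (subtopology X W)"

definition stratification :: "'a set \<Rightarrow> 'i set \<Rightarrow> ('i \<Rightarrow> 'a set) \<Rightarrow> bool" where
  "stratification X I A \<longleftrightarrow> disjoint_family_on A I \<and> partition_on X (A ` I)"

context
  fixes n m q :: nat and lt :: "trm \<Rightarrow> trm \<Rightarrow> bool"
begin

definition wedge_terms :: "wedge_trm set" where
  "wedge_terms = {L. length L = q \<and> set L \<subseteq> terms n m \<and> sorted_wrt (\<lambda>a b. lt b a) L}"

definition wedge_less :: "wedge_trm \<Rightarrow> wedge_trm \<Rightarrow> bool" where
  "wedge_less L L' \<longleftrightarrow> (\<exists>j<q. (\<forall>i<j. L ! i = L' ! i) \<and> lt (L ! j) (L' ! j))"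

text \<open>\<open>g(\<tau>\<^sub>1 \<and> \<dots> \<and> \<tau>\<^sub>q) = g(\<tau>\<^sub>1) \<and> \<dots> \<and> g(\<tau>\<^sub>q)\<close>\<close>

definition act_wedge :: "'k::field mat \<Rightarrow> wedge_trm \<Rightarrow> wedge_trm \<Rightarrow>\<^sub>0 'k" where
  "act_wedge g L = (\<Sum>M\<in>wedge_terms. Poly_Mapping.single M
     (plucker_coord q
        (\<lambda>i. Poly_Mapping.lookup (act_poly n g (Poly_Mapping.single (L ! i) 1))) M))"

text \<open>The terms that are Borel over the field \<open>'k\<close>; \<open>range (single L)\<close> is the line \<open>\<langle>L\<rangle>\<close>.\<close>

definition borel_terms :: "'k::field itself \<Rightarrow> wedge_trm set" where
  "borel_terms _ = {L \<in> wedge_terms. \<forall>g\<in>GL n :: 'k mat set.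
     upper_triangular g \<longrightarrow> act_wedge g L \<in> range (Poly_Mapping.single L)}"

definition coord_ring :: "(wedge_trm, 'k::field) mpoly ring" where
  "coord_ring = \<lparr>carrier = {f. \<forall>t\<in>Poly_Mapping.keys f. Poly_Mapping.keys t \<subseteq> wedge_terms},
     monoid.mult = (*), one = 1, ring.zero = 0, ring.add = (+)\<rparr>"

definition proj_points :: "'k::field point set" where
  "proj_points = {P. primeideal P coord_ring \<and> (\<forall>f\<in>P. \<forall>d. hom_component d f \<in> P) \<and>
     \<not> Var ` wedge_terms \<subseteq> P}"

definition proj_space :: "'k::field point topology" where
  "proj_space =
     topology (\<lambda>U. \<exists>A \<subseteq> carrier coord_ring. U = {P \<in> proj_points. \<not> A \<subseteq> P})"

text \<open>The Pluecker embedding is given by the maximal minors of a generic matrix with rows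
  indexed by \<open>{0..<q}\<close> and columns by the terms of \<open>S\<^sub>m\<close>; the homogeneous ideal of its image is
  the ideal of relations among these minors.\<close>

definition plucker_ideal :: "(wedge_trm, 'k::field) mpoly set" where
  "plucker_ideal = {f \<in> carrier coord_ring.
     subst (plucker_coord q (\<lambda>i \<tau>. Var (i, \<tau>) :: (nat \<times> trm, 'k) mpoly)) f = 0}"

definition Gr :: "'k::field point topology" where
  "Gr = subtopology proj_space {P. plucker_ideal \<subseteq> P}"

definition U_chart :: "wedge_trm \<Rightarrow> 'k::field point set" where
  "U_chart L = {P \<in> topspace Gr. Var L \<notin> P}"

text \<open>The automorphism of \<open>\<bbbP>(\<and>\<^sup>q S\<^sub>m)\<close> induced by \<open>g\<close> is the preimage map on prime ideals of
  the pullback of coordinate functions \<open>\<Delta>\<^sub>L \<mapsto> \<Delta>\<^sub>L \<circ> g\<close>.\<close>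

definition pullback :: "'k::field mat \<Rightarrow> (wedge_trm, 'k) mpoly \<Rightarrow> (wedge_trm, 'k) mpoly" where
  "pullback g = subst (\<lambda>L. \<Sum>M\<in>wedge_terms.
     Poly_Mapping.single 0 (Poly_Mapping.lookup (act_wedge g M) L) * Var M)"

definition act_point :: "'k::field mat \<Rightarrow> 'k point \<Rightarrow> 'k point" where
  "act_point g P = {f \<in> carrier coord_ring. pullback g f \<in> P}"

definition stable :: "'k::field point set \<Rightarrow> bool" where
  "stable W \<longleftrightarrow> (\<forall>g\<in>GL n. act_point g ` W = W)"

definition orbit :: "'k::field point set \<Rightarrow> 'k point set" where
  "orbit W = {act_point g V | g V. V \<in> W \<and> g \<in> GL n}"

text \<open>\<open>ini W\<close> is the maximum with respect to \<open>wedge_less\<close>, meaningful for non-empty sets \<open>W\<close> of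
  points.\<close>

definition ini :: "'k::field point set \<Rightarrow> wedge_trm" where
  "ini W = (THE L. L \<in> wedge_terms \<and> U_chart L \<inter> W \<noteq> {} \<and>
     (\<forall>M\<in>wedge_terms. U_chart M \<inter> W \<noteq> {} \<longrightarrow> M = L \<or> wedge_less M L))"

definition gin :: "'k::field point set \<Rightarrow> wedge_trm" where
  "gin W = ini (orbit W)"

definition V_stratum :: "wedge_trm \<Rightarrow> 'k::field point set" where
  "V_stratum L = {V \<in> topspace Gr. ini {V} = L}"

definition U_stratum :: "wedge_trm \<Rightarrow> 'k::field point set" where
  "U_stratum L = {V \<in> topspace Gr. gin {V} = L}"

text \<open>The sets used to define \<open>proj_space\<close> do form a topology.\<close>

lemma istopology_proj_space:
  "istopology (\<lambda>U. \<exists>A \<subseteq> carrier coord_ring. U = {P \<in> proj_points :: 'k::field point set. \<not> A \<subseteq> P})"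
  unfolding istopology_def
proof (intro conjI allI impI)
  fix U U' :: "'k point set"
  assume "\<exists>A \<subseteq> carrier coord_ring. U = {P \<in> proj_points. \<not> A \<subseteq> P}"
    and "\<exists>A \<subseteq> carrier coord_ring. U' = {P \<in> proj_points. \<not> A \<subseteq> P}"
  then obtain A A' where A: "A \<subseteq> carrier coord_ring" "U = {P \<in> proj_points. \<not> A \<subseteq> P}"
    and A': "A' \<subseteq> carrier coord_ring" "U' = {P \<in> proj_points. \<not> A' \<subseteq> P}"
    by blast
  define C where "C = {a \<otimes>\<^bsub>coord_ring\<^esub> b | a b. a \<in> A \<and> b \<in> A'} \<inter> carrier coord_ring"
  have "\<not> C \<subseteq> P \<longleftrightarrow> \<not> A \<subseteq> P \<and> \<not> A' \<subseteq> P" if "P \<in> proj_points" for P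
  proof -
    interpret primeideal P coord_ring using that by (simp add: proj_points_def)
    show ?thesis
    proof
      assume "\<not> C \<subseteq> P"
      then obtain a b where ab: "a \<in> A" "b \<in> A'" "a \<otimes>\<^bsub>coord_ring\<^esub> b \<notin> P"
        by (auto simp: C_def)
      with A(1) A'(1) have "a \<in> carrier coord_ring" "b \<in> carrier coord_ring" by auto
      with ab I_l_closed I_r_closed show "\<not> A \<subseteq> P \<and> \<not> A' \<subseteq> P" by blast
    next
      assume "\<not> A \<subseteq> P \<and> \<not> A' \<subseteq> P"
      then obtain a b where ab: "a \<in> A" "b \<in> A'" "a \<notin> P" "b \<notin> P" by blast
      with A(1) A'(1) have car: "a \<in> carrier coord_ring" "b \<in> carrier coord_ring" by auto
      with ab I_prime have "a \<otimes>\<^bsub>coord_ring\<^esub> b \<notin> P" by blast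
      moreover have "a \<otimes>\<^bsub>coord_ring\<^esub> b \<in> C" using ab car by (auto simp: C_def)
      ultimately show "\<not> C \<subseteq> P" by blast
    qed
  qed
  then have "U \<inter> U' = {P \<in> proj_points. \<not> C \<subseteq> P}" using A(2) A'(2) by blast
  moreover have "C \<subseteq> carrier coord_ring" by (simp add: C_def)
  ultimately show "\<exists>A \<subseteq> carrier coord_ring. U \<inter> U' = {P \<in> proj_points. \<not> A \<subseteq> P}" by blast
next
  fix \<K> :: "'k point set set"
  assume "\<forall>U\<in>\<K>. \<exists>A \<subseteq> carrier coord_ring. U = {P \<in> proj_points. \<not> A \<subseteq> P}"
  from bchoice[OF this] obtain F where F: "\<forall>U\<in>\<K>. F U \<subseteq> carrier coord_ring \<and>
    U = {P \<in> proj_points. \<not> F U \<subseteq> P}"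
    by (elim exE)
  have F_sub: "F U \<subseteq> carrier coord_ring" if "U \<in> \<K>" for U
    using bspec[OF F that] by (rule conjunct1)
  have F_eq: "U = {P \<in> proj_points. \<not> F U \<subseteq> P}" if "U \<in> \<K>" for U
    using bspec[OF F that] by (rule conjunct2)
  have "\<Union>\<K> = (\<Union>U\<in>\<K>. U)" by (simp only: image_ident)
  also have "\<dots> = (\<Union>U\<in>\<K>. {P \<in> proj_points. \<not> F U \<subseteq> P})"
    by (rule SUP_cong[OF refl F_eq])
  also have "\<dots> = {P \<in> proj_points. \<not> \<Union>(F ` \<K>) \<subseteq> P}"
    unfolding UN_subset_iff by blast
  finally have "\<Union>\<K> = {P \<in> proj_points. \<not> \<Union>(F ` \<K>) \<subseteq> P}" .
  moreover have "\<Union>(F ` \<K>) \<subseteq> carrier coord_ring" by (rule UN_least[OF F_sub])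
  ultimately show "\<exists>A \<subseteq> carrier coord_ring. \<Union>\<K> = {P \<in> proj_points. \<not> A \<subseteq> P}"
    by (intro exI conjI)
qed

lemma openin_proj_space:
  "openin (proj_space :: 'k::field point topology) U \<longleftrightarrow>
     (\<exists>A \<subseteq> carrier coord_ring. U = {P \<in> proj_points. \<not> A \<subseteq> P})"
  unfolding proj_space_def by (simp only: topology_inverse'[OF istopology_proj_space])

lemma topspace_proj_space: "topspace (proj_space :: 'k::field point topology) = proj_points"
proof
  show "topspace (proj_space :: 'k point topology) \<subseteq> proj_points"
    by (auto simp: topspace_def openin_proj_space)
  have "\<exists>A \<subseteq> carrier coord_ring. proj_points = {P \<in> proj_points :: 'k point set. \<not> A \<subseteq> P}"
  proof (intro exI conjI)
    have "\<not> carrier coord_ring \<subseteq> P" if "P \<in> proj_points" for P :: "'k point"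
    proof -
      interpret primeideal P coord_ring using that by (simp add: proj_points_def)
      show ?thesis using a_subset I_notcarr by blast
    qed
    then show "proj_points = {P \<in> proj_points :: 'k point set. \<not> carrier coord_ring \<subseteq> P}"
      by blast
  qed simp
  then have "openin (proj_space :: 'k point topology) proj_points"
    by (simp only: openin_proj_space)
  then show "proj_points \<subseteq> topspace (proj_space :: 'k point topology)"
    by (rule openin_subset)
qed

end

end

theory Submission
  imports Defs "HOL-Algebra.QuotRing" "Jordan_Normal_Form.Char_Poly"
begin

text \<open>Everything formal follows from the maximality in the definition of the initial term, except
  that generic initial terms are Borel and that every Borel term is one.

  For the first, move \<open>V\<close> so that its initial term \<open>L\<close> is already the generic one. The exchange
  relations, applied in the residue domain of \<open>V\<close>, show that every other non-zero Pluecker coordinate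
  \<open>N\<close> satisfies \<open>\<Prod>N \<prec> \<Prod>L\<close>, so \<open>L\<close> is the only one of its torus weight. Since \<open>K\<close> is
  infinite, torus translates separate the weights; if \<open>u\<close> is upper triangular and \<open>u(L)\<close> had a
  coordinate \<open>M \<succ> L\<close>, that coordinate would be non-zero on some translate of \<open>V\<close>, contradicting
  maximality.

  For the second, take the coordinate subspace of a Borel term \<open>L\<close>. Almost all matrices \<open>g + s\<close> are
  of the form lower triangular after upper triangular; the upper triangular factor fixes the line
  \<open>\<langle>L\<rangle>\<close> and the lower triangular one only decreases terms. By interpolation in \<open>s\<close> no
  \<open>g(L)\<close> has a coordinate above \<open>L\<close>.\<close>

section \<open>Evaluation of polynomials\<close>

text \<open>A point is encoded as a homogeneous prime ideal, so no reduced echelon basis of a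
  subspace is directly at hand, although one would give the weight inequality at once. Its
  substitute is that the prime contains all relations among generic minors: an exchange relation
  whose left side is non-zero modulo the prime has a summand both of whose factors are non-zero. The
  weight of \<open>L\<close> has to be isolated because coordinate \<open>M\<close> of a translate
  by \<open>u\<close> adds up contributions of all non-zero coordinates of \<open>V\<close>;
  contributions of equal weight could cancel and hide a non-zero coefficient of \<open>u(L)\<close>.
  Both halves use matrix coefficients on the exterior power rather than a criterion by exchanging
  variables, since such a criterion depends on the characteristic of \<open>K\<close>. Realising
  every Borel term is forced by the notion of partition, whose blocks are non-empty.\<close>

lemma poly_mapping_sum_single:
  "(f :: 'a \<Rightarrow>\<^sub>0 'b::comm_monoid_add) =
     (\<Sum>t\<in>Poly_Mapping.keys f. Poly_Mapping.single t (Poly_Mapping.lookup f t))"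
proof (rule poly_mapping_eqI)
  fix k
  show "Poly_Mapping.lookup f k =
    Poly_Mapping.lookup (\<Sum>t\<in>Poly_Mapping.keys f. Poly_Mapping.single t (Poly_Mapping.lookup f t)) k"
    by (cases "k \<in> Poly_Mapping.keys f")
      (auto simp: lookup_sum lookup_single when_def in_keys_iff sum.delta)
qed

definition mon_eval :: "('v \<Rightarrow> 'r::comm_ring_1) \<Rightarrow> ('v \<Rightarrow>\<^sub>0 nat) \<Rightarrow> 'r" where
  "mon_eval \<phi> t = (\<Prod>v\<in>Poly_Mapping.keys t. \<phi> v ^ Poly_Mapping.lookup t v)"

lemma mon_superset:
  assumes "finite A" "Poly_Mapping.keys t \<subseteq> A"
  shows "mon_eval \<phi> t = (\<Prod>v\<in>A. \<phi> v ^ Poly_Mapping.lookup t v)"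
  unfolding mon_eval_def using assms
  by (intro prod.mono_neutral_left) (auto simp: in_keys_iff)

lemma mon_add: "mon_eval \<phi> (s + t) = mon_eval \<phi> s * mon_eval \<phi> t"
proof -
  let ?A = "Poly_Mapping.keys s \<union> Poly_Mapping.keys t"
  have "Poly_Mapping.keys (s + t) \<subseteq> ?A" by (rule keys_add)
  then show ?thesis
    by (simp add: mon_superset[of ?A] lookup_add power_add prod.distrib)
qed

lemma mon_zero [simp]: "mon_eval \<phi> 0 = 1"
  by (simp add: mon_eval_def)

lemma mon_single [simp]: "mon_eval \<phi> (Poly_Mapping.single v k) = \<phi> v ^ k"
  by (cases "k = 0") (simp_all add: mon_eval_def)

text \<open>The coefficient map \<open>c\<close> is kept apart from the assignment
  \<open>\<phi>\<close> so that one set of lemmas serves both substitution, where \<open>c\<close>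
  embeds constants, and change of coefficients in \<open>map_coeff\<close>.\<close>

definition eval_pm :: "('k \<Rightarrow> 'r) \<Rightarrow> ('v \<Rightarrow> 'r) \<Rightarrow> ('v, 'k::comm_ring_1) mpoly \<Rightarrow> 'r::comm_ring_1" where
  "eval_pm c \<phi> f = (\<Sum>t\<in>Poly_Mapping.keys f. c (Poly_Mapping.lookup f t) * mon_eval \<phi> t)"

lemma subst_eq_eval_pm: "subst \<phi> = eval_pm (Poly_Mapping.single 0) \<phi>"
  by (rule ext) (simp add: subst_def eval_pm_def mon_eval_def)

context comm_ring_hom
begin

lemma eval_pm_superset:
  assumes "finite A" "Poly_Mapping.keys f \<subseteq> A"
  shows "eval_pm hom \<phi> f = (\<Sum>t\<in>A. hom (Poly_Mapping.lookup f t) * mon_eval \<phi> t)"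
  unfolding eval_pm_def using assms
  by (intro sum.mono_neutral_left) (auto simp: in_keys_iff)

lemma eval_pm_add: "eval_pm hom \<phi> (f + g) = eval_pm hom \<phi> f + eval_pm hom \<phi> g"
proof -
  let ?A = "Poly_Mapping.keys f \<union> Poly_Mapping.keys g"
  have "Poly_Mapping.keys (f + g) \<subseteq> ?A" by (rule keys_add)
  then show ?thesis
    by (simp add: eval_pm_superset[of ?A] lookup_add hom_add distrib_right sum.distrib)
qed

lemma eval_pm_single: "eval_pm hom \<phi> (Poly_Mapping.single t a) = hom a * mon_eval \<phi> t"
  by (cases "a = 0") (simp_all add: eval_pm_def)

lemma eval_pm_zero: "eval_pm hom \<phi> 0 = 0"
  by (simp add: eval_pm_def)

lemma eval_pm_sum: "eval_pm hom \<phi> (sum F I) = (\<Sum>i\<in>I. eval_pm hom \<phi> (F i))"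
  by (induction I rule: infinite_finite_induct) (simp_all add: eval_pm_zero eval_pm_add)

lemma eval_pm_mult: "eval_pm hom \<phi> (f * g) = eval_pm hom \<phi> f * eval_pm hom \<phi> g"
proof -
  have "f * g = (\<Sum>s\<in>Poly_Mapping.keys f. \<Sum>t\<in>Poly_Mapping.keys g.
      Poly_Mapping.single (s + t) (Poly_Mapping.lookup f s * Poly_Mapping.lookup g t))"
    using arg_cong2[OF poly_mapping_sum_single[of f] poly_mapping_sum_single[of g], of "(*)"]
    by (simp only: sum_product mult_single)
  then have "eval_pm hom \<phi> (f * g) = (\<Sum>s\<in>Poly_Mapping.keys f. \<Sum>t\<in>Poly_Mapping.keys g.
      hom (Poly_Mapping.lookup f s * Poly_Mapping.lookup g t) * mon_eval \<phi> (s + t))"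
    by (simp add: eval_pm_sum eval_pm_single)
  also have "\<dots> = eval_pm hom \<phi> f * eval_pm hom \<phi> g"
    by (simp add: eval_pm_def sum_product mon_add hom_mult mult_ac)
  finally show ?thesis .
qed

lemma comm_ring_hom_eval_pm: "comm_ring_hom (eval_pm hom \<phi>)"
proof
  show "eval_pm hom \<phi> 1 = 1"
    using eval_pm_single[of \<phi> 0 1] by simp
qed (simp_all add: eval_pm_zero eval_pm_add eval_pm_mult)

lemma hom_mon: "hom (mon_eval \<phi> t) = mon_eval (\<lambda>v. hom (\<phi> v)) t"
  by (simp add: mon_eval_def hom_prod hom_power)

lemma hom_eval_pm: "hom (eval_pm c \<phi> f) = eval_pm (\<lambda>a. hom (c a)) (\<lambda>v. hom (\<phi> v)) f"
  by (simp add: eval_pm_def hom_sum hom_mult hom_mon)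

lemma eval_pm_Var: "eval_pm hom \<phi> (Var v) = \<phi> v"
  by (simp add: Var_def eval_pm_single)

end

lemma comm_ring_hom_single: "comm_ring_hom (Poly_Mapping.single 0 :: 'k::comm_ring_1 \<Rightarrow> 'v::comm_monoid_add \<Rightarrow>\<^sub>0 'k)"
  by unfold_locales (simp_all add: single_add mult_single)

interpretation const: comm_ring_hom
  "Poly_Mapping.single 0 :: 'k::comm_ring_1 \<Rightarrow> ('v, 'k) mpoly"
  by (rule comm_ring_hom_single)

interpretation subst: comm_ring_hom "subst \<phi> :: ('v, 'k::comm_ring_1) mpoly \<Rightarrow> ('w, 'k) mpoly" for \<phi>
  unfolding subst_eq_eval_pm
  by (rule comm_ring_hom.comm_ring_hom_eval_pm[OF comm_ring_hom_single])

lemma subst_single: "subst \<phi> (Poly_Mapping.single t a) = Poly_Mapping.single 0 a * mon_eval \<phi> t"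
  unfolding subst_eq_eval_pm by (rule comm_ring_hom.eval_pm_single[OF comm_ring_hom_single])

lemma subst_const [simp]: "subst \<phi> (Poly_Mapping.single 0 a) = Poly_Mapping.single 0 a"
  by (simp add: subst_single)

lemma subst_Var [simp]: "subst \<phi> (Var v) = \<phi> v"
  unfolding subst_eq_eval_pm by (rule comm_ring_hom.eval_pm_Var[OF comm_ring_hom_single])

lemma eval_pm_cong:
  assumes "\<And>t v. t \<in> Poly_Mapping.keys f \<Longrightarrow> v \<in> Poly_Mapping.keys t \<Longrightarrow> \<phi> v = \<psi> v"
  shows "eval_pm c \<phi> f = eval_pm c \<psi> f"
  unfolding eval_pm_def mon_eval_def using assms by (intro sum.cong refl arg_cong2[where f="(*)"] prod.cong) auto

lemma subst_cong:
  assumes "\<And>t v. t \<in> Poly_Mapping.keys f \<Longrightarrow> v \<in> Poly_Mapping.keys t \<Longrightarrow> \<phi> v = \<psi> v"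
  shows "subst \<phi> f = subst \<psi> f"
  unfolding subst_eq_eval_pm using assms by (rule eval_pm_cong)

lemma subst_subst: "subst \<psi> (subst \<phi> f) = subst (\<lambda>v. subst \<psi> (\<phi> v)) f"
  by (simp add: subst_eq_eval_pm[of \<phi>] subst.hom_eval_pm) (simp add: subst_eq_eval_pm)

lemma mon_Var: "mon_eval Var t = Poly_Mapping.single t 1"
proof -
  have pow: "(Var v :: ('a, 'b::comm_ring_1) mpoly) ^ k = Poly_Mapping.single (Poly_Mapping.single v k) 1"
    for v :: 'a and k
    by (induction k) (simp_all add: Var_def mult_single single_add[symmetric])
  have prod: "(\<Prod>v\<in>A. Poly_Mapping.single (F v) (1::'b)) = Poly_Mapping.single (sum F A) 1"
    for A and F :: "'a \<Rightarrow> 'a \<Rightarrow>\<^sub>0 nat"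
    by (induction A rule: infinite_finite_induct) (simp_all add: mult_single)
  show ?thesis
    unfolding mon_eval_def pow prod by (simp only: poly_mapping_sum_single[of t, symmetric])
qed

lemma subst_Var_id [simp]: "subst Var f = f"
  unfolding subst_eq_eval_pm eval_pm_def mon_Var mult_single
  by (simp only: add_0 mult_1_right poly_mapping_sum_single[of f, symmetric])

lemma lookup_const_mult:
  "Poly_Mapping.lookup (Poly_Mapping.single 0 a * f) t = a * Poly_Mapping.lookup (f :: ('v, 'k::comm_ring_1) mpoly) t"
  unfolding mult_map_scale_conv_mult[symmetric] by (simp add: Poly_Mapping.map.rep_eq when_def)

section \<open>Change of coefficients\<close>

definition map_coeff :: "('k \<Rightarrow> 'l) \<Rightarrow> ('v, 'k::comm_ring_1) mpoly \<Rightarrow> ('v, 'l::comm_ring_1) mpoly" where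
  "map_coeff h = eval_pm (\<lambda>a. Poly_Mapping.single 0 (h a)) Var"

lemma (in comm_ring_hom) comm_ring_hom_map_coeff: "comm_ring_hom (map_coeff hom :: ('v, 'a) mpoly \<Rightarrow> _)"
proof -
  interpret s: comm_ring_hom "\<lambda>a. Poly_Mapping.single 0 (hom a) :: ('v, 'b) mpoly"
    by unfold_locales (simp_all add: single_add mult_single hom_add hom_mult)
  show ?thesis unfolding map_coeff_def by (rule s.comm_ring_hom_eval_pm)
qed

lemma (in comm_ring_hom) lookup_map_coeff:
  "Poly_Mapping.lookup (map_coeff hom f) t = hom (Poly_Mapping.lookup f t)"
  by (cases "t \<in> Poly_Mapping.keys f")
    (auto simp: map_coeff_def eval_pm_def mon_Var mult_single lookup_sum lookup_single when_def in_keys_iff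
      sum.delta)

lemma (in comm_ring_hom) map_coeff_Var [simp]: "map_coeff hom (Var v) = Var v"
  by (rule poly_mapping_eqI) (simp add: lookup_map_coeff Var_def lookup_single when_def)

lemma (in comm_ring_hom) map_coeff_single:
  "map_coeff hom (Poly_Mapping.single t a) = Poly_Mapping.single t (hom a)"
  by (rule poly_mapping_eqI) (simp add: lookup_map_coeff lookup_single when_def)

section \<open>Degrees and homogeneous components\<close>

lemma mdeg_superset:
  assumes "finite A" "Poly_Mapping.keys t \<subseteq> A"
  shows "mdeg t = (\<Sum>v\<in>A. Poly_Mapping.lookup t v)"
  unfolding mdeg_def using assms by (intro sum.mono_neutral_left) (auto simp: in_keys_iff)

lemma mdeg_add: "mdeg (s + t) = mdeg s + mdeg t"
proof -
  let ?A = "Poly_Mapping.keys s \<union> Poly_Mapping.keys t"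
  have "Poly_Mapping.keys (s + t) \<subseteq> ?A" by (rule keys_add)
  then show ?thesis
    by (simp add: mdeg_superset[of ?A] lookup_add sum.distrib)
qed

lemma mdeg_single [simp]: "mdeg (Poly_Mapping.single v k) = k"
  by (cases "k = 0") (simp_all add: mdeg_def)

lemma mdeg_zero [simp]: "mdeg 0 = 0"
  by (simp add: mdeg_def)

definition homogeneous :: "nat \<Rightarrow> ('v, 'k::comm_ring_1) mpoly \<Rightarrow> bool" where
  "homogeneous d f \<longleftrightarrow> (\<forall>t\<in>Poly_Mapping.keys f. mdeg t = d)"

lemma homogeneous_add: "homogeneous d f \<Longrightarrow> homogeneous d g \<Longrightarrow> homogeneous d (f + g)"
  using keys_add[of f g] by (auto simp: homogeneous_def)

lemma homogeneous_sum: "(\<And>i. i \<in> I \<Longrightarrow> homogeneous d (F i)) \<Longrightarrow> homogeneous d (sum F I)"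
  by (induction I rule: infinite_finite_induct)
    (simp_all add: homogeneous_add, simp_all add: homogeneous_def)

lemma homogeneous_mult: "homogeneous d f \<Longrightarrow> homogeneous e g \<Longrightarrow> homogeneous (d + e) (f * g)"
  using keys_mult[of f g] by (fastforce simp: homogeneous_def mdeg_add)

lemma homogeneous_single [simp]: "mdeg t = d \<Longrightarrow> homogeneous d (Poly_Mapping.single t a)"
  by (cases "a = 0") (simp_all add: homogeneous_def)

lemma homogeneous_Var [simp]: "homogeneous 1 (Var v)"
  by (simp add: Var_def)

lemma homogeneous_const_mult: "homogeneous d f \<Longrightarrow> homogeneous d (Poly_Mapping.single 0 a * f)"
  using homogeneous_mult[of 0 "Poly_Mapping.single 0 a" d f] by simp

lemma homogeneous_mon:
  assumes "\<And>v. v \<in> Poly_Mapping.keys t \<Longrightarrow> homogeneous 1 (\<phi> v)"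
  shows "homogeneous (mdeg t) (mon_eval \<phi> t)"
proof -
  have pow: "homogeneous k (\<phi> v ^ k)" if "v \<in> Poly_Mapping.keys t" for v k
  proof (induction k)
    case (Suc k)
    then show ?case using homogeneous_mult[OF assms[OF that] Suc] by simp
  qed (simp add: homogeneous_def)
  have "homogeneous (\<Sum>v\<in>A. Poly_Mapping.lookup t v) (\<Prod>v\<in>A. \<phi> v ^ Poly_Mapping.lookup t v)"
    if "finite A" "A \<subseteq> Poly_Mapping.keys t" for A
    using that
    by (induction A rule: finite_induct) (auto simp: homogeneous_mult pow, simp add: homogeneous_def)
  then show ?thesis by (simp add: mon_eval_def mdeg_def)
qed

lemma lookup_hom_component:
  "Poly_Mapping.lookup (hom_component d f) t = (if mdeg t = d then Poly_Mapping.lookup f t else 0)"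
  by (auto simp: hom_component_def lookup_sum lookup_single when_def in_keys_iff sum.delta)

lemma hom_component_sum: "hom_component d (sum F I) = (\<Sum>i\<in>I. hom_component d (F i))"
  by (rule poly_mapping_eqI) (simp add: lookup_hom_component lookup_sum)

lemma hom_component_homogeneous:
  "homogeneous e f \<Longrightarrow> hom_component d f = (if d = e then f else 0)"
  by (rule poly_mapping_eqI) (auto simp: lookup_hom_component homogeneous_def in_keys_iff)

text \<open>Linear forms substituted for variables send a monomial of degree \<open>d\<close> into
  degree \<open>d\<close>, so components cannot mix. This keeps ideals homogeneous under the group
  action.\<close>

lemma hom_component_subst:
  assumes "\<And>t v. t \<in> Poly_Mapping.keys f \<Longrightarrow> v \<in> Poly_Mapping.keys t \<Longrightarrow> homogeneous 1 (\<phi> v)"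
  shows "hom_component d (subst \<phi> f) = subst \<phi> (hom_component d f)"
proof -
  have h: "homogeneous (mdeg t) (Poly_Mapping.single 0 a * mon_eval \<phi> t)" if "t \<in> Poly_Mapping.keys f" for t a
    using that assms by (intro homogeneous_const_mult homogeneous_mon) auto
  have "hom_component d (subst \<phi> f) = (\<Sum>t\<in>Poly_Mapping.keys f.
      if d = mdeg t then Poly_Mapping.single 0 (Poly_Mapping.lookup f t) * mon_eval \<phi> t else 0)"
    unfolding subst_eq_eval_pm eval_pm_def hom_component_sum
    by (intro sum.cong refl hom_component_homogeneous h)
  also have "\<dots> = (\<Sum>t\<in>{t \<in> Poly_Mapping.keys f. mdeg t = d}.
      Poly_Mapping.single 0 (Poly_Mapping.lookup f t) * mon_eval \<phi> t)"
    by (simp add: sum.inter_filter eq_commute)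
  also have "\<dots> = subst \<phi> (hom_component d f)"
    by (simp add: hom_component_def subst.hom_sum subst_single)
  finally show ?thesis .
qed

section \<open>Minors of a matrix with columns indexed by terms\<close>

lemma permutes_less: "p permutes {0..<q} \<Longrightarrow> i < q \<Longrightarrow> p i < (q :: nat)"
  using permutes_in_image[of p "{0..<q}" i] by simp

lemma (in comm_ring_hom) hom_plucker_coord:
  "hom (plucker_coord q c L) = plucker_coord q (\<lambda>i \<tau>. hom (c i \<tau>)) L"
  unfolding plucker_coord_def hom_det[symmetric]
  by (rule arg_cong[of _ _ det]) (auto intro: eq_matI)

lemma plucker_coord_cong:
  assumes "\<And>i j. i < q \<Longrightarrow> j < q \<Longrightarrow> c i (L ! j) = d i (M ! j)"
  shows "plucker_coord q c L = plucker_coord q d M"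
  unfolding plucker_coord_def
  by (rule arg_cong[of _ _ det]) (auto intro!: eq_matI assms)

lemma plucker_coord_Leibniz:
  "plucker_coord q c L = (\<Sum>p | p permutes {0..<q}. signof p * (\<Prod>i = 0..<q. c i (L ! p i)))"
proof -
  have "(\<Prod>i = 0..<q. mat q q (\<lambda>(i, j). c i (L ! j)) $$ (i, p i)) = (\<Prod>i = 0..<q. c i (L ! p i))"
    if "p permutes {0..<q}" for p
    using that by (intro prod.cong refl) (simp add: permutes_less)
  then show ?thesis
    unfolding plucker_coord_def by (simp add: det_def)
qed

lemma plucker_coord_permute_rows:
  assumes "p permutes {0..<q}"
  shows "plucker_coord q (\<lambda>i. c (p i)) L = signof p * plucker_coord q c L"
proof -
  have "plucker_coord q (\<lambda>i. c (p i)) L = det (mat q q (\<lambda>(i, j). mat q q (\<lambda>(i, j). c i (L ! j)) $$ (p i, j)))"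
    unfolding plucker_coord_def using assms
    by (intro arg_cong[of _ _ det] eq_matI) (auto simp: permutes_less)
  also have "\<dots> = signof p * det (mat q q (\<lambda>(i, j). c i (L ! j)))"
    by (rule det_permute_rows[OF _ assms]) simp
  finally show ?thesis by (simp add: plucker_coord_def)
qed

lemma plucker_coord_identical_rows:
  assumes "i < q" "j < q" "i \<noteq> j" "c i = c j"
  shows "plucker_coord q c L = 0"
  unfolding plucker_coord_def using assms
  by (intro det_identical_rows[of _ q i j]) (auto intro!: eq_vecI)

lemma plucker_coord_transpose:
  "plucker_coord q c L = det (mat q q (\<lambda>(i, j). c j (L ! i)))"
proof -
  have "mat q q (\<lambda>(i, j). c j (L ! i)) = (mat q q (\<lambda>(i, j). c i (L ! j)))\<^sup>T"
    by (auto intro: eq_matI)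
  then show ?thesis
    unfolding plucker_coord_def by (simp only: det_transpose[OF mat_carrier])
qed

lemma plucker_coord_identical_columns:
  assumes "i < q" "j < q" "i \<noteq> j" "L ! i = L ! j"
  shows "plucker_coord q c L = 0"
  unfolding plucker_coord_transpose using assms
  by (intro det_identical_rows[of _ q i j]) (auto intro!: eq_vecI)

lemma plucker_coord_permute_columns:
  assumes "p permutes {0..<q}" "\<And>i. i < q \<Longrightarrow> M ! i = L ! p i"
  shows "plucker_coord q c M = signof p * plucker_coord q c L"
proof -
  have "plucker_coord q c M = det (mat q q (\<lambda>(i, j). mat q q (\<lambda>(i, j). c j (L ! i)) $$ (p i, j)))"
    unfolding plucker_coord_transpose using assms
    by (intro arg_cong[of _ _ det] eq_matI) (auto simp: permutes_less)
  also have "\<dots> = signof p * det (mat q q (\<lambda>(i, j). c j (L ! i)))"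
    by (rule det_permute_rows[OF _ assms(1)]) simp
  finally show ?thesis by (simp add: plucker_coord_transpose)
qed

lemma permutes_nth_obtain:
  assumes "length L = q" "length M = q" "distinct L" "distinct M" "set L = set M"
  obtains p where "p permutes {0..<q}" "\<And>i. i < q \<Longrightarrow> M ! i = L ! p i"
proof -
  have "mset L = mset M" using assms by (simp add: set_eq_iff_mset_eq_distinct)
  then obtain p where p: "p permutes {..<length M}" "permute_list p M = L"
    by (metis mset_eq_permutation)
  show ?thesis
  proof
    show "inv_into UNIV p permutes {0..<q}"
      using permutes_inv[OF p(1)] assms(2) by (simp add: atLeast0LessThan)
    fix i assume i: "i < q"
    then have "inv_into UNIV p i < q"
      using permutes_in_image[OF permutes_inv[OF p(1)], of i] assms(2) by simp
    then have "L ! inv_into UNIV p i = M ! p (inv_into UNIV p i)"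
      using p assms(2) by (metis permute_list_nth)
    then show "M ! i = L ! inv_into UNIV p i"
      using permutes_inverses[OF p(1)] by simp
  qed
qed

text \<open>Laplace expansion along column \<open>k\<close>. The cofactors do not see that column,
  so they may be taken from the original \<open>L\<close>; the minor becomes visibly linear in the
  inserted column.\<close>

lemma plucker_coord_update:
  assumes "length L = q" "k < q"
  shows "plucker_coord q c (L[k := \<tau>]) =
    (\<Sum>r<q. c r \<tau> * cofactor (mat q q (\<lambda>(i, j). c i (L ! j))) r k)"
proof -
  let ?A = "mat q q (\<lambda>(i, j). c i (L ! j))" and ?B = "mat q q (\<lambda>(i, j). c i (L[k := \<tau>] ! j))"
  have "mat_delete ?B r k = mat_delete ?A r k" if "r < q" for r
    unfolding mat_delete_def using assms that by (intro cong_mat) auto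
  then have cof: "cofactor ?B r k = cofactor ?A r k" if "r < q" for r
    using that by (simp add: cofactor_def)
  have "plucker_coord q c (L[k := \<tau>]) = (\<Sum>r<q. ?B $$ (r, k) * cofactor ?B r k)"
    unfolding plucker_coord_def by (rule laplace_expansion_column) (use assms in auto)
  also have "\<dots> = (\<Sum>r<q. c r \<tau> * cofactor ?A r k)"
    using assms by (intro sum.cong refl) (simp add: cof)
  finally show ?thesis .
qed

text \<open>Cramer's rule expresses the column \<open>N ! i\<close>, scaled by the minor at \<open>L\<close>, in the columns of \<open>L\<close>.\<close>

lemma plucker_exchange:
  fixes c :: "nat \<Rightarrow> trm \<Rightarrow> 'r::comm_ring_1"
  assumes L: "length L = q" and N: "length N = q" and i: "i < q"
  shows "plucker_coord q c N * plucker_coord q c L =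
    (\<Sum>k<q. plucker_coord q c (N[i := L ! k]) * plucker_coord q c (L[k := N ! i]))"
proof -
  let ?A = "mat q q (\<lambda>(i, j). c i (N ! j))" and ?B = "mat q q (\<lambda>(i, j). c i (L ! j))"
  \<comment> \<open>The numerators of Cramer's rule for solving column \<open>N ! i\<close> in the
    columns of \<open>L\<close>.\<close>
  define x where "x k = plucker_coord q c (L[k := N ! i])" for k
  \<comment> \<open>The entries of the matrix times its adjugate; no division by the determinant is
    involved, so this holds over any commutative ring.\<close>
  have adj: "(\<Sum>k<q. c r (L ! k) * cofactor ?B s k) = (if r = s then det ?B else 0)"
    if "r < q" "s < q" for r s
  proof -
    have "(?B * adj_mat ?B) $$ (r, s) = (det ?B \<cdot>\<^sub>m 1\<^sub>m q) $$ (r, s)"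
      using adj_mat(2)[of ?B q] by simp
    moreover have "(?B * adj_mat ?B) $$ (r, s) = (\<Sum>k<q. c r (L ! k) * cofactor ?B s k)"
      using that by (simp add: adj_mat_def scalar_prod_def atLeast0LessThan)
    ultimately show ?thesis using that by simp
  qed
  have Bx: "(\<Sum>k<q. c r (L ! k) * x k) = c r (N ! i) * det ?B" if r: "r < q" for r
  proof -
    have "(\<Sum>k<q. c r (L ! k) * x k) =
        (\<Sum>k<q. \<Sum>s<q. c s (N ! i) * (c r (L ! k) * cofactor ?B s k))"
      using L by (simp add: x_def plucker_coord_update sum_distrib_left mult_ac)
    also have "\<dots> = (\<Sum>s<q. c s (N ! i) * (\<Sum>k<q. c r (L ! k) * cofactor ?B s k))"
      by (subst sum.swap) (simp add: sum_distrib_left)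
    also have "\<dots> = (\<Sum>s<q. if s = r then c s (N ! i) * det ?B else 0)"
      by (intro sum.cong refl) (simp add: adj r)
    also have "\<dots> = c r (N ! i) * det ?B" using r by (simp add: sum.delta)
    finally show ?thesis .
  qed
  \<comment> \<open>Expanding along the inserted column lets the sum over \<open>k\<close> move
    inside, where \<open>Bx\<close> turns it back into column \<open>N ! i\<close>, scaled by the
    minor at \<open>L\<close>.\<close>
  have "(\<Sum>k<q. plucker_coord q c (N[i := L ! k]) * x k) =
      (\<Sum>k<q. \<Sum>r<q. cofactor ?A r i * (c r (L ! k) * x k))"
    using N i by (simp add: plucker_coord_update sum_distrib_left sum_distrib_right mult_ac)
  also have "\<dots> = (\<Sum>r<q. cofactor ?A r i * (\<Sum>k<q. c r (L ! k) * x k))"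
    by (subst sum.swap) (simp add: sum_distrib_left)
  also have "\<dots> = (\<Sum>r<q. cofactor ?A r i * (c r (N ! i) * det ?B))"
    by (intro sum.cong refl) (simp add: Bx)
  also have "\<dots> = (\<Sum>r<q. c r (N ! i) * cofactor ?A r i) * det ?B"
    by (simp add: sum_distrib_left sum_distrib_right mult_ac)
  also have "(\<Sum>r<q. c r (N ! i) * cofactor ?A r i) = plucker_coord q c N"
    using plucker_coord_update[OF N i, of c "N ! i"] by simp
  finally show ?thesis by (simp add: x_def plucker_coord_def)
qed

text \<open>Multilinear expansion in the rows gives one summand for each choice of a middle index
  per row. Choices with a repetition yield equal rows and vanish; an injective choice is a
  \<open>q\<close>-subset with a permutation, and summing over the permutations reassembles a minor
  of \<open>c\<close>. \<open>WS\<close> is any system of duplicate-free lists representing the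
  \<open>q\<close>-subsets.\<close>

lemma cauchy_binet:
  fixes c :: "nat \<Rightarrow> trm \<Rightarrow> 'r::comm_ring_1"
  assumes T: "finite T"
    and WS: "\<And>M. M \<in> WS \<Longrightarrow> length M = q \<and> distinct M \<and> set M \<subseteq> T"
    and bij: "bij_betw set WS {Q. Q \<subseteq> T \<and> card Q = q}"
  shows "plucker_coord q (\<lambda>i \<tau>. \<Sum>\<sigma>\<in>T. c i \<sigma> * a \<sigma> \<tau>) N =
    (\<Sum>M\<in>WS. plucker_coord q c M * plucker_coord q (\<lambda>i. a (M ! i)) N)"
proof -
  let ?S = "{p. p permutes {0..<q}}" and ?F = "{0..<q} \<rightarrow>\<^sub>E T"
  let ?J = "{f \<in> ?F. inj_on f {0..<q}}"
  \<comment> \<open>The contribution of the choice \<open>f\<close>, after the sum over column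
    permutations has been collected into a minor of \<open>a\<close>.\<close>
  define G where "G f = (\<Prod>i = 0..<q. c i (f i)) * plucker_coord q (\<lambda>i. a (f i)) N" for f
  have finF: "finite ?F" using T by (intro finite_PiE) auto
  have "plucker_coord q (\<lambda>i \<tau>. \<Sum>\<sigma>\<in>T. c i \<sigma> * a \<sigma> \<tau>) N =
      (\<Sum>p\<in>?S. signof p * (\<Sum>f\<in>?F. \<Prod>i = 0..<q. c i (f i) * a (f i) (N ! p i)))"
    unfolding plucker_coord_Leibniz using T by (subst prod_sum_PiE) auto
  also have "\<dots> = (\<Sum>p\<in>?S. \<Sum>f\<in>?F. (\<Prod>i = 0..<q. c i (f i)) *
      (signof p * (\<Prod>i = 0..<q. a (f i) (N ! p i))))"
    by (simp add: sum_distrib_left prod.distrib mult_ac)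
  also have "\<dots> = (\<Sum>f\<in>?F. G f)"
    unfolding G_def plucker_coord_Leibniz by (subst sum.swap) (simp add: sum_distrib_left)
  also have "\<dots> = (\<Sum>f\<in>?J. G f)"
  proof (rule sum.mono_neutral_right[OF finF])
    show "\<forall>f\<in>?F - ?J. G f = 0"
    proof
      fix f assume "f \<in> ?F - ?J"
      then obtain i j where "i < q" "j < q" "i \<noteq> j" "f i = f j"
        by (auto simp: inj_on_def)
      then have "plucker_coord q (\<lambda>i. a (f i)) N = 0"
        by (intro plucker_coord_identical_rows[of i q j]) auto
      then show "G f = 0" by (simp add: G_def)
    qed
  qed auto
  also have "\<dots> = (\<Sum>(M, p)\<in>WS \<times> ?S. G (restrict (\<lambda>i. M ! p i) {0..<q}))"
  proof -
    \<comment> \<open>The set of values of an injective choice determines \<open>M\<close>, and the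
      order in which they occur determines \<open>p\<close>. The \<open>restrict\<close> is there
      because the choices are extensional functions.\<close>
    have "bij_betw (\<lambda>(M, p). restrict (\<lambda>i. M ! p i) {0..<q}) (WS \<times> ?S) ?J"
    proof (rule bij_betw_imageI)
      have range: "(\<lambda>i. M ! p i) ` {0..<q} = set M" if "M \<in> WS" "p \<in> ?S" for M p
      proof -
        have "(\<lambda>i. M ! p i) ` {0..<q} = (!) M ` (p ` {0..<q})" by (simp add: image_image)
        also have "\<dots> = set M"
          using that WS[of M] permutes_image[of p "{0..<q}"] nth_image[of q M] by simp
        finally show ?thesis .
      qed
      show "inj_on (\<lambda>(M, p). restrict (\<lambda>i. M ! p i) {0..<q}) (WS \<times> ?S)"
      proof (rule inj_onI, clarify)
        fix M p M' p'
        assume M: "M \<in> WS" "M' \<in> WS" and p: "p permutes {0..<q}" "p' permutes {0..<q}"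
          and eq: "restrict (\<lambda>i. M ! p i) {0..<q} = restrict (\<lambda>i. M' ! p' i) {0..<q}"
        have eq': "M ! p i = M' ! p' i" if "i < q" for i
          using fun_cong[OF eq, of i] that by simp
        have "(\<lambda>i. M ! p i) ` {0..<q} = (\<lambda>i. M' ! p' i) ` {0..<q}"
          by (intro image_cong refl) (simp add: eq')
        then have "set M = set M'"
          using range[of M p] range[of M' p'] M p by simp
        then have MM: "M = M'"
          using bij M by (auto simp: bij_betw_def dest: inj_onD)
        have "p i = p' i" for i
        proof (cases "i < q")
          case True
          then show ?thesis
            using eq'[OF True] WS[OF M(1)] p MM by (simp add: nth_eq_iff_index_eq permutes_less)
        next
          case False
          then show ?thesis using p by (simp add: permutes_def)
        qed
        with MM show "M = M' \<and> p = p'" by auto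
      qed
      show "(\<lambda>(M, p). restrict (\<lambda>i. M ! p i) {0..<q}) ` (WS \<times> ?S) = ?J"
      proof (intro equalityI subsetI)
        fix f assume "f \<in> (\<lambda>(M, p). restrict (\<lambda>i. M ! p i) {0..<q}) ` (WS \<times> ?S)"
        then obtain M p where M: "M \<in> WS" and p: "p permutes {0..<q}"
          and f: "f = restrict (\<lambda>i. M ! p i) {0..<q}"
          by auto
        have "M ! p i \<in> T" if "i < q" for i
          using WS[OF M] permutes_less[OF p that] by (metis nth_mem subsetD)
        moreover have "inj_on f {0..<q}"
        proof (rule inj_onI)
          fix i j assume "i \<in> {0..<q}" "j \<in> {0..<q}" "f i = f j"
          then have "p i = p j"
            using WS[OF M] p by (simp add: f nth_eq_iff_index_eq permutes_less)
          then show "i = j" using permutes_inj[OF p] by (simp add: inj_eq)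
        qed
        ultimately show "f \<in> ?J" by (simp add: f)
      next
        fix f assume f: "f \<in> ?J"
        then have "f ` {0..<q} \<subseteq> T" by auto
        moreover have "card (f ` {0..<q}) = q" using f by (simp add: card_image)
        ultimately have "f ` {0..<q} \<in> set ` WS" using bij by (simp add: bij_betw_def)
        then obtain M where M: "M \<in> WS" "set M = f ` {0..<q}" by (auto simp: image_iff)
        have d: "distinct (map f [0..<q])" using f by (simp add: distinct_map)
        obtain p where p: "p permutes {0..<q}" "\<And>i. i < q \<Longrightarrow> map f [0..<q] ! i = M ! p i"
          by (rule permutes_nth_obtain[of M q "map f [0..<q]"])
            (use M(2) WS[OF M(1)] d in simp_all)
        have "f = restrict (\<lambda>i. M ! p i) {0..<q}"
        proof
          fix i show "f i = restrict (\<lambda>i. M ! p i) {0..<q} i"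
          proof (cases "i < q")
            case True
            then show ?thesis using p(2)[OF True] by simp
          next
            case False
            then show ?thesis using f PiE_arb[of f "{0..<q}" "\<lambda>_. T" i] by simp
          qed
        qed
        then show "f \<in> (\<lambda>(M, p). restrict (\<lambda>i. M ! p i) {0..<q}) ` (WS \<times> ?S)"
          using M(1) p(1) by auto
      qed
    qed
    from sum.reindex_bij_betw[OF this, of G] show ?thesis
      unfolding case_prod_beta by (rule sym)
  qed
  also have "\<dots> = (\<Sum>M\<in>WS. \<Sum>p\<in>?S. G (restrict (\<lambda>i. M ! p i) {0..<q}))"
    by (rule sum.cartesian_product[symmetric])
  also have "\<dots> = (\<Sum>M\<in>WS. plucker_coord q c M * plucker_coord q (\<lambda>i. a (M ! i)) N)"
  proof (intro sum.cong refl)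
    fix M
    have "G (restrict (\<lambda>i. M ! p i) {0..<q}) =
        signof p * (\<Prod>i = 0..<q. c i (M ! p i)) * plucker_coord q (\<lambda>i. a (M ! i)) N"
      if "p \<in> ?S" for p
    proof -
      have "plucker_coord q (\<lambda>i. a (restrict (\<lambda>i. M ! p i) {0..<q} i)) N =
          plucker_coord q (\<lambda>i. a (M ! p i)) N"
        by (rule plucker_coord_cong) simp
      then show ?thesis
        using plucker_coord_permute_rows[of p q "\<lambda>i. a (M ! i)" N] that
        by (simp add: G_def mult_ac)
    qed
    then show "(\<Sum>p\<in>?S. G (restrict (\<lambda>i. M ! p i) {0..<q})) =
        plucker_coord q c M * plucker_coord q (\<lambda>i. a (M ! i)) N"
      by (simp add: plucker_coord_Leibniz[of q c M] sum_distrib_right)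
  qed
  finally show ?thesis .
qed

section \<open>Wedge terms\<close>

lemma finite_terms: "finite (terms n m)"
proof -
  have "Poly_Mapping.lookup t x \<le> m" if "t \<in> terms n m" for t x
  proof (cases "x \<in> Poly_Mapping.keys t")
    case True
    then have "Poly_Mapping.lookup t x \<le> mdeg t"
      unfolding mdeg_def by (intro member_le_sum) auto
    then show ?thesis using that by (simp add: terms_def)
  qed (simp add: in_keys_iff)
  then have "Poly_Mapping.lookup ` terms n m \<subseteq>
      {f. \<forall>x. (x \<in> {0..n} \<longrightarrow> f x \<in> {0..m}) \<and> (x \<notin> {0..n} \<longrightarrow> f x = 0)}"
    by (auto simp: terms_def S_terms_def in_keys_iff subset_iff)
  then have "finite (Poly_Mapping.lookup ` terms n m)"
    by (rule finite_subset[OF _ finite_set_of_finite_funs[OF finite_atLeastAtMost finite_atLeastAtMost]])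
  then show ?thesis
    by (rule finite_imageD) (simp add: inj_on_def lookup_inject)
qed

locale wedge_order =
  fixes n m q :: nat and lt :: "trm \<Rightarrow> trm \<Rightarrow> bool"
  assumes ord: "term_order n lt"
begin

abbreviation "WT \<equiv> wedge_terms n m q lt"
abbreviation "wl \<equiv> wedge_less q lt"

lemma lt_irrefl: "a \<in> S_terms n \<Longrightarrow> \<not> lt a a"
  using ord by (simp add: term_order_def irreflp_on_def)

lemma lt_trans: "lt a b \<Longrightarrow> lt b c \<Longrightarrow> a \<in> S_terms n \<Longrightarrow> b \<in> S_terms n \<Longrightarrow> c \<in> S_terms n \<Longrightarrow> lt a c"
  using ord unfolding term_order_def transp_on_def by blast

lemma lt_total: "a \<in> S_terms n \<Longrightarrow> b \<in> S_terms n \<Longrightarrow> a \<noteq> b \<Longrightarrow> lt a b \<or> lt b a"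
  using ord unfolding term_order_def totalp_on_def by blast

lemma lt_add: "lt a b \<Longrightarrow> a \<in> S_terms n \<Longrightarrow> b \<in> S_terms n \<Longrightarrow> c \<in> S_terms n \<Longrightarrow> lt (a + c) (b + c)"
  using ord unfolding term_order_def by blast

lemma terms_S_terms: "t \<in> terms n m \<Longrightarrow> t \<in> S_terms n"
  by (simp add: terms_def)

lemma WT_D:
  assumes "L \<in> WT"
  shows "length L = q" "set L \<subseteq> terms n m" "distinct L"
    and "i < q \<Longrightarrow> L ! i \<in> terms n m" "i < q \<Longrightarrow> L ! i \<in> S_terms n"
    and "i < j \<Longrightarrow> j < q \<Longrightarrow> lt (L ! j) (L ! i)"
proof -
  show len: "length L = q" and sub: "set L \<subseteq> terms n m"
    using assms by (auto simp: wedge_terms_def)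
  show *: "i < q \<Longrightarrow> L ! i \<in> terms n m" for i using len sub by auto
  then show nth: "i < q \<Longrightarrow> L ! i \<in> S_terms n" for i by (simp add: terms_S_terms)
  show sorted: "i < j \<Longrightarrow> j < q \<Longrightarrow> lt (L ! j) (L ! i)" for i j
    using assms len by (auto simp: wedge_terms_def sorted_wrt_iff_nth_less)
  show "distinct L"
    unfolding distinct_conv_nth
  proof (intro allI impI)
    fix i j assume "i < length L" "j < length L" "i \<noteq> j"
    then show "L ! i \<noteq> L ! j"
      using sorted[of i j] sorted[of j i] lt_irrefl nth len by (metis nat_neq_iff)
  qed
qed

text \<open>Pigeonhole: if \<open>M ! j\<close> were below \<open>L ! j\<close>, then
  \<open>f\<close> would carry the first \<open>j + 1\<close> entries of \<open>L\<close> to terms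
  strictly above \<open>M ! j\<close>, hence injectively into the first \<open>j\<close> entries of
  \<open>M\<close>.\<close>

lemma wedge_dominance:
  assumes L: "L \<in> WT" and M: "M \<in> WT" and inj: "inj_on f (set L)" and im: "f ` set L \<subseteq> set M"
    and le: "\<And>x. x \<in> set L \<Longrightarrow> x = f x \<or> lt x (f x)" and j: "j < q"
  shows "L ! j = M ! j \<or> lt (L ! j) (M ! j)"
proof (rule ccontr)
  assume "\<not> ?thesis"
  then have less: "lt (M ! j) (L ! j)"
    using lt_total WT_D(5)[OF L j] WT_D(5)[OF M j] by blast
  have "f (L ! i) \<in> (!) M ` {..<j}" if "i \<le> j" for i
  proof -
    have i: "i < q" using that j by simp
    have "L ! i \<in> set L" using i WT_D(1)[OF L] by simp
    then obtain k where k: "k < q" "f (L ! i) = M ! k"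
      using im WT_D(1)[OF M] by (metis image_subset_iff in_set_conv_nth)
    have "lt (M ! j) (L ! i)"
      using less that WT_D(6)[OF L, of i j] j lt_trans[OF less] WT_D(5)[OF L] WT_D(5)[OF M] i
      by (cases "i = j") auto
    then have "lt (M ! j) (M ! k)"
      using le[OF \<open>L ! i \<in> set L\<close>] k lt_trans[of "M ! j" "L ! i" "M ! k"] WT_D(5)[OF L i] WT_D(5)[OF M] j
      by auto
    then have "\<not> j \<le> k"
      using WT_D(6)[OF M, of j k] lt_irrefl[OF WT_D(5)[OF M j]] lt_trans[of "M ! j" "M ! k" "M ! j"]
        WT_D(5)[OF M] j k by (cases "j = k") auto
    then show ?thesis using k by auto
  qed
  then have "f ` (!) L ` {..j} \<subseteq> (!) M ` {..<j}" by auto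
  then have "card (f ` (!) L ` {..j}) \<le> card ((!) M ` {..<j})"
    by (intro card_mono) auto
  also have "\<dots> \<le> j" using card_image_le[of "{..<j}" "(!) M"] by simp
  also have "card (f ` (!) L ` {..j}) = card ((!) L ` {..j})"
    using j WT_D(1)[OF L] by (intro card_image inj_on_subset[OF inj]) auto
  also have "\<dots> = Suc j"
    using j WT_D(1,3)[OF L] by (subst card_image) (auto simp: inj_on_def nth_eq_iff_index_eq)
  finally show False by simp
qed

text \<open>Entrywise dominance decides the comparison at the first difference. In this form matrix
  coefficients and exchange relations become comparisons of wedge terms: both supply a map
  \<open>f\<close> matching factors.\<close>

lemma wedge_dominance_imp_le:
  assumes "L \<in> WT" "M \<in> WT" "inj_on f (set L)" "f ` set L \<subseteq> set M"
    and "\<And>x. x \<in> set L \<Longrightarrow> x = f x \<or> lt x (f x)"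
  shows "L = M \<or> wl L M"
proof (rule disjCI)
  assume nl: "\<not> wl L M"
  have "L ! j = M ! j" if "j < q" for j
    using that
  proof (induction j rule: less_induct)
    case (less j)
    then show ?case
      using wedge_dominance[OF assms less.prems] nl by (auto simp: wedge_less_def)
  qed
  then show "L = M" using WT_D(1)[OF assms(1)] WT_D(1)[OF assms(2)] by (simp add: nth_equalityI)
qed

lemma wl_irrefl: "L \<in> WT \<Longrightarrow> \<not> wl L L"
  using WT_D(5) lt_irrefl by (auto simp: wedge_less_def)

lemma wl_trans:
  assumes "wl L M" "wl M N" "L \<in> WT" "M \<in> WT" "N \<in> WT"
  shows "wl L N"
proof -
  obtain j where j: "j < q" "\<forall>i<j. L ! i = M ! i" "lt (L ! j) (M ! j)"
    using assms(1) by (auto simp: wedge_less_def)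
  obtain k where k: "k < q" "\<forall>i<k. M ! i = N ! i" "lt (M ! k) (N ! k)"
    using assms(2) by (auto simp: wedge_less_def)
  have "lt (L ! min j k) (N ! min j k)"
    using j k lt_trans[of "L ! j" "M ! j" "N ! j"] WT_D(5)[OF assms(3)] WT_D(5)[OF assms(4)]
      WT_D(5)[OF assms(5)]
    by (cases j k rule: linorder_cases) auto
  then show ?thesis
    unfolding wedge_less_def using j k by (intro exI[of _ "min j k"]) auto
qed

lemma wl_total:
  assumes "L \<in> WT" "M \<in> WT" "L \<noteq> M"
  shows "wl L M \<or> wl M L"
proof -
  have "\<exists>j. j < q \<and> L ! j \<noteq> M ! j"
    using assms(3) WT_D(1)[OF assms(1)] WT_D(1)[OF assms(2)] by (metis nth_equalityI)
  then obtain j where j: "j < q \<and> L ! j \<noteq> M ! j" and least: "\<forall>i<j. \<not> (i < q \<and> L ! i \<noteq> M ! i)"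
    unfolding exists_least_iff[of "\<lambda>j. j < q \<and> L ! j \<noteq> M ! j"] by blast
  then have j: "j < q" "L ! j \<noteq> M ! j" "\<forall>i<j. L ! i = M ! i" by auto
  then have "lt (L ! j) (M ! j) \<or> lt (M ! j) (L ! j)"
    by (intro lt_total WT_D(5)[OF assms(1)] WT_D(5)[OF assms(2)])
  then show ?thesis using j by (auto simp: wedge_less_def)
qed

lemma wl_asym: "wl L M \<Longrightarrow> L \<in> WT \<Longrightarrow> M \<in> WT \<Longrightarrow> \<not> wl M L"
  using wl_trans wl_irrefl by blast

lemma finite_WT: "finite WT"
  by (rule finite_subset[OF _ finite_lists_length_eq[OF finite_terms, of n m q]])
    (auto simp: wedge_terms_def)

lemma WT_max:
  assumes "A \<subseteq> WT" "A \<noteq> {}"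
  obtains L where "L \<in> A" "\<And>M. M \<in> A \<Longrightarrow> \<not> wl L M"
proof -
  have "finite A" using assms finite_WT finite_subset by blast
  moreover have "asymp_on A wl" using wl_asym assms by (auto intro!: asymp_onI)
  moreover have "transp_on A wl" using wl_trans assms(1) unfolding transp_on_def by blast
  ultimately obtain L where "L \<in> A" "\<forall>M\<in>A. L \<noteq> M \<longrightarrow> \<not> wl L M"
    using Finite_Set.bex_max_element[of A wl, OF _ _ _ assms(2)] by auto
  then have "\<not> wl L M" if "M \<in> A" for M
    using that wl_irrefl assms(1) by (cases "L = M") auto
  then show thesis using \<open>L \<in> A\<close> by (intro that[of L])
qed

text \<open>The identity map dominates in both directions, and the order is asymmetric.\<close>

lemma WT_set_inj:
  assumes "L \<in> WT" "M \<in> WT" "set L = set M"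
  shows "L = M"
  using wedge_dominance_imp_le[OF assms(1,2), of id] wedge_dominance_imp_le[OF assms(2,1), of id]
    wl_asym[OF _ assms(1,2)] assms(3) by auto

lemma WT_sort:
  assumes "Q \<subseteq> terms n m" "card Q = q"
  obtains L where "L \<in> WT" "set L = Q"
proof -
  have "\<exists>L. length L = k \<and> set L = Q \<and> sorted_wrt (\<lambda>a b. lt b a) L"
    if "Q \<subseteq> terms n m" "card Q = k" for k Q
    using that
  proof (induction k arbitrary: Q)
    case 0
    then have "Q = {}" using finite_subset[OF _ finite_terms[of n m]] by simp
    then show ?case by (intro exI[of _ "[]"]) simp
  next
    case (Suc k)
    have S: "Q \<subseteq> S_terms n" using Suc.prems(1) terms_S_terms by blast
    have fin: "finite Q" using finite_subset[OF Suc.prems(1) finite_terms] .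
    have "asymp_on Q lt"
    proof (rule asymp_onI)
      fix x y assume "x \<in> Q" "y \<in> Q" "lt x y"
      then show "\<not> lt y x" using S lt_trans[of x y x] lt_irrefl[of x] by auto
    qed
    moreover have "transp_on Q lt" using ord S transp_on_subset[of "S_terms n" lt Q] by (simp add: term_order_def)
    moreover have "Q \<noteq> {}" using Suc.prems by auto
    ultimately obtain x where x: "x \<in> Q" "\<forall>y\<in>Q. x \<noteq> y \<longrightarrow> \<not> lt x y"
      using Finite_Set.bex_max_element[OF fin, of lt] by metis
    have "Q - {x} \<subseteq> terms n m" using Suc.prems(1) by blast
    moreover have "card (Q - {x}) = k" using Suc.prems(2) x(1) by simp
    ultimately have "\<exists>L. length L = k \<and> set L = Q - {x} \<and> sorted_wrt (\<lambda>a b. lt b a) L"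
      by (rule Suc.IH)
    then obtain L where L: "length L = k" "set L = Q - {x}" "sorted_wrt (\<lambda>a b. lt b a) L"
      by (elim exE conjE)
    have "lt y x" if "y \<in> set L" for y
      using x that lt_total[of x y] S L(2) by auto
    then have "length (x # L) = Suc k \<and> set (x # L) = Q \<and> sorted_wrt (\<lambda>a b. lt b a) (x # L)"
      using L x(1) by (simp add: insert_absorb)
    then show ?case by (rule exI)
  qed
  from this[OF assms] obtain L where "length L = q" "set L = Q" "sorted_wrt (\<lambda>a b. lt b a) L"
    by (elim exE conjE)
  moreover from this have "L \<in> WT" using assms(1) by (simp add: wedge_terms_def)
  ultimately show thesis using that by blast
qed

text \<open>Makes \<open>WT\<close> a system of representatives as required by
  \<open>cauchy_binet\<close>.\<close>

lemma bij_betw_set_WT: "bij_betw set WT {Q. Q \<subseteq> terms n m \<and> card Q = q}"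
proof (rule bij_betw_imageI)
  show "inj_on set WT" by (rule inj_onI) (rule WT_set_inj)
  show "set ` WT = {Q. Q \<subseteq> terms n m \<and> card Q = q}"
  proof (intro equalityI subsetI)
    fix Q assume "Q \<in> {Q. Q \<subseteq> terms n m \<and> card Q = q}"
    then have "Q \<subseteq> terms n m" "card Q = q" by simp_all
    then obtain L where "L \<in> WT" "set L = Q" by (rule WT_sort)
    then show "Q \<in> set ` WT" by blast
  next
    fix Q assume "Q \<in> set ` WT"
    then obtain L where L: "L \<in> WT" "Q = set L" by blast
    show "Q \<in> {Q. Q \<subseteq> terms n m \<and> card Q = q}"
      using WT_D(1-3)[OF L(1)] by (simp add: L(2) distinct_card)
  qed
qed

end

section \<open>The action on wedge terms\<close>

definition vars_in :: "'v set \<Rightarrow> ('v, 'k::comm_ring_1) mpoly \<Rightarrow> bool" where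
  "vars_in V f \<longleftrightarrow> (\<forall>t\<in>Poly_Mapping.keys f. Poly_Mapping.keys t \<subseteq> V)"

lemma vars_in_zero [simp]: "vars_in V 0"
  by (simp add: vars_in_def)

lemma vars_in_add: "vars_in V f \<Longrightarrow> vars_in V g \<Longrightarrow> vars_in V (f + g)"
  using keys_add[of f g] by (auto simp: vars_in_def)

lemma vars_in_uminus: "vars_in V f \<Longrightarrow> vars_in V (- f)"
  by (simp add: vars_in_def in_keys_iff)

lemma vars_in_sum: "(\<And>i. i \<in> I \<Longrightarrow> vars_in V (F i)) \<Longrightarrow> vars_in V (sum F I)"
  by (induction I rule: infinite_finite_induct) (simp_all add: vars_in_add)

lemma vars_in_const [simp]: "vars_in V (Poly_Mapping.single 0 a)"
  by (cases "a = 0") (simp_all add: vars_in_def)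

lemma vars_in_one [simp]: "vars_in V 1"
  by (simp add: vars_in_def)

lemma vars_in_Var: "v \<in> V \<Longrightarrow> vars_in V (Var v)"
  by (simp add: vars_in_def Var_def)

lemma vars_in_mult:
  assumes "vars_in V f" "vars_in V g"
  shows "vars_in V (f * g)"
  unfolding vars_in_def
proof
  fix t assume "t \<in> Poly_Mapping.keys (f * g)"
  then obtain a b where ab: "t = a + b" "a \<in> Poly_Mapping.keys f" "b \<in> Poly_Mapping.keys g"
    using keys_mult[of f g] by blast
  then show "Poly_Mapping.keys t \<subseteq> V"
    using assms keys_add[of a b] unfolding vars_in_def by blast
qed

lemma vars_in_power: "vars_in V f \<Longrightarrow> vars_in V (f ^ k)"
  by (induction k) (simp_all add: vars_in_mult)

lemma vars_in_prod: "(\<And>i. i \<in> I \<Longrightarrow> vars_in V (F i)) \<Longrightarrow> vars_in V (prod F I)"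
  by (induction I rule: infinite_finite_induct) (simp_all add: vars_in_mult)

lemma vars_in_subst:
  assumes "\<And>t v. t \<in> Poly_Mapping.keys f \<Longrightarrow> v \<in> Poly_Mapping.keys t \<Longrightarrow> vars_in V (\<phi> v)"
  shows "vars_in V (subst \<phi> f)"
  unfolding subst_def using assms
  by (intro vars_in_sum vars_in_mult vars_in_const vars_in_prod vars_in_power) auto

lemma subst_eq_sum_single:
  "subst \<phi> f = (\<Sum>t\<in>Poly_Mapping.keys f. Poly_Mapping.single 0 (Poly_Mapping.lookup f t) *
     subst \<phi> (Poly_Mapping.single t 1))"
  by (simp add: subst_eq_eval_pm eval_pm_def comm_ring_hom.eval_pm_single[OF comm_ring_hom_single])

text \<open>The image of the variable \<open>i\<close> under \<open>g\<close>. Entries range over a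
  commutative ring rather than a field because the matrix \<open>g + s\<close> is later taken with
  \<open>s\<close> an indeterminate.\<close>

definition lin_form :: "nat \<Rightarrow> 'k::comm_ring_1 mat \<Rightarrow> nat \<Rightarrow> (nat, 'k) mpoly" where
  "lin_form n g i = (\<Sum>j\<le>n. Poly_Mapping.single 0 (g $$ (i, j)) * Var j)"

lemma act_poly_eq: "act_poly n g = subst (lin_form n g)"
  by (simp add: act_poly_def lin_form_def[abs_def])

definition term_coeff :: "nat \<Rightarrow> 'k::comm_ring_1 mat \<Rightarrow> trm \<Rightarrow> trm \<Rightarrow> 'k" where
  "term_coeff n g \<sigma> \<tau> = Poly_Mapping.lookup (subst (lin_form n g) (Poly_Mapping.single \<sigma> 1)) \<tau>"

lemma homogeneous_lin_form: "homogeneous 1 (lin_form n g i)"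
  unfolding lin_form_def
  by (intro homogeneous_sum homogeneous_const_mult homogeneous_Var)

lemma vars_in_lin_form: "vars_in {0..n} (lin_form n g i)"
  unfolding lin_form_def by (intro vars_in_sum vars_in_mult vars_in_const vars_in_Var) auto

lemma term_coeff_eq_0:
  assumes "\<sigma> \<in> terms n m" "\<tau> \<notin> terms n m"
  shows "term_coeff n g \<sigma> \<tau> = 0"
proof -
  let ?f = "subst (lin_form n g) (Poly_Mapping.single \<sigma> 1)"
  have "homogeneous (mdeg \<sigma>) ?f"
    using homogeneous_mon[OF homogeneous_lin_form] by (simp add: subst_single)
  moreover have "vars_in {0..n} ?f"
    by (intro vars_in_subst vars_in_lin_form)
  ultimately have "\<tau> \<notin> Poly_Mapping.keys ?f"
    using assms by (auto simp: homogeneous_def vars_in_def terms_def S_terms_def)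
  then show ?thesis by (simp add: term_coeff_def in_keys_iff)
qed

text \<open>Substitutions compose in the reverse order of the matrices: the form of \<open>h\<close>
  is written first and \<open>g\<close> is substituted into it. All later product formulas inherit
  this order.\<close>

lemma lin_form_mult:
  fixes g h :: "'k::comm_ring_1 mat"
  assumes "g \<in> carrier_mat (n + 1) (n + 1)" "h \<in> carrier_mat (n + 1) (n + 1)" "i \<le> n"
  shows "subst (lin_form n g) (lin_form n h i) = lin_form n (h * g) i"
proof -
  have "subst (lin_form n g) (lin_form n h i) =
      (\<Sum>j\<le>n. \<Sum>k\<le>n. Poly_Mapping.single 0 (h $$ (i, j) * g $$ (j, k)) * Var k)"
    unfolding lin_form_def[of n h]
    by (simp add: subst.hom_sum subst.hom_mult)
      (simp add: lin_form_def sum_distrib_left mult_single mult.assoc[symmetric])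
  also have "\<dots> = (\<Sum>k\<le>n. (\<Sum>j\<le>n. Poly_Mapping.single 0 (h $$ (i, j) * g $$ (j, k))) * Var k)"
    by (subst sum.swap) (simp add: sum_distrib_right)
  also have "\<dots> = (\<Sum>k\<le>n. Poly_Mapping.single 0 ((h * g) $$ (i, k)) * Var k)"
  proof (intro sum.cong refl arg_cong2[where f = "(*)"])
    fix k assume "k \<in> {..n}"
    then have "(h * g) $$ (i, k) = (\<Sum>j\<le>n. h $$ (i, j) * g $$ (j, k))"
      using assms by (simp add: scalar_prod_def atLeast0LessThan lessThan_Suc_atMost)
    then show "(\<Sum>j\<le>n. Poly_Mapping.single 0 (h $$ (i, j) * g $$ (j, k))) =
        (Poly_Mapping.single 0 ((h * g) $$ (i, k)) :: (nat, 'k) mpoly)"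
      by (simp only: const.hom_sum)
  qed
  finally show ?thesis by (simp add: lin_form_def)
qed

lemma term_coeff_mult:
  assumes "g \<in> carrier_mat (n + 1) (n + 1)" "h \<in> carrier_mat (n + 1) (n + 1)" "\<sigma> \<in> terms n m"
  shows "term_coeff n (h * g) \<sigma> \<tau> = (\<Sum>\<rho>\<in>terms n m. term_coeff n h \<sigma> \<rho> * term_coeff n g \<rho> \<tau>)"
proof -
  let ?h = "subst (lin_form n h) (Poly_Mapping.single \<sigma> 1)"
  have "subst (lin_form n g) ?h = subst (lin_form n (h * g)) (Poly_Mapping.single \<sigma> 1)"
    unfolding subst_subst using assms lin_form_mult[OF assms(1,2)]
    by (intro subst_cong) (auto simp: terms_def S_terms_def subset_iff split: if_splits)
  then have "term_coeff n (h * g) \<sigma> \<tau> =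
      Poly_Mapping.lookup (\<Sum>\<rho>\<in>Poly_Mapping.keys ?h. Poly_Mapping.single 0 (Poly_Mapping.lookup ?h \<rho>) *
        subst (lin_form n g) (Poly_Mapping.single \<rho> 1)) \<tau>"
    by (simp add: term_coeff_def flip: subst_eq_sum_single)
  also have "\<dots> = (\<Sum>\<rho>\<in>Poly_Mapping.keys ?h. term_coeff n h \<sigma> \<rho> * term_coeff n g \<rho> \<tau>)"
    by (simp add: lookup_sum lookup_const_mult term_coeff_def)
  also have "\<dots> = (\<Sum>\<rho>\<in>terms n m. term_coeff n h \<sigma> \<rho> * term_coeff n g \<rho> \<tau>)"
  proof (rule sum.mono_neutral_left[OF finite_terms])
    show "Poly_Mapping.keys ?h \<subseteq> terms n m"
      using term_coeff_eq_0[OF assms(3), of _ h] by (auto simp: term_coeff_def in_keys_iff)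
  qed (auto simp: term_coeff_def in_keys_iff)
  finally show ?thesis .
qed

lemma term_coeff_diag:
  assumes "\<sigma> \<in> S_terms n"
  shows "term_coeff n (mat (n + 1) (n + 1) (\<lambda>(i, j). if i = j then t i else 0)) \<sigma> \<tau> =
    (if \<tau> = \<sigma> then mon_eval t \<sigma> else 0)"
proof -
  let ?g = "mat (n + 1) (n + 1) (\<lambda>(i, j). if i = j then t i else 0)"
  have "lin_form n ?g i = Poly_Mapping.single 0 (t i) * Var i" if "i \<le> n" for i
  proof -
    have "lin_form n ?g i = (\<Sum>j\<le>n. if j = i then Poly_Mapping.single 0 (t i) * Var i else 0)"
      unfolding lin_form_def using that by (intro sum.cong refl) auto
    then show ?thesis using that by (simp add: sum.delta)
  qed
  then have "mon_eval (lin_form n ?g) \<sigma> = mon_eval (\<lambda>i. Poly_Mapping.single 0 (t i) * Var i) \<sigma>"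
    unfolding mon_eval_def using assms by (intro prod.cong refl) (auto simp: S_terms_def)
  also have "\<dots> = mon_eval (\<lambda>i. Poly_Mapping.single 0 (t i)) \<sigma> * mon_eval Var \<sigma>"
    by (simp add: mon_eval_def power_mult_distrib prod.distrib)
  also have "\<dots> = Poly_Mapping.single \<sigma> (mon_eval t \<sigma>)"
    by (simp add: mon_Var mult_single flip: const.hom_mon)
  finally show ?thesis by (simp add: term_coeff_def subst_single lookup_single when_def)
qed

text \<open>The coefficients are built from the entries of \<open>g\<close> by ring operations only.
  Applied to evaluation at \<open>s\<close>, this specialises a matrix of polynomials.\<close>

lemma (in comm_ring_hom) term_coeff_hom:
  assumes "g \<in> carrier_mat (n + 1) (n + 1)" "\<sigma> \<in> S_terms n"
  shows "hom (term_coeff n g \<sigma> \<tau>) = term_coeff n (map_mat hom g) \<sigma> \<tau>"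
proof -
  interpret mc: comm_ring_hom "map_coeff hom :: (nat, 'a) mpoly \<Rightarrow> _"
    by (rule comm_ring_hom_map_coeff)
  have "map_coeff hom (lin_form n g i) = lin_form n (map_mat hom g) i" if "i \<le> n" for i
    unfolding lin_form_def using assms(1) that
    by (simp add: mc.hom_sum mc.hom_mult map_coeff_single)
  then have "map_coeff hom (mon_eval (lin_form n g) \<sigma>) = mon_eval (lin_form n (map_mat hom g)) \<sigma>"
    unfolding mc.hom_mon unfolding mon_eval_def using assms(2)
    by (intro prod.cong refl) (auto simp: S_terms_def)
  then show ?thesis
    by (simp add: term_coeff_def subst_single flip: lookup_map_coeff)
qed

context wedge_order
begin

text \<open>If \<open>M\<close> differs from \<open>L\<close>, some factor of \<open>L\<close> is
  missing in \<open>M\<close>, and its row is zero in the columns of \<open>M\<close>. The lemma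
  serves both diagonal matrices and the coordinates of a coordinate subspace.\<close>

lemma plucker_coord_delta:
  assumes "L \<in> WT" "M \<in> WT"
  shows "plucker_coord q (\<lambda>i \<tau>. if \<tau> = L ! i then x i else 0) M =
    (if M = L then \<Prod>i<q. x i else (0 :: 'r::comm_ring_1))"
proof (cases "M = L")
  case True
  let ?A = "mat q q (\<lambda>(i, j). if L ! j = L ! i then x i else 0)"
  have eq: "L ! i = L ! j \<longleftrightarrow> i = j" if "i < q" "j < q" for i j
    using that WT_D(1,3)[OF assms(1)] by (simp add: nth_eq_iff_index_eq)
  \<comment> \<open>By \<open>eq\<close> the matrix is diagonal, since the entries of
    \<open>L\<close> are distinct.\<close>
  have "det ?A = prod_list (diag_mat ?A)"
    by (rule det_upper_triangular[of _ q]) (auto simp: eq)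
  also have "\<dots> = (\<Prod>i<q. x i)"
    by (simp add: prod_list_diag_prod atLeast0LessThan)
  finally show ?thesis using True by (simp add: plucker_coord_def)
next
  case False
  have "\<not> set L \<subseteq> set M"
  proof
    assume "set L \<subseteq> set M"
    then have "set L = set M"
      using WT_D(1,3)[OF assms(1)] WT_D(1,3)[OF assms(2)]
      by (intro card_subset_eq) (auto simp: distinct_card)
    then show False using False WT_set_inj assms by blast
  qed
  then obtain a where "a \<in> set L" "a \<notin> set M" by blast
  then obtain i where i: "i < q" "L ! i \<notin> set M"
    using WT_D(1)[OF assms(1)] by (metis in_set_conv_nth)
  have "(\<Prod>i = 0..<q. if M ! p i = L ! i then x i else 0) = 0" if "p permutes {0..<q}" for p
  proof (rule prod_zero)
    have "M ! p i \<in> set M" using permutes_less[OF that i(1)] WT_D(1)[OF assms(2)] by simp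
    then show "\<exists>i\<in>{0..<q}. (if M ! p i = L ! i then x i else 0) = 0"
      using i by (intro bexI[of _ i]) auto
  qed simp
  then show ?thesis using False by (simp add: plucker_coord_Leibniz)
qed

text \<open>The matrix of \<open>g\<close> on the exterior power, with row \<open>L\<close> listing
  the coordinates of \<open>g(L)\<close>. Unlike \<open>act_wedge\<close> it makes sense over any
  commutative ring.\<close>

definition wedge_coeff :: "'k::comm_ring_1 mat \<Rightarrow> wedge_trm \<Rightarrow> wedge_trm \<Rightarrow> 'k" where
  "wedge_coeff g L M = plucker_coord q (\<lambda>i. term_coeff n g (L ! i)) M"

lemma lookup_act_wedge:
  "Poly_Mapping.lookup (act_wedge n m q lt g L) M = (if M \<in> WT then wedge_coeff g L M else 0)"
  by (simp add: act_wedge_def lookup_sum lookup_single when_def finite_WT wedge_coeff_def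
      term_coeff_def[abs_def] act_poly_eq)

text \<open>Functoriality of the exterior power: Cauchy-Binet applied to the product formula for
  \<open>term_coeff\<close>.\<close>

lemma wedge_coeff_mult:
  fixes g h :: "'k::comm_ring_1 mat"
  assumes "g \<in> carrier_mat (n + 1) (n + 1)" "h \<in> carrier_mat (n + 1) (n + 1)" "L \<in> WT"
  shows "wedge_coeff (h * g) L N = (\<Sum>M\<in>WT. wedge_coeff h L M * wedge_coeff g M N)"
proof -
  have "wedge_coeff (h * g) L N =
      plucker_coord q (\<lambda>i \<tau>. \<Sum>\<rho>\<in>terms n m. term_coeff n h (L ! i) \<rho> * term_coeff n g \<rho> \<tau>) N"
    unfolding wedge_coeff_def
    by (intro plucker_coord_cong term_coeff_mult[OF assms(1,2)] WT_D(4)[OF assms(3)])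
  also have "\<dots> = (\<Sum>M\<in>WT. wedge_coeff h L M * wedge_coeff g M N)"
    unfolding wedge_coeff_def
    by (rule cauchy_binet[OF finite_terms _ bij_betw_set_WT]) (auto dest: WT_D)
  finally show ?thesis .
qed

lemma wedge_coeff_diag:
  assumes "L \<in> WT" "M \<in> WT"
  shows "wedge_coeff (mat (n + 1) (n + 1) (\<lambda>(i, j). if i = j then t i else 0)) L M =
    (if M = L then \<Prod>i<q. mon_eval t (L ! i) else 0)"
  unfolding wedge_coeff_def plucker_coord_delta[OF assms, symmetric]
  by (intro plucker_coord_cong term_coeff_diag WT_D(5)[OF assms(1)])

lemma wedge_coeff_one:
  assumes "L \<in> WT" "M \<in> WT"
  shows "wedge_coeff (1\<^sub>m (n + 1)) L M = (if M = L then 1 else 0 :: 'k::comm_ring_1)"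
  using wedge_coeff_diag[OF assms, of "\<lambda>_. 1 :: 'k"]
  by (simp only: one_mat_def mon_eval_def power_one prod.neutral_const)

end

section \<open>Points of the Grassmannian\<close>

lemma inverse_mat_obtain:
  fixes A :: "'k::field mat"
  assumes A: "A \<in> carrier_mat n n" and d: "det A \<noteq> 0"
  obtains B where "B \<in> carrier_mat n n" "A * B = 1\<^sub>m n" "B * A = 1\<^sub>m n"
proof -
  let ?B = "inverse (det A) \<cdot>\<^sub>m adj_mat A"
  have adj: "adj_mat A \<in> carrier_mat n n" using A by (rule adj_mat)
  have "A * ?B = 1\<^sub>m n"
    using mult_smult_distrib[OF A adj] adj_mat(2)[OF A] d by (simp del: One_nat_def)
      (auto intro!: eq_matI)
  moreover have "?B * A = 1\<^sub>m n"
    using mult_smult_assoc_mat[OF adj A] adj_mat(3)[OF A] d by (simp del: One_nat_def)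
      (auto intro!: eq_matI)
  moreover have "?B \<in> carrier_mat n n" using adj by simp
  ultimately show thesis using that by blast
qed

context wedge_order
begin

abbreviation "CR \<equiv> coord_ring n m q lt"
abbreviation "PB \<equiv> pullback n m q lt"
abbreviation "AP \<equiv> act_point n m q lt"
abbreviation "PI \<equiv> plucker_ideal n m q lt"
abbreviation "GP \<equiv> topspace (Gr n m q lt)"

lemma carrier_CR: "carrier CR = {f. vars_in WT f}"
  by (simp add: coord_ring_def vars_in_def)

lemma CR_simps:
  "f \<oplus>\<^bsub>CR\<^esub> g = f + g" "f \<otimes>\<^bsub>CR\<^esub> g = f * g" "\<zero>\<^bsub>CR\<^esub> = 0" "\<one>\<^bsub>CR\<^esub> = 1"
  by (simp_all add: coord_ring_def)

lemma cring_CR: "cring (CR :: ((wedge_trm, 'k::field) mpoly) ring)"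
proof (rule cringI)
  show "abelian_group (CR :: ((wedge_trm, 'k::field) mpoly) ring)"
  proof (rule abelian_groupI)
    fix x :: "(wedge_trm, 'k) mpoly" assume "x \<in> carrier CR"
    then show "\<exists>y\<in>carrier CR. y \<oplus>\<^bsub>CR\<^esub> x = \<zero>\<^bsub>CR\<^esub>"
      by (intro bexI[of _ "- x"]) (simp_all add: carrier_CR CR_simps vars_in_uminus)
  qed (simp_all add: carrier_CR CR_simps vars_in_add add_ac)
  show "Group.comm_monoid (CR :: ((wedge_trm, 'k::field) mpoly) ring)"
    by (rule comm_monoidI) (simp_all add: carrier_CR CR_simps vars_in_mult mult_ac)
qed (simp add: CR_simps distrib_right)

text \<open>The linear form \<Delta>_L composed with \<open>g\<close>. It gathers the coefficients
  of \<open>L\<close> in all \<open>g(M)\<close>, thus a column of the matrix whose rows describe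
  \<open>act_wedge\<close>.\<close>

definition pform :: "'k::field mat \<Rightarrow> wedge_trm \<Rightarrow> (wedge_trm, 'k) mpoly" where
  "pform g L = (\<Sum>M\<in>WT. Poly_Mapping.single 0 (Poly_Mapping.lookup (act_wedge n m q lt g M) L) * Var M)"

lemma pullback_eq: "PB g = subst (pform g)"
  by (simp add: pullback_def pform_def[abs_def])

lemma pform_eq: "L \<in> WT \<Longrightarrow> pform g L = (\<Sum>M\<in>WT. Poly_Mapping.single 0 (wedge_coeff g M L) * Var M)"
  by (simp add: pform_def lookup_act_wedge)

lemma vars_in_pform: "vars_in WT (pform g L)"
  unfolding pform_def by (intro vars_in_sum vars_in_mult vars_in_const vars_in_Var)

lemma homogeneous_pform: "homogeneous 1 (pform g L)"
  unfolding pform_def by (intro homogeneous_sum homogeneous_const_mult homogeneous_Var)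

lemma pullback_carrier: "PB g f \<in> carrier CR"
  by (simp add: pullback_eq carrier_CR vars_in_subst vars_in_pform)

lemma pullback_pullback:
  assumes "g \<in> carrier_mat (n + 1) (n + 1)" "h \<in> carrier_mat (n + 1) (n + 1)" "f \<in> carrier CR"
  shows "PB h (PB g f) = PB (h * g) f"
proof -
  have "subst (pform h) (pform g L) = pform (h * g) L" if "L \<in> WT" for L
  proof -
    have "subst (pform h) (pform g L) = (\<Sum>M\<in>WT. \<Sum>N\<in>WT.
        Poly_Mapping.single 0 (wedge_coeff h N M * wedge_coeff g M L) * Var N)"
      by (simp add: pform_eq that subst.hom_sum subst.hom_mult sum_distrib_left)
        (simp add: mult_single mult_ac flip: mult.assoc)
    also have "\<dots> = (\<Sum>N\<in>WT. (\<Sum>M\<in>WT.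
        Poly_Mapping.single 0 (wedge_coeff h N M * wedge_coeff g M L)) * Var N)"
      by (subst sum.swap) (simp add: sum_distrib_right)
    also have "\<dots> = pform (h * g) L"
      using assms by (simp add: pform_eq that wedge_coeff_mult const.hom_sum)
    finally show ?thesis .
  qed
  then show ?thesis
    unfolding pullback_eq subst_subst using assms(3)
    by (intro subst_cong) (auto simp: carrier_CR vars_in_def)
qed

lemma pullback_one:
  assumes "f \<in> carrier CR"
  shows "PB (1\<^sub>m (n + 1)) f = f"
proof -
  have "pform (1\<^sub>m (n + 1)) L = Var L" if "L \<in> WT" for L
  proof -
    have "pform (1\<^sub>m (n + 1)) L = (\<Sum>M\<in>WT. if M = L then Var M else 0)"
      unfolding pform_eq[OF that] using that by (intro sum.cong refl) (simp add: wedge_coeff_one del: One_nat_def)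
    then show ?thesis using that finite_WT by (simp add: sum.delta)
  qed
  then have "PB (1\<^sub>m (n + 1)) f = subst Var f"
    unfolding pullback_eq using assms by (intro subst_cong) (auto simp: carrier_CR vars_in_def)
  then show ?thesis by simp
qed

text \<open>Applying \<open>g\<close> amounts to multiplying the generic matrix on the right. By
  Cauchy-Binet the minors of the product are the pulled-back linear forms in the generic minors, so
  a relation among generic minors pulls back to a relation.\<close>

lemma pullback_plucker_ideal:
  fixes f :: "(wedge_trm, 'k::field) mpoly"
  assumes "f \<in> PI"
  shows "PB g f \<in> PI"
proof -
  let ?plk = "plucker_coord q (\<lambda>i \<tau>. Var (i, \<tau>) :: (nat \<times> trm, 'k) mpoly)"
  \<comment> \<open>Replaces the generic matrix by its product with the matrix of \<open>g\<close>
    on the terms of degree \<open>m\<close>.\<close>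
  let ?\<psi> = "\<lambda>(i, \<tau>). \<Sum>\<sigma>\<in>terms n m. Var (i, \<sigma>) * Poly_Mapping.single 0 (term_coeff n g \<sigma> \<tau>)
    :: (nat \<times> trm, 'k) mpoly"
  have "subst ?plk (pform g L) = subst ?\<psi> (?plk L)" if "L \<in> WT" for L
  proof -
    have "subst ?\<psi> (?plk L) = plucker_coord q (\<lambda>i \<tau>. \<Sum>\<sigma>\<in>terms n m. Var (i, \<sigma>) *
        Poly_Mapping.single 0 (term_coeff n g \<sigma> \<tau>)) L"
      by (simp add: subst.hom_plucker_coord)
    also have "\<dots> = (\<Sum>M\<in>WT. ?plk M * plucker_coord q (\<lambda>i \<tau>. Poly_Mapping.single 0 (term_coeff n g (M ! i) \<tau>)) L)"
      by (rule cauchy_binet[OF finite_terms _ bij_betw_set_WT]) (auto dest: WT_D)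
    also have "\<dots> = (\<Sum>M\<in>WT. Poly_Mapping.single 0 (wedge_coeff g M L) * ?plk M)"
      by (simp add: wedge_coeff_def const.hom_plucker_coord mult.commute)
    also have "\<dots> = subst ?plk (pform g L)"
      by (simp add: pform_eq that subst.hom_sum subst.hom_mult)
    finally show ?thesis by simp
  qed
  then have "subst ?plk (PB g f) = subst ?\<psi> (subst ?plk f)"
    unfolding pullback_eq subst_subst using assms
    by (intro subst_cong) (auto simp: plucker_ideal_def carrier_CR vars_in_def)
  then show ?thesis
    using assms by (simp add: plucker_ideal_def pullback_carrier)
qed

lemma GP_eq: "GP = {P \<in> proj_points n m q lt. PI \<subseteq> P}"
  by (auto simp: Gr_def topspace_proj_space)

lemma openin_Gr: "openin (Gr n m q lt :: 'k::field point topology) U \<longleftrightarrow>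
    (\<exists>A \<subseteq> carrier CR. U = {P \<in> GP. \<not> A \<subseteq> P})"
proof -
  have "{P \<in> proj_points n m q lt. \<not> A \<subseteq> P} \<inter> {P. PI \<subseteq> P} = {P \<in> GP. \<not> A \<subseteq> P}"
    for A :: "'k point"
    unfolding GP_eq by auto
  note eq = this
  show ?thesis
  proof
    assume "openin (Gr n m q lt :: 'k point topology) U"
    then obtain T where T: "openin (proj_space n m q lt :: 'k point topology) T" "U = T \<inter> {P. PI \<subseteq> P}"
      unfolding Gr_def openin_subtopology by (elim exE conjE)
    from T(1) obtain A :: "'k point" where "A \<subseteq> carrier CR" "T = {P \<in> proj_points n m q lt. \<not> A \<subseteq> P}"
      unfolding openin_proj_space by (elim exE conjE)
    with T(2) eq show "\<exists>A \<subseteq> carrier CR. U = {P \<in> GP. \<not> A \<subseteq> P}"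
      by (intro exI[of _ A] conjI) simp_all
  next
    assume "\<exists>A \<subseteq> carrier CR. U = {P \<in> GP. \<not> A \<subseteq> P}"
    then obtain A :: "'k point" where "A \<subseteq> carrier CR" "U = {P \<in> GP. \<not> A \<subseteq> P}"
      by (elim exE conjE)
    then have "openin (subtopology (proj_space n m q lt) {P. PI \<subseteq> P}) U"
      unfolding openin_subtopology openin_proj_space
      by (intro exI[of _ "{P \<in> proj_points n m q lt. \<not> A \<subseteq> P}"] conjI exI[of _ A])
        (simp_all only: eq)
    then show "openin (Gr n m q lt :: 'k point topology) U"
      by (simp add: Gr_def)
  qed
qed

lemma ring_hom_ring_pullback: "ring_hom_ring CR CR (PB g :: (wedge_trm, 'k::field) mpoly \<Rightarrow> _)"
proof (rule ring_hom_ringI2)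
  show "ring (CR :: ((wedge_trm, 'k) mpoly) ring)" "ring (CR :: ((wedge_trm, 'k) mpoly) ring)"
    using cring_CR by (auto simp: cring_def)
  show "PB g \<in> Ring.ring_hom CR CR"
    by (rule ring_hom_memI) (simp_all add: pullback_carrier CR_simps, simp_all add: pullback_eq subst.hom_add subst.hom_mult)
qed

section \<open>Calculation modulo a point\<close>

context
  fixes P :: "'k::field point"
  assumes P: "P \<in> GP"
begin

lemma point_primeideal: "primeideal P CR"
  using P by (simp add: GP_eq proj_points_def)

lemma point_subset: "P \<subseteq> carrier CR"
proof -
  interpret primeideal P CR by (rule point_primeideal)
  show ?thesis by (rule a_subset)
qed

lemma point_zero: "0 \<in> P"
proof -
  interpret primeideal P CR by (rule point_primeideal)
  show ?thesis using additive_subgroup.zero_closed[OF additive_subgroup_axioms] by (simp add: CR_simps)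
qed

lemma point_add: "f \<in> P \<Longrightarrow> g \<in> P \<Longrightarrow> f + g \<in> P"
proof -
  interpret primeideal P CR by (rule point_primeideal)
  show "f \<in> P \<Longrightarrow> g \<in> P \<Longrightarrow> f + g \<in> P"
    using additive_subgroup.a_closed[OF additive_subgroup_axioms] by (simp add: CR_simps)
qed

lemma point_mult: "f \<in> P \<Longrightarrow> g \<in> carrier CR \<Longrightarrow> g * f \<in> P"
proof -
  interpret primeideal P CR by (rule point_primeideal)
  show "f \<in> P \<Longrightarrow> g \<in> carrier CR \<Longrightarrow> g * f \<in> P"
    using I_l_closed[of f g] by (simp add: CR_simps)
qed

lemma point_prime: "f * g \<in> P \<Longrightarrow> f \<in> carrier CR \<Longrightarrow> g \<in> carrier CR \<Longrightarrow> f \<in> P \<or> g \<in> P"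
proof -
  interpret primeideal P CR by (rule point_primeideal)
  show "f * g \<in> P \<Longrightarrow> f \<in> carrier CR \<Longrightarrow> g \<in> carrier CR \<Longrightarrow> f \<in> P \<or> g \<in> P"
    using I_prime[of f g] by (simp add: CR_simps)
qed

lemma point_const_mult: "f \<in> P \<Longrightarrow> Poly_Mapping.single 0 a * f \<in> P"
  using point_mult[of f "Poly_Mapping.single 0 a"] by (simp add: carrier_CR)

lemma point_uminus: "f \<in> P \<Longrightarrow> - f \<in> P"
  using point_const_mult[of f "- 1"] by (simp add: single_uminus)

lemma point_diff: "f \<in> P \<Longrightarrow> g \<in> P \<Longrightarrow> f - g \<in> P"
  using point_add[of f "- g"] point_uminus[of g] by simp

lemma point_sum: "(\<And>i. i \<in> I \<Longrightarrow> F i \<in> P) \<Longrightarrow> sum F I \<in> P"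
  by (induction I rule: infinite_finite_induct) (simp_all add: point_zero point_add)

lemma point_const_mult_cancel:
  assumes "Poly_Mapping.single 0 a * f \<in> P" "a \<noteq> 0"
  shows "f \<in> P"
proof -
  have "Poly_Mapping.single 0 (inverse a) * (Poly_Mapping.single 0 a * f) \<in> P"
    by (rule point_const_mult) fact
  then show ?thesis using assms(2) by (simp add: mult_single flip: mult.assoc)
qed

lemma point_Var: obtains L where "L \<in> WT" "Var L \<notin> P"
  using P by (auto simp: GP_eq proj_points_def)

lemma point_plucker: "f \<in> PI \<Longrightarrow> f \<in> P"
  using P by (auto simp: GP_eq)

lemma point_hom_component: "f \<in> P \<Longrightarrow> hom_component d f \<in> P"
  using P by (auto simp: GP_eq proj_points_def)

lemma mem_act_point: "f \<in> AP g P \<longleftrightarrow> f \<in> carrier CR \<and> PB g f \<in> P"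
  by (simp add: act_point_def)

lemma act_point_one: "AP (1\<^sub>m (n + 1)) P = P"
  using point_subset by (auto simp: act_point_def pullback_one simp del: One_nat_def)

end

section \<open>Invertible matrices and their action on points\<close>

lemma GL_carrier: "g \<in> GL n \<Longrightarrow> g \<in> carrier_mat (n + 1) (n + 1)"
  by (simp add: GL_def)

lemma GL_inverse:
  assumes "g \<in> (GL n :: 'k::field mat set)"
  obtains h where "h \<in> GL n" "h * g = 1\<^sub>m (n + 1)" "g * h = 1\<^sub>m (n + 1)"
proof -
  have g: "g \<in> carrier_mat (n + 1) (n + 1)" using assms by (rule GL_carrier)
  obtain h where h: "inverts_mat g h" "inverts_mat h g"
    using assms by (auto simp: GL_def invertible_mat_def)
  then have gh: "g * h = 1\<^sub>m (n + 1)" and hg: "h * g = 1\<^sub>m (dim_row h)"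
    using g by (auto simp: inverts_mat_def)
  have "dim_col h = n + 1" using arg_cong[OF gh, of dim_col] by simp
  moreover have "dim_row h = n + 1" using arg_cong[OF hg, of dim_col] g by simp
  ultimately have hc: "h \<in> carrier_mat (n + 1) (n + 1)" by auto
  moreover from this have "h \<in> GL n"
    using h by (auto simp: GL_def invertible_mat_def)
  ultimately show thesis using that gh hg by simp
qed

lemma GL_iff_det:
  assumes g: "g \<in> carrier_mat (n + 1) (n + 1)"
  shows "g \<in> GL n \<longleftrightarrow> det g \<noteq> (0 :: 'k::field)"
proof
  assume "g \<in> GL n"
  then obtain h where h: "h \<in> GL n" "g * h = 1\<^sub>m (n + 1)" using GL_inverse by metis
  then have "det g * det h = 1"
    using det_mult[OF g GL_carrier[OF h(1)]] by simp
  then show "det g \<noteq> 0" by auto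
next
  assume d: "det g \<noteq> 0"
  obtain h where h: "h \<in> carrier_mat (n + 1) (n + 1)" "g * h = 1\<^sub>m (n + 1)" "h * g = 1\<^sub>m (n + 1)"
    using inverse_mat_obtain[OF g d] .
  then show "g \<in> GL n"
    using g by (auto simp: GL_def invertible_mat_def inverts_mat_def intro!: exI[of _ h])
qed

lemma one_GL: "1\<^sub>m (n + 1) \<in> (GL n :: 'k::field mat set)"
  by (subst GL_iff_det) auto

lemma mult_GL: "g \<in> GL n \<Longrightarrow> h \<in> GL n \<Longrightarrow> g * h \<in> (GL n :: 'k::field mat set)"
  using GL_carrier[of g] GL_carrier[of h] GL_iff_det[of g] GL_iff_det[of h] GL_iff_det[of "g * h"]
    det_mult[of g "n + 1" h] by auto

text \<open>Taking preimages under pullbacks reverses their order, so the factors appear as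
  \<open>h * g\<close>. Orbits do not feel this, since \<open>GL n\<close> is closed under products
  and inverses.\<close>

lemma act_point_act_point:
  assumes "g \<in> carrier_mat (n + 1) (n + 1)" "h \<in> carrier_mat (n + 1) (n + 1)"
  shows "AP g (AP h P) = AP (h * g) P"
  using pullback_carrier[of g] pullback_pullback[OF assms] by (auto simp: act_point_def)

lemma act_point_GP:
  assumes P: "P \<in> GP" and g: "g \<in> (GL n :: 'k::field mat set)"
  shows "AP g P \<in> GP"
proof -
  have "primeideal (AP g P) CR"
    using ring_hom_ring.primeideal_vimage[OF ring_hom_ring_pullback cring_CR point_primeideal[OF P]]
    by (simp add: act_point_def)
  moreover have "hom_component d f \<in> AP g P" if "f \<in> AP g P" for f d
  proof -
    have "PB g (hom_component d f) = hom_component d (PB g f)"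
      unfolding pullback_eq by (rule hom_component_subst[symmetric]) (rule homogeneous_pform)
    moreover have "hom_component d f \<in> carrier CR"
      using that by (auto simp: carrier_CR mem_act_point[OF P] vars_in_def in_keys_iff lookup_hom_component
          split: if_splits)
    ultimately show ?thesis
      using that point_hom_component[OF P] by (simp add: mem_act_point[OF P])
  qed
  moreover have "\<not> Var ` WT \<subseteq> AP g P"
  proof
    assume sub: "Var ` WT \<subseteq> AP g P"
    obtain h where h: "h \<in> GL n" "h * g = 1\<^sub>m (n + 1)" "g * h = 1\<^sub>m (n + 1)"
      using GL_inverse[OF g] .
    obtain L where L: "L \<in> WT" "Var L \<notin> P" using point_Var[OF P] .
    have Var: "Var L \<in> carrier CR" using L by (simp add: carrier_CR vars_in_Var)
    \<comment> \<open>The inverse matrix recovers \<Delta>_L as a combination of the transformed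
      coordinates; were all of these in \<open>P\<close>, so would be \<Delta>_L.\<close>
    have "PB g (PB h (Var L)) = PB g (\<Sum>M\<in>WT. Poly_Mapping.single 0 (wedge_coeff h M L) * Var M)"
      using L by (simp add: pullback_eq[of h] pform_eq)
    also have "\<dots> = (\<Sum>M\<in>WT. Poly_Mapping.single 0 (wedge_coeff h M L) * PB g (Var M))"
      by (simp add: pullback_eq subst.hom_sum subst.hom_mult)
    also have "\<dots> \<in> P"
      using sub by (intro point_sum[OF P] point_const_mult[OF P]) (auto simp: mem_act_point[OF P])
    also have "PB g (PB h (Var L)) = Var L"
      using pullback_pullback[OF GL_carrier[OF h(1)] GL_carrier[OF g] Var] pullback_one[OF Var] h by simp
    finally show False using L by simp
  qed
  moreover have "PI \<subseteq> AP g P"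
  proof
    fix f :: "(wedge_trm, 'k) mpoly" assume f: "f \<in> PI"
    then have "PB g f \<in> P" by (intro point_plucker[OF P] pullback_plucker_ideal)
    then show "f \<in> AP g P" using f by (simp add: mem_act_point[OF P] plucker_ideal_def)
  qed
  ultimately show ?thesis by (auto simp: GP_eq proj_points_def)
qed

end

section \<open>Initial terms and torus weights\<close>

lemma mon_eval_sum: "mon_eval t (sum F A) = (\<Prod>i\<in>A. mon_eval t (F i))"
  by (induction A rule: infinite_finite_induct) (simp_all add: mon_add)

lemma mon_eval_mult: "mon_eval (\<lambda>i. a i * b i) \<sigma> = mon_eval a \<sigma> * mon_eval b \<sigma>"
  by (simp add: mon_eval_def power_mult_distrib prod.distrib)

lemma infinite_field_power_neq:
  assumes "infinite (UNIV :: 'k::field set)" "d \<noteq> e"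
  obtains s :: "'k::field" where "s \<noteq> 0" "s ^ d \<noteq> s ^ e"
proof -
  let ?p = "monom 1 d - monom 1 e :: 'k poly"
  have "coeff ?p d = 1" using assms(2) by simp
  then have "?p \<noteq> 0" by (metis coeff_0 zero_neq_one)
  then have "finite {s. poly ?p s = 0}" by (rule poly_roots_finite)
  then have "finite ({0} \<union> {s. poly ?p s = 0})" by blast
  then obtain s where "s \<notin> {0} \<union> {s. poly ?p s = 0}"
    using ex_new_if_finite[OF assms(1)] by blast
  then show thesis by (intro that[of s]) (auto simp: poly_monom)
qed

lemma S_terms_add: "a \<in> S_terms n \<Longrightarrow> b \<in> S_terms n \<Longrightarrow> a + b \<in> S_terms n"
  using keys_add[of a b] unfolding S_terms_def by blast

lemma S_terms_sum: "(\<And>i. i \<in> A \<Longrightarrow> F i \<in> S_terms n) \<Longrightarrow> sum F A \<in> S_terms n"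
  by (induction A rule: infinite_finite_induct) (auto simp: S_terms_add, auto simp: S_terms_def)

context wedge_order
begin

abbreviation "UC \<equiv> U_chart n m q lt"
abbreviation "INI \<equiv> ini n m q lt"
abbreviation "GIN \<equiv> gin n m q lt"
abbreviation "ORB \<equiv> orbit n m q lt"

lemma ini_eqI:
  assumes "L \<in> WT" "UC L \<inter> W \<noteq> {}" "\<And>M. M \<in> WT \<Longrightarrow> wl L M \<Longrightarrow> UC M \<inter> W = {}"
  shows "INI W = L"
  unfolding ini_def
proof (rule the_equality)
  show "L \<in> WT \<and> UC L \<inter> W \<noteq> {} \<and> (\<forall>M\<in>WT. UC M \<inter> W \<noteq> {} \<longrightarrow> M = L \<or> wl M L)"
    using assms wl_total by blast
  fix M assume M: "M \<in> WT \<and> UC M \<inter> W \<noteq> {} \<and> (\<forall>N\<in>WT. UC N \<inter> W \<noteq> {} \<longrightarrow> N = M \<or> wl N M)"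
  then have M: "M \<in> WT" "UC M \<inter> W \<noteq> {}" "L \<noteq> M \<Longrightarrow> wl L M"
    using assms(1,2) by auto
  then show "M = L" using assms(3)[OF M(1)] by blast
qed

lemma ini_props:
  assumes "W \<subseteq> GP" "W \<noteq> {}"
  shows "INI W \<in> WT" "UC (INI W) \<inter> W \<noteq> {}" "\<And>M. M \<in> WT \<Longrightarrow> wl (INI W) M \<Longrightarrow> UC M \<inter> W = {}"
proof -
  let ?A = "{L \<in> WT. UC L \<inter> W \<noteq> {}}"
  obtain P where P: "P \<in> W" "P \<in> GP" using assms by blast
  obtain M where M: "M \<in> WT" "Var M \<notin> P" using point_Var[OF P(2)] .
  then have "P \<in> UC M" using P by (simp add: U_chart_def)
  then have ne: "?A \<noteq> {}" using P M by blast
  have "?A \<subseteq> WT" by blast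
  from this ne obtain L where L: "L \<in> ?A" "\<And>M. M \<in> ?A \<Longrightarrow> \<not> wl L M"
    by (rule WT_max) (rule that)
  then have "INI W = L" by (intro ini_eqI) auto
  then show "INI W \<in> WT" "UC (INI W) \<inter> W \<noteq> {}" "\<And>M. M \<in> WT \<Longrightarrow> wl (INI W) M \<Longrightarrow> UC M \<inter> W = {}"
    using L by auto
qed

text \<open>Exchange relations produce unsorted lists, whereas the coordinate ring has variables
  only for decreasing ones. The element \<open>v\<close> represents the minor at \<open>X\<close>:
  zero if a term repeats, otherwise the sorted variable with the sign of the sorting
  permutation.\<close>

lemma signed_Var:
  fixes X :: "trm list"
  assumes X: "length X = q" "set X \<subseteq> terms n m"
  shows "\<exists>v\<in>carrier CR. subst (plucker_coord q (\<lambda>i \<tau>. Var (i, \<tau>))) v =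
      plucker_coord q (\<lambda>i \<tau>. Var (i, \<tau>) :: (nat \<times> trm, 'k::field) mpoly) X \<and>
    (v = 0 \<or> distinct X \<and> (\<exists>Y\<in>WT. set Y = set X \<and> (v = Var Y \<or> v = - Var Y)))"
proof (cases "distinct X")
  case False
  then obtain i j where "i < q" "j < q" "i \<noteq> j" "X ! i = X ! j"
    using X by (auto simp: distinct_conv_nth)
  then show ?thesis
    by (intro bexI[of _ 0]) (simp_all add: plucker_coord_identical_columns carrier_CR)
next
  case True
  then have "card (set X) = q" using X(1) by (simp add: distinct_card)
  with X(2) obtain Y where Y: "Y \<in> WT" "set Y = set X" by (rule WT_sort)
  obtain p where p: "p permutes {0..<q}" "\<And>i. i < q \<Longrightarrow> X ! i = Y ! p i"
    by (rule permutes_nth_obtain[OF WT_D(1)[OF Y(1)] X(1) WT_D(3)[OF Y(1)] True Y(2)]) (rule that)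
  have Xp: "plucker_coord q (\<lambda>i \<tau>. Var (i, \<tau>) :: (nat \<times> trm, 'k) mpoly) X =
      signof p * plucker_coord q (\<lambda>i \<tau>. Var (i, \<tau>)) Y"
    using p by (rule plucker_coord_permute_columns)
  have "sign p = 1 \<or> sign p = - 1" by (auto simp: sign_def)
  then show ?thesis
  proof
    assume "sign p = 1"
    then show ?thesis using True Y Xp
      by (intro bexI[of _ "Var Y"]) (auto simp: carrier_CR vars_in_Var)
  next
    assume "sign p = - 1"
    then show ?thesis using True Y Xp
      by (intro bexI[of _ "- Var Y"]) (auto simp: carrier_CR vars_in_Var vars_in_uminus subst.hom_uminus)
  qed
qed

text \<open>The exchange relation lies in \<open>P\<close> but the product of its two left-hand
  coordinates does not, \<open>P\<close> being prime. Hence some summand is outside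
  \<open>P\<close>, and then so are both of its factors. This is symmetric basis exchange for the
  coordinates non-zero at \<open>P\<close>.\<close>

lemma point_exchange:
  fixes P :: "'k::field point"
  assumes P: "P \<in> GP" and N: "N \<in> WT" "Var N \<notin> P" and L: "L \<in> WT" "Var L \<notin> P" and i: "i < q"
  obtains k N' L' where "k < q" "N' \<in> WT" "Var N' \<notin> P" "L' \<in> WT" "Var L' \<notin> P"
    "distinct (N[i := L ! k])" "set N' = set (N[i := L ! k])" "set L' = set (L[k := N ! i])"
proof -
  let ?plk = "plucker_coord q (\<lambda>i \<tau>. Var (i, \<tau>) :: (nat \<times> trm, 'k) mpoly)"
  \<comment> \<open>\<open>v k\<close> and \<open>w k\<close> will represent the two minors in the
    summand \<open>k\<close> of the exchange relation.\<close>
  define good where "good X v \<longleftrightarrow> v \<in> carrier CR \<and> subst ?plk v = ?plk X \<and>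
    (v = 0 \<or> distinct X \<and> (\<exists>Y\<in>WT. set Y = set X \<and> (v = Var Y \<or> v = - Var Y)))" for X v
  define v where "v k = (SOME v. good (N[i := L ! k]) v)" for k
  define w where "w k = (SOME v. good (L[k := N ! i]) v)" for k
  have ex: "\<exists>v. good X v" if "length X = q" "set X \<subseteq> terms n m" for X
    using signed_Var[OF that] by (auto simp: good_def)
  have "\<exists>v. good (N[i := L ! k]) v" if "k < q" for k
    using WT_D(1,2,4)[OF N(1)] WT_D(1,2,4)[OF L(1)] that i
    by (intro ex) (auto dest!: set_update_subset_insert[THEN subsetD])
  then have v: "k < q \<Longrightarrow> good (N[i := L ! k]) (v k)" for k
    unfolding v_def by (rule someI_ex)
  have "\<exists>v. good (L[k := N ! i]) v" if "k < q" for k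
    using WT_D(1,2,4)[OF N(1)] WT_D(1,2,4)[OF L(1)] that i
    by (intro ex) (auto dest!: set_update_subset_insert[THEN subsetD])
  then have w: "k < q \<Longrightarrow> good (L[k := N ! i]) (w k)" for k
    unfolding w_def by (rule someI_ex)
  let ?s = "\<Sum>k<q. v k * w k"
  have car: "(Var N :: (wedge_trm, 'k) mpoly) \<in> carrier CR" "(Var L :: (wedge_trm, 'k) mpoly) \<in> carrier CR"
    using N L by (simp_all add: carrier_CR vars_in_Var)
  have "vars_in WT ?s"
    using v w by (intro vars_in_sum vars_in_mult) (auto simp: good_def carrier_CR)
  moreover have "vars_in WT (Var N * Var L :: (wedge_trm, 'k) mpoly)"
    using car by (simp add: carrier_CR vars_in_mult)
  ultimately have "Var N * Var L - ?s \<in> carrier CR"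
    using vars_in_add[OF _ vars_in_uminus[of WT ?s], of "Var N * Var L"] by (simp add: carrier_CR)
  moreover have "subst ?plk (Var N * Var L - ?s) = 0"
    using plucker_exchange[OF WT_D(1)[OF L(1)] WT_D(1)[OF N(1)] i, of "\<lambda>i \<tau>. Var (i, \<tau>) :: (nat \<times> trm, 'k) mpoly"]
      v w by (simp add: subst.hom_minus subst.hom_mult subst.hom_sum good_def)
  ultimately have "Var N * Var L - ?s \<in> PI" by (simp add: plucker_ideal_def)
  then have diff: "Var N * Var L - ?s \<in> P" by (rule point_plucker[OF P])
  \<comment> \<open>Only here does primality enter: a sum of elements of \<open>P\<close> would
    force the left-hand product into \<open>P\<close>.\<close>
  have "\<exists>k<q. v k * w k \<notin> P"
  proof (rule ccontr)
    assume "\<not> ?thesis"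
    then have "?s \<in> P" by (intro point_sum[OF P]) auto
    from point_add[OF P diff this] have "Var N * Var L \<in> P" by simp
    then show False using point_prime[OF P] car N L by blast
  qed
  then obtain k where k: "k < q" "v k * w k \<notin> P" by blast
  have "v k \<notin> P" using k w[OF k(1)] point_mult[OF P, of "v k" "w k"] by (auto simp: good_def mult.commute)
  moreover from this have "v k \<noteq> 0" using point_zero[OF P] by auto
  ultimately obtain N' where N': "distinct (N[i := L ! k])" "N' \<in> WT" "set N' = set (N[i := L ! k])"
    "v k = Var N' \<or> v k = - Var N'" "v k \<notin> P"
    using v[OF k(1)] by (auto simp: good_def)
  have "w k \<notin> P" using k v[OF k(1)] point_mult[OF P, of "w k" "v k"] by (auto simp: good_def)
  moreover from this have "w k \<noteq> 0" using point_zero[OF P] by auto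
  ultimately obtain L' where L': "L' \<in> WT" "set L' = set (L[k := N ! i])"
    "w k = Var L' \<or> w k = - Var L'" "w k \<notin> P"
    using w[OF k(1)] by (auto simp: good_def)
  have "Var N' \<notin> P" "Var L' \<notin> P"
    using N' L' point_uminus[OF P] by auto
  then show thesis using that[OF k(1)] N' L' by blast
qed

text \<open>The non-zero coordinates behave like the bases of a matroid whose lexicographically
  largest basis is \<open>L\<close>. Exchanging a term of \<open>N\<close> outside \<open>L\<close>
  for one of \<open>L\<close> brings \<open>N\<close> closer to \<open>L\<close> and raises the
  product of its terms; a sum of exponent vectors is such a product.\<close>

lemma weight_less:
  fixes P :: "'k::field point"
  assumes P: "P \<in> GP" and L: "L \<in> WT" "Var L \<notin> P" and max: "\<And>M. M \<in> WT \<Longrightarrow> wl L M \<Longrightarrow> Var M \<in> P"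
  shows "N \<in> WT \<Longrightarrow> Var N \<notin> P \<Longrightarrow> N = L \<or> lt (\<Sum>(set N)) (\<Sum>(set L))"
proof (induction "card (set N - set L)" arbitrary: N rule: less_induct)
  case less
  note N = less.prems
  have S: "set N \<subseteq> S_terms n" "set L \<subseteq> S_terms n"
    using WT_D(2) N(1) L(1) terms_S_terms by blast+
  show ?case
  proof (cases "set N \<subseteq> set L")
    case True
    then have "set N = set L"
      using WT_D(1,3)[OF N(1)] WT_D(1,3)[OF L(1)] by (intro card_subset_eq) (auto simp: distinct_card)
    then show ?thesis using WT_set_inj N(1) L(1) by blast
  next
    case False
    then obtain a where a: "a \<in> set N" "a \<notin> set L" by blast
    then obtain i where i: "i < q" "a = N ! i"
      using WT_D(1)[OF N(1)] by (metis in_set_conv_nth)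
    obtain k N' L' where k: "k < q" and N': "N' \<in> WT" "Var N' \<notin> P" and L': "L' \<in> WT" "Var L' \<notin> P"
      and dN: "distinct (N[i := L ! k])" and sets: "set N' = set (N[i := L ! k])" "set L' = set (L[k := N ! i])"
      using point_exchange[OF P N L i(1)] .
    define b where "b = L ! k"
    have b: "b \<in> set L" using k WT_D(1)[OF L(1)] by (simp add: b_def)
    have sN': "set N' = insert b (set N - {a})"
      using sets(1) WT_D(1,3)[OF N(1)] i by (simp add: set_update_distinct b_def)
    have sL': "set L' = insert a (set L - {b})"
      using sets(2) WT_D(1,3)[OF L(1)] k i by (simp add: set_update_distinct b_def)
    \<comment> \<open>If \<open>b\<close> already occurred in \<open>N\<close>, then
      \<open>N'\<close> would have one term too few.\<close>
    have bN: "b \<notin> set N"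
    proof
      assume "b \<in> set N"
      then have "set N' = set N - {a}" using sN' a b by auto
      moreover have "card (set N') = q" "card (set N) = q"
        using WT_D(1,3)[OF N'(1)] WT_D(1,3)[OF N(1)] by (simp_all add: distinct_card)
      ultimately show False using a(1) i(1) by simp
    qed
    \<comment> \<open>Otherwise replacing \<open>b\<close> by the larger \<open>a\<close> turns
      \<open>L\<close> into the non-zero coordinate \<open>L'\<close> above it, against maximality.
      This is what the second factor of the exchange is for.\<close>
    have ab: "lt a b"
    proof (rule ccontr)
      assume "\<not> lt a b"
      then have ba: "lt b a" using lt_total[of a b] a b S by auto
      have "L = L' \<or> wl L L'"
        by (rule wedge_dominance_imp_le[OF L(1) L'(1), of "\<lambda>x. if x = b then a else x"])
          (use ba a sL' in \<open>auto simp: inj_on_def split: if_splits\<close>)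
      then show False using max[OF L'(1)] L'(2) a sL' by auto
    qed
    let ?c = "\<Sum>(set N - {a})"
    have "lt (a + ?c) (b + ?c)"
      using ab a b S by (intro lt_add S_terms_sum) auto
    moreover have "\<Sum>(set N) = a + ?c" using a by (simp add: sum.remove)
    moreover have "\<Sum>(set N') = b + ?c" using sN' bN by simp
    ultimately have NN': "lt (\<Sum>(set N)) (\<Sum>(set N'))" by simp
    have "set N' - set L = (set N - set L) - {a}" using sN' b by auto
    moreover have "card ((set N - set L) - {a}) < card (set N - set L)"
      using a by (intro card_Diff1_less) auto
    ultimately have "card (set N' - set L) < card (set N - set L)" by simp
    then have "N' = L \<or> lt (\<Sum>(set N')) (\<Sum>(set L))"
      using less.hyps N' by blast
    moreover have "\<Sum>(set X) \<in> S_terms n" if "X \<in> WT" for X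
      using WT_D(2)[OF that] terms_S_terms by (intro S_terms_sum) blast
    ultimately show ?thesis
      using NN' lt_trans[OF NN', of "\<Sum>(set L)"] N(1) L(1) N'(1) by auto
  qed
qed

text \<open>Artin's argument for the independence of distinct characters, modulo \<open>P\<close>.\<close>

lemma point_character_coefficient:
  fixes P :: "'k::field point" and \<chi> :: "'i \<Rightarrow> (nat \<Rightarrow> 'k) \<Rightarrow> 'k"
  defines "T \<equiv> {t. \<forall>i. t i \<noteq> 0}"
  assumes P: "P \<in> GP"
    and mult: "\<And>i a t. \<chi> i (\<lambda>j. a j * t j) = \<chi> i a * \<chi> i t" and one: "\<chi> i0 (\<lambda>_. 1) = 1"
    and J: "finite J" "i0 \<notin> J" "\<And>i. i \<in> J \<Longrightarrow> \<exists>a\<in>T. \<chi> i a \<noteq> \<chi> i0 a"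
    and sum: "\<And>t. t \<in> T \<Longrightarrow> (\<Sum>i\<in>insert i0 J. Poly_Mapping.single 0 (\<chi> i t) * v i) \<in> P"
  shows "v i0 \<in> P"
  using J sum
proof (induction J arbitrary: v rule: finite_induct)
  case empty
  have "(\<lambda>_. 1) \<in> T" by (simp add: T_def)
  then show ?case using empty.prems(3)[of "\<lambda>_. 1"] one by simp
next
  case (insert j J)
  obtain a where a: "a \<in> T" "\<chi> j a \<noteq> \<chi> i0 a" using insert.prems by blast
  \<comment> \<open>The factor is zero at \<open>j\<close>, which drops out, and non-zero at
    \<open>i0\<close>, so it can be cancelled there at the end.\<close>
  let ?w = "\<lambda>i. Poly_Mapping.single 0 (\<chi> i a - \<chi> j a) * v i"
  let ?K = "insert i0 (insert j J)"
  have red: "(\<Sum>i\<in>insert i0 J. Poly_Mapping.single 0 (\<chi> i t) * ?w i) \<in> P" if t: "t \<in> T" for t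
  proof -
    have at: "(\<lambda>j. a j * t j) \<in> T" using a(1) t by (simp add: T_def)
    \<comment> \<open>Compare the relation at the translate of \<open>t\<close> by \<open>a\<close>
      with the relation at \<open>t\<close> multiplied by the value of character \<open>j\<close> at
      \<open>a\<close>.\<close>
    have "(\<Sum>i\<in>?K. Poly_Mapping.single 0 (\<chi> i (\<lambda>j. a j * t j)) * v i)
        - Poly_Mapping.single 0 (\<chi> j a) * (\<Sum>i\<in>?K. Poly_Mapping.single 0 (\<chi> i t) * v i) \<in> P"
      by (intro point_diff[OF P] point_const_mult[OF P] insert.prems(3) at t)
    also have "(\<Sum>i\<in>?K. Poly_Mapping.single 0 (\<chi> i (\<lambda>j. a j * t j)) * v i)
        - Poly_Mapping.single 0 (\<chi> j a) * (\<Sum>i\<in>?K. Poly_Mapping.single 0 (\<chi> i t) * v i)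
        = (\<Sum>i\<in>?K. Poly_Mapping.single 0 (\<chi> i t) * ?w i)"
      unfolding sum_distrib_left sum_subtractf[symmetric] mult.assoc[symmetric] mult_single mult
      by (intro sum.cong refl) (simp add: algebra_simps single_diff)
    also have "\<dots> = (\<Sum>i\<in>insert i0 J. Poly_Mapping.single 0 (\<chi> i t) * ?w i)"
    proof (rule sum.mono_neutral_right)
      show "\<forall>i\<in>?K - insert i0 J. Poly_Mapping.single 0 (\<chi> i t) * ?w i = 0"
      proof
        fix i assume "i \<in> ?K - insert i0 J"
        then have "i = j" by blast
        then show "Poly_Mapping.single 0 (\<chi> i t) * ?w i = 0" by simp
      qed
    qed (use insert.hyps(1) in \<open>simp, blast\<close>)
    finally show ?thesis .
  qed
  have "i0 \<notin> J" using insert.prems(1) by blast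
  moreover have "\<exists>a\<in>T. \<chi> i a \<noteq> \<chi> i0 a" if "i \<in> J" for i
    using insert.prems(2)[of i] that by blast
  ultimately have "?w i0 \<in> P" using red by (rule insert.IH)
  moreover have "\<chi> i0 a - \<chi> j a \<noteq> 0" using a(2) by simp
  ultimately show ?case by (rule point_const_mult_cancel[OF P])
qed

end

section \<open>Products of upper and lower triangular matrices\<close>

text \<open>The upper factor stands on the left because row \<open>L\<close> of a product meets the
  left factor first: a Borel term is kept on its line by \<open>u\<close> before \<open>l\<close>
  lowers it. Accordingly elimination starts from the bottom right corner.\<close>

definition upper_lower_decomposable :: "nat \<Rightarrow> 'k::field mat \<Rightarrow> bool" where
  "upper_lower_decomposable n g \<longleftrightarrow> (\<exists>u l. u \<in> carrier_mat n n \<and> l \<in> carrier_mat n n \<and>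
     upper_triangular u \<and> (\<forall>i j. i < j \<longrightarrow> j < n \<longrightarrow> l $$ (i, j) = 0) \<and>
     det u \<noteq> 0 \<and> det l \<noteq> 0 \<and> g = u * l)"

text \<open>Block elimination against the trailing block \<open>D\<close>: the border of the factors
  solves \<open>x * l = R\<close> and \<open>u * y = C\<close>, and the new corner entry is the
  Schur complement \<open>E\<close>.\<close>

lemma upper_lower_decomposable_Suc:
  fixes D :: "'k::field mat"
  assumes A: "A \<in> carrier_mat 1 1" and R: "R \<in> carrier_mat 1 n" and C: "C \<in> carrier_mat n 1"
    and D: "D \<in> carrier_mat n n" and dec: "upper_lower_decomposable n D"
    and det: "det (four_block_mat A R C D) \<noteq> 0"
  shows "upper_lower_decomposable (Suc n) (four_block_mat A R C D)"
proof -
  obtain u l where u: "u \<in> carrier_mat n n" "upper_triangular u" "det u \<noteq> 0"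
    and l: "l \<in> carrier_mat n n" "\<And>i j. i < j \<Longrightarrow> j < n \<Longrightarrow> l $$ (i, j) = 0" "det l \<noteq> 0"
    and ul: "D = u * l"
    using dec by (auto simp: upper_lower_decomposable_def)
  obtain u' where u': "u' \<in> carrier_mat n n" "u * u' = 1\<^sub>m n"
    using inverse_mat_obtain[OF u(1,3)] by metis
  obtain l' where l': "l' \<in> carrier_mat n n" "l' * l = 1\<^sub>m n"
    using inverse_mat_obtain[OF l(1,3)] by metis
  define x where "x = R * l'"
  define y where "y = u' * C"
  define E where "E = A - x * y"
  have x: "x \<in> carrier_mat 1 n" and y: "y \<in> carrier_mat n 1"
    using R C u' l' by (auto simp: x_def y_def)
  have xy: "x * y \<in> carrier_mat 1 1" using x y by (rule mult_carrier_mat)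
  then have E: "E \<in> carrier_mat 1 1" unfolding E_def by (rule minus_carrier_mat)
  have Exy: "E + x * y = A"
    unfolding E_def using A x y by (intro eq_matI) auto
  have xl: "x * l = R" using assoc_mult_mat[OF R l'(1) l(1)] l'(2) R by (simp add: x_def)
  have uy: "u * y = C" using assoc_mult_mat[OF u(1) u'(1) C] u'(2) C by (simp add: y_def)
  let ?U = "four_block_mat (1\<^sub>m 1) x (0\<^sub>m n 1) u"
  let ?L = "four_block_mat E (0\<^sub>m 1 n) y l"
  have "?U * ?L = four_block_mat (1\<^sub>m 1 * E + x * y) (1\<^sub>m 1 * 0\<^sub>m 1 n + x * l)
      (0\<^sub>m n 1 * E + u * y) (0\<^sub>m n 1 * 0\<^sub>m 1 n + u * l)"
    by (rule mult_four_block_mat[OF one_carrier_mat x zero_carrier_mat u(1) E zero_carrier_mat y l(1)])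
  also have "1\<^sub>m 1 * E + x * y = A" by (simp only: left_mult_one_mat[OF E] Exy)
  also have "1\<^sub>m 1 * 0\<^sub>m 1 n + x * l = R"
    by (simp only: left_mult_one_mat[OF zero_carrier_mat] xl left_add_zero_mat[OF R])
  also have "0\<^sub>m n 1 * E + u * y = C"
    by (simp only: left_mult_zero_mat[OF E] uy left_add_zero_mat[OF C])
  also have "0\<^sub>m n 1 * 0\<^sub>m 1 n + u * l = D"
    by (simp only: left_mult_zero_mat[OF zero_carrier_mat] ul[symmetric] left_add_zero_mat[OF D])
  finally have UL: "?U * ?L = four_block_mat A R C D" .
  have U: "?U \<in> carrier_mat (Suc n) (Suc n)"
    using four_block_carrier_mat[OF one_carrier_mat[of 1] u(1)] by simp
  have L: "?L \<in> carrier_mat (Suc n) (Suc n)"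
    using four_block_carrier_mat[OF E l(1)] by simp
  \<comment> \<open>The full determinant guarantees that both factors are invertible, in particular
    that \<open>E\<close> is not zero, without computing block determinants.\<close>
  have "det ?U * det ?L \<noteq> 0" using det_mult[OF U L] det UL by simp
  then have "det ?U \<noteq> 0" "det ?L \<noteq> 0" by auto
  moreover have "upper_triangular ?U"
    using upper_triangular_four_block[OF one_carrier_mat u(1) _ u(2)] by auto
  moreover have "?L $$ (i, j) = 0" if "i < j" "j < Suc n" for i j
  proof (cases i)
    case 0
    then show ?thesis using that l(1) E y by auto
  next
    case (Suc i')
    then show ?thesis using that l(1) l(2)[of i' "j - 1"] E y by auto
  qed
  ultimately show ?thesis
    unfolding upper_lower_decomposable_def using U L UL by metis
qed

text \<open>This determinant is the value at \<open>s\<close> of the characteristic polynomial of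
  \<open>- g\<close>, which is monic and thus has finitely many roots.\<close>

lemma shift_det_roots:
  fixes g :: "'k::field mat"
  assumes g: "g \<in> carrier_mat n n"
  shows "finite {s. det (g + s \<cdot>\<^sub>m 1\<^sub>m n) = 0}"
proof -
  have "char_poly (- g) \<noteq> 0"
    using degree_monic_char_poly[of "- g" n] g by auto
  moreover have "poly (char_poly (- g)) s = det (g + s \<cdot>\<^sub>m 1\<^sub>m n)" for s
    unfolding char_poly_def using g by (intro poly_det_cong[of _ n]) (auto simp: char_poly_matrix_def)
  ultimately show ?thesis using poly_roots_finite[of "char_poly (- g)"] by simp
qed

text \<open>Shifting by a scalar matrix is compatible with passing to the trailing block. A bad
  \<open>s\<close> is therefore bad for the smaller block or a root of the full determinant, and
  both sets are finite.\<close>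

lemma shift_upper_lower_decomposable:
  fixes g :: "'k::field mat"
  assumes "g \<in> carrier_mat n n"
  shows "finite {s. \<not> upper_lower_decomposable n (g + s \<cdot>\<^sub>m 1\<^sub>m n)}"
  using assms
proof (induction n arbitrary: g)
  case 0
  have "upper_lower_decomposable 0 (g + s \<cdot>\<^sub>m 1\<^sub>m 0)" for s
    unfolding upper_lower_decomposable_def using 0
    by (intro exI[of _ "1\<^sub>m 0"]) (auto intro!: eq_matI)
  then show ?case by simp
next
  case (Suc n)
  obtain A R C D where split: "split_block g 1 1 = (A, R, C, D)" by (metis prod_cases4)
  have dims: "A \<in> carrier_mat 1 1" "R \<in> carrier_mat 1 n" "C \<in> carrier_mat n 1" "D \<in> carrier_mat n n"
    and g: "g = four_block_mat A R C D"
    using split_block[OF split, of n n] Suc.prems by auto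
  have shift: "g + s \<cdot>\<^sub>m 1\<^sub>m (Suc n) = four_block_mat (A + s \<cdot>\<^sub>m 1\<^sub>m 1) R C (D + s \<cdot>\<^sub>m 1\<^sub>m n)" for s
    unfolding g using dims by (intro eq_matI) (auto simp: four_block_mat_def Let_def)
  have "{s. \<not> upper_lower_decomposable (Suc n) (g + s \<cdot>\<^sub>m 1\<^sub>m (Suc n))} \<subseteq>
      {s. \<not> upper_lower_decomposable n (D + s \<cdot>\<^sub>m 1\<^sub>m n)} \<union> {s. det (g + s \<cdot>\<^sub>m 1\<^sub>m (Suc n)) = 0}"
  proof
    fix s assume s: "s \<in> {s. \<not> upper_lower_decomposable (Suc n) (g + s \<cdot>\<^sub>m 1\<^sub>m (Suc n))}"
    have "A + s \<cdot>\<^sub>m 1\<^sub>m 1 \<in> carrier_mat 1 1" "D + s \<cdot>\<^sub>m 1\<^sub>m n \<in> carrier_mat n n"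
      using dims by auto
    with s show "s \<in> {s. \<not> upper_lower_decomposable n (D + s \<cdot>\<^sub>m 1\<^sub>m n)} \<union> {s. det (g + s \<cdot>\<^sub>m 1\<^sub>m (Suc n)) = 0}"
      unfolding shift using upper_lower_decomposable_Suc[OF _ dims(2,3)] by blast
  qed
  then show ?case
    using Suc.IH[OF dims(4)] shift_det_roots[OF Suc.prems] by (meson finite_UnI finite_subset)
qed

section \<open>Triangular matrices and the order on wedge terms\<close>

locale grassmann_order = wedge_order +
  assumes vars_increasing: "i < j \<Longrightarrow> j \<le> n \<Longrightarrow> lt (Poly_Mapping.single i 1) (Poly_Mapping.single j 1)"
begin

lemma single_S_terms: "i \<le> n \<Longrightarrow> Poly_Mapping.single i k \<in> S_terms n"
  by (cases "k = 0") (simp_all add: S_terms_def)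

text \<open>\<open>R\<close> stays abstract so that upper triangular matrices use \<open>lt\<close>
  and lower triangular ones its converse. Compatibility with products carries the comparison from
  variables to all terms.\<close>

lemma mon_eval_dominates:
  assumes R_add: "\<And>a b c. R a b \<Longrightarrow> a \<in> S_terms n \<Longrightarrow> b \<in> S_terms n \<Longrightarrow> c \<in> S_terms n \<Longrightarrow> R (a + c) (b + c)"
    and R_trans: "\<And>a b c. R a b \<Longrightarrow> R b c \<Longrightarrow> a \<in> S_terms n \<Longrightarrow> b \<in> S_terms n \<Longrightarrow> c \<in> S_terms n \<Longrightarrow> R a c"
    and \<phi>: "\<And>v \<tau>. v \<le> n \<Longrightarrow> \<tau> \<in> Poly_Mapping.keys (\<phi> v :: (nat, 'k::comm_ring_1) mpoly) \<Longrightarrow>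
      \<tau> \<in> S_terms n \<and> (Poly_Mapping.single v 1 = \<tau> \<or> R (Poly_Mapping.single v 1) \<tau>)"
    and \<sigma>: "\<sigma> \<in> S_terms n" and \<tau>: "\<tau> \<in> Poly_Mapping.keys (mon_eval \<phi> \<sigma>)"
  shows "\<sigma> = \<tau> \<or> R \<sigma> \<tau>"
proof -
  \<comment> \<open>\<open>dom \<sigma> f\<close> says that \<open>\<sigma>\<close> and all terms of
    \<open>f\<close> lie in \<open>S\<close> and that each term of \<open>f\<close> equals
    \<open>\<sigma>\<close> or stands in relation \<open>R\<close> to it; this is multiplicative in
    both arguments.\<close>
  define dom where "dom \<sigma> f \<longleftrightarrow> \<sigma> \<in> S_terms n \<and>
    (\<forall>\<tau>\<in>Poly_Mapping.keys f. \<tau> \<in> S_terms n \<and> (\<sigma> = \<tau> \<or> R \<sigma> \<tau>))" for \<sigma> and f :: "(nat, 'k) mpoly"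
  have dom_one: "dom 0 1"
    by (simp add: dom_def S_terms_def)
  have dom_mult: "dom (a + b) (f * g)" if "dom a f" "dom b g" for a b f g
    unfolding dom_def
  proof (intro conjI ballI)
    show ab: "a + b \<in> S_terms n" using that by (simp add: dom_def S_terms_add)
    fix \<tau> assume "\<tau> \<in> Poly_Mapping.keys (f * g)"
    then obtain x y where xy: "\<tau> = x + y" "x \<in> Poly_Mapping.keys f" "y \<in> Poly_Mapping.keys g"
      using keys_mult[of f g] by blast
    have x: "x \<in> S_terms n" "a = x \<or> R a x" and y: "y \<in> S_terms n" "b = y \<or> R b y"
      and S: "a \<in> S_terms n" "b \<in> S_terms n"
      using that xy by (auto simp: dom_def)
    show "\<tau> \<in> S_terms n" using xy x y by (simp add: S_terms_add)
    have 1: "a + b = x + b \<or> R (a + b) (x + b)" using x(2) R_add[OF _ S(1) x(1) S(2)] by auto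
    have 2: "x + b = x + y \<or> R (x + b) (x + y)"
      using y(2) R_add[OF _ S(2) y(1) x(1)] by (auto simp: add.commute)
    show "a + b = \<tau> \<or> R (a + b) \<tau>"
      using 1 2 R_trans[of "a + b" "x + b" "x + y"] xy(1) ab x y S by (auto simp: S_terms_add)
  qed
  have dom_pow: "dom (Poly_Mapping.single v k) (\<phi> v ^ k)" if "v \<le> n" for v k
  proof (induction k)
    case 0
    then show ?case using dom_one by simp
  next
    case (Suc k)
    have "dom (Poly_Mapping.single v 1) (\<phi> v)"
      using \<phi> that single_S_terms by (auto simp: dom_def)
    from dom_mult[OF this Suc] show ?case by (simp flip: single_add)
  qed
  have "dom (\<Sum>v\<in>A. Poly_Mapping.single v (Poly_Mapping.lookup \<sigma> v)) (\<Prod>v\<in>A. \<phi> v ^ Poly_Mapping.lookup \<sigma> v)"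
    if "finite A" "A \<subseteq> Poly_Mapping.keys \<sigma>" for A
    using that
  proof (induction A rule: finite_induct)
    case empty
    then show ?case using dom_one by simp
  next
    case (insert v A)
    have "v \<le> n" using insert.prems \<sigma> by (auto simp: S_terms_def)
    then show ?case using insert by (simp add: dom_mult dom_pow)
  qed
  from this[of "Poly_Mapping.keys \<sigma>"] have "dom \<sigma> (mon_eval \<phi> \<sigma>)"
    by (simp add: mon_eval_def flip: poly_mapping_sum_single)
  then show ?thesis using \<tau> by (auto simp: dom_def)
qed

lemma keys_lin_form:
  assumes "\<tau> \<in> Poly_Mapping.keys (lin_form n g i)"
  obtains j where "j \<le> n" "\<tau> = Poly_Mapping.single j 1" "g $$ (i, j) \<noteq> 0"
proof -
  have "(\<Sum>j\<le>n. g $$ (i, j) * Poly_Mapping.lookup (Var j) \<tau>) \<noteq> 0"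
    using assms by (simp add: lin_form_def lookup_sum lookup_const_mult in_keys_iff)
  then obtain j where "j \<le> n" "g $$ (i, j) * Poly_Mapping.lookup (Var j) \<tau> \<noteq> 0"
    by (metis (no_types, lifting) atMost_iff sum.neutral)
  then show thesis using that[of j] by (auto simp: Var_def lookup_single when_def split: if_splits)
qed

text \<open>An upper triangular matrix sends a variable to a combination of itself and variables of
  larger index, which are larger in the order.\<close>

lemma term_coeff_upper:
  assumes u: "u \<in> carrier_mat (n + 1) (n + 1)" "upper_triangular u" and \<sigma>: "\<sigma> \<in> S_terms n"
    and nz: "term_coeff n u \<sigma> \<tau> \<noteq> 0"
  shows "\<sigma> = \<tau> \<or> lt \<sigma> \<tau>"
proof (rule mon_eval_dominates[where R = lt and \<phi> = "lin_form n u", OF _ _ _ \<sigma>])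
  show "\<tau> \<in> Poly_Mapping.keys (mon_eval (lin_form n u) \<sigma>)"
    using nz by (simp add: term_coeff_def subst_single in_keys_iff)
  fix v \<tau> assume v: "v \<le> n" and "\<tau> \<in> Poly_Mapping.keys (lin_form n u v)"
  then obtain j where j: "j \<le> n" "\<tau> = Poly_Mapping.single j 1" "u $$ (v, j) \<noteq> 0"
    using keys_lin_form by blast
  then have "v \<le> j" using u v by (metis Suc_eq_plus1 carrier_matD(1) less_Suc_eq_le not_le upper_triangularD)
  then show "\<tau> \<in> S_terms n \<and> (Poly_Mapping.single v 1 = \<tau> \<or> lt (Poly_Mapping.single v 1) \<tau>)"
    using j vars_increasing[of v j] single_S_terms by (cases "v = j") auto
qed (fact lt_add lt_trans)+

lemma term_coeff_lower:
  assumes l: "\<And>i j. i < j \<Longrightarrow> j < n + 1 \<Longrightarrow> l $$ (i, j) = 0" and \<sigma>: "\<sigma> \<in> S_terms n"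
    and nz: "term_coeff n l \<sigma> \<tau> \<noteq> 0"
  shows "\<tau> = \<sigma> \<or> lt \<tau> \<sigma>"
proof -
  have "\<sigma> = \<tau> \<or> lt \<tau> \<sigma>"
  proof (rule mon_eval_dominates[where R = "\<lambda>a b. lt b a" and \<phi> = "lin_form n l", OF _ _ _ \<sigma>])
    show "\<tau> \<in> Poly_Mapping.keys (mon_eval (lin_form n l) \<sigma>)"
      using nz by (simp add: term_coeff_def subst_single in_keys_iff)
    fix v \<tau> assume v: "v \<le> n" and "\<tau> \<in> Poly_Mapping.keys (lin_form n l v)"
    then obtain j where j: "j \<le> n" "\<tau> = Poly_Mapping.single j 1" "l $$ (v, j) \<noteq> 0"
      using keys_lin_form by blast
    then have "j \<le> v" using l[of v j] by (cases "v < j") auto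
    then show "\<tau> \<in> S_terms n \<and> (Poly_Mapping.single v 1 = \<tau> \<or> lt \<tau> (Poly_Mapping.single v 1))"
      using j v vars_increasing[of j v] single_S_terms by (cases "v = j") auto
  next
    fix a b c assume S: "a \<in> S_terms n" "b \<in> S_terms n" "c \<in> S_terms n"
    show "lt (b + c) (a + c)" if "lt b a" using that S(2,1,3) by (rule lt_add)
    show "lt c a" if "lt b a" "lt c b" using that(2,1) S(3,2,1) by (rule lt_trans)
  qed
  then show ?thesis by auto
qed

text \<open>A non-zero determinant has a non-zero Leibniz summand; its permutation matches the
  factors of \<open>L\<close> with those of \<open>M\<close>.\<close>

lemma wedge_coeff_nonzero:
  fixes g :: "'k::comm_ring_1 mat"
  assumes L: "L \<in> WT" and M: "M \<in> WT" and nz: "wedge_coeff g L M \<noteq> 0"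
  obtains p where "p permutes {0..<q}" "\<And>i. i < q \<Longrightarrow> term_coeff n g (L ! i) (M ! p i) \<noteq> 0"
proof -
  have "\<exists>p. p permutes {0..<q} \<and> (\<Prod>i = 0..<q. term_coeff n g (L ! i) (M ! p i)) \<noteq> 0"
  proof (rule ccontr)
    assume "\<not> ?thesis"
    then have "wedge_coeff g L M = 0"
      unfolding wedge_coeff_def plucker_coord_Leibniz by (intro sum.neutral) auto
    then show False using nz by simp
  qed
  then obtain p where p: "p permutes {0..<q}" "(\<Prod>i = 0..<q. term_coeff n g (L ! i) (M ! p i)) \<noteq> 0"
    by blast
  have "term_coeff n g (L ! i) (M ! p i) \<noteq> 0" if "i < q" for i
    using p(2) that by (metis atLeastLessThan_iff finite_atLeastLessThan prod_zero zero_le)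
  then show thesis using that p(1) by blast
qed

lemma wedge_coeff_upper:
  assumes u: "u \<in> carrier_mat (n + 1) (n + 1)" "upper_triangular u"
    and L: "L \<in> WT" and M: "M \<in> WT" and nz: "wedge_coeff u L M \<noteq> 0"
  shows "L = M \<or> wl L M"
proof -
  obtain p where p: "p permutes {0..<q}" "\<And>i. i < q \<Longrightarrow> term_coeff n u (L ! i) (M ! p i) \<noteq> 0"
    using wedge_coeff_nonzero[OF L M nz] by blast
  \<comment> \<open>The matching written as a map on terms: it sends \<open>L ! i\<close> to
    \<open>M ! p i\<close>. The index is well defined because \<open>L\<close> has no
    repetitions.\<close>
  define f where "f x = M ! p (THE i. i < q \<and> L ! i = x)" for x
  have f: "f (L ! i) = M ! p i" if "i < q" for i
  proof -
    have "(THE j. j < q \<and> L ! j = L ! i) = i"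
      using that WT_D(1,3)[OF L] by (intro the_equality) (auto simp: nth_eq_iff_index_eq)
    then show ?thesis by (simp add: f_def)
  qed
  have ex: "\<exists>i<q. x = L ! i" if "x \<in> set L" for x
    using that WT_D(1)[OF L] by (metis in_set_conv_nth)
  show ?thesis
  proof (rule wedge_dominance_imp_le[OF L M, of f])
    show "inj_on f (set L)"
    proof (rule inj_onI)
      fix x y assume "x \<in> set L" "y \<in> set L" "f x = f y"
      then obtain i j where ij: "i < q" "x = L ! i" "j < q" "y = L ! j" "M ! p i = M ! p j"
        using ex f by metis
      then have "p i = p j"
        using WT_D(1,3)[OF M] permutes_less[OF p(1)] by (simp add: nth_eq_iff_index_eq)
      then have "i = j" using permutes_inj[OF p(1)] by (simp add: inj_eq)
      then show "x = y" using ij by simp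
    qed
    show "f ` set L \<subseteq> set M"
    proof (rule image_subsetI)
      fix x assume "x \<in> set L"
      then obtain i where i: "i < q" "x = L ! i" using ex by blast
      then show "f x \<in> set M" using f[OF i(1)] WT_D(1)[OF M] permutes_less[OF p(1) i(1)] by simp
    qed
    fix x assume "x \<in> set L"
    then obtain i where i: "i < q" "x = L ! i" using ex by blast
    then show "x = f x \<or> lt x (f x)"
      using term_coeff_upper[OF u WT_D(5)[OF L i(1)] p(2)[OF i(1)]] f by simp
  qed
qed

text \<open>The matching is now read backwards, from \<open>M\<close> to \<open>L\<close>, since
  lower triangular matrices replace factors by smaller ones.\<close>

lemma wedge_coeff_lower:
  assumes l: "\<And>i j. i < j \<Longrightarrow> j < n + 1 \<Longrightarrow> l $$ (i, j) = 0"
    and L: "L \<in> WT" and M: "M \<in> WT" and nz: "wedge_coeff l L M \<noteq> 0"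
  shows "M = L \<or> wl M L"
proof -
  obtain p where p: "p permutes {0..<q}" "\<And>i. i < q \<Longrightarrow> term_coeff n l (L ! i) (M ! p i) \<noteq> 0"
    using wedge_coeff_nonzero[OF L M nz] by blast
  define f where "f x = L ! (THE i. i < q \<and> M ! p i = x)" for x
  have f: "f (M ! p i) = L ! i" if "i < q" for i
  proof -
    have "j = i" if "j < q" "M ! p j = M ! p i" for j
    proof -
      have "p j = p i"
        using that(2) WT_D(1,3)[OF M] permutes_less[OF p(1) that(1)] permutes_less[OF p(1) \<open>i < q\<close>]
        by (simp add: nth_eq_iff_index_eq)
      then show "j = i" using permutes_inj[OF p(1)] by (simp add: inj_eq)
    qed
    then have "(THE j. j < q \<and> M ! p j = M ! p i) = i"
      using that by (intro the_equality) blast+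
    then show ?thesis by (simp add: f_def)
  qed
  have ex: "\<exists>i<q. x = M ! p i" if x: "x \<in> set M" for x
  proof -
    obtain j where j: "j < q" "x = M ! j" using x WT_D(1)[OF M] by (metis in_set_conv_nth)
    have "j \<in> p ` {0..<q}" using j permutes_image[OF p(1)] by simp
    then show ?thesis using j by auto
  qed
  show ?thesis
  proof (rule wedge_dominance_imp_le[OF M L, of f])
    show "inj_on f (set M)"
    proof (rule inj_onI)
      fix x y assume "x \<in> set M" "y \<in> set M" "f x = f y"
      then obtain i j where ij: "i < q" "x = M ! p i" "j < q" "y = M ! p j" "L ! i = L ! j"
        using ex f by metis
      then have "i = j" using WT_D(1,3)[OF L] by (simp add: nth_eq_iff_index_eq)
      then show "x = y" using ij by simp
    qed
    show "f ` set M \<subseteq> set L"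
    proof (rule image_subsetI)
      fix x assume "x \<in> set M"
      then obtain i where i: "i < q" "x = M ! p i" using ex by blast
      then show "f x \<in> set L" using f[OF i(1)] WT_D(1)[OF L] by simp
    qed
    fix x assume "x \<in> set M"
    then obtain i where i: "i < q" "x = M ! p i" using ex by blast
    then show "x = f x \<or> lt x (f x)"
      using term_coeff_lower[OF l WT_D(5)[OF L i(1)] p(2)[OF i(1)]] f by simp
  qed
qed

end

section \<open>Generic initial terms are Borel\<close>

context grassmann_order
begin

definition torus :: "(nat \<Rightarrow> 'k::field) \<Rightarrow> 'k mat" where
  "torus t = mat (n + 1) (n + 1) (\<lambda>(i, j). if i = j then t i else 0)"

text \<open>The eigenvalue of the torus element \<open>t\<close> on the line through
  \<open>L\<close>, that is, the torus weight of \<open>L\<close>.\<close>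

definition char_of :: "wedge_trm \<Rightarrow> (nat \<Rightarrow> 'k::field) \<Rightarrow> 'k" where
  "char_of L t = (\<Prod>i<q. mon_eval t (L ! i))"

lemma torus_GL: "(\<And>i. t i \<noteq> 0) \<Longrightarrow> torus t \<in> GL n"
proof -
  assume t: "\<And>i. t i \<noteq> 0"
  have car: "torus t \<in> carrier_mat (n + 1) (n + 1)" by (simp add: torus_def)
  have "det (torus t) = prod_list (diag_mat (torus t))"
    by (rule det_upper_triangular[OF _ car]) (auto simp: torus_def)
  also have "\<dots> \<noteq> 0" using t by (auto simp: prod_list_zero_iff diag_mat_def torus_def)
  finally show ?thesis using GL_iff_det[OF car] by simp
qed

lemma wedge_coeff_torus_mult:
  assumes u: "u \<in> carrier_mat (n + 1) (n + 1)" and L: "L \<in> WT"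
  shows "wedge_coeff (torus t * u) L M = char_of L t * wedge_coeff u L M"
proof -
  have "wedge_coeff (torus t * u) L M = (\<Sum>N\<in>WT. wedge_coeff (torus t) L N * wedge_coeff u N M)"
    using u L by (intro wedge_coeff_mult) (auto simp: torus_def)
  also have "\<dots> = (\<Sum>N\<in>WT. if N = L then char_of L t * wedge_coeff u L M else 0)"
    using L by (intro sum.cong refl) (simp add: torus_def wedge_coeff_diag char_of_def del: One_nat_def Suc_eq_plus1)
  also have "\<dots> = char_of L t * wedge_coeff u L M"
    using L finite_WT by (simp add: sum.delta)
  finally show ?thesis .
qed

text \<open>Different products differ in the exponent of some variable. A torus element that scales
  only this variable separates them, since distinct powers are distinct functions on an infinite
  field.\<close>

lemma char_of_distinct:
  assumes inf: "infinite (UNIV :: 'k::field set)" and LN: "L \<in> WT" "N \<in> WT"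
    and ne: "\<Sum>(set L) \<noteq> \<Sum>(set N)"
  shows "\<exists>t \<in> {t. \<forall>i. t i \<noteq> (0 :: 'k)}. char_of L t \<noteq> char_of N t"
proof -
  have char: "char_of M t = mon_eval t (\<Sum>(set M))" if "M \<in> WT" for M and t :: "nat \<Rightarrow> 'k"
  proof -
    have "\<Sum>(set M) = (\<Sum>i<q. M ! i)"
      using WT_D(1,3)[OF that] by (simp add: sum.distinct_set_conv_list sum_list_sum_nth atLeast0LessThan)
    then show ?thesis by (simp add: char_of_def mon_eval_sum)
  qed
  have "Poly_Mapping.lookup (\<Sum>(set L)) \<noteq> Poly_Mapping.lookup (\<Sum>(set N))"
    using ne by (simp only: lookup_inject not_False_eq_True)
  then obtain v where v: "Poly_Mapping.lookup (\<Sum>(set L)) v \<noteq> Poly_Mapping.lookup (\<Sum>(set N)) v"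
    unfolding fun_eq_iff by (elim not_all[THEN iffD1, elim_format] exE)
  obtain s :: 'k where s: "s \<noteq> 0"
    "s ^ Poly_Mapping.lookup (\<Sum>(set L)) v \<noteq> s ^ Poly_Mapping.lookup (\<Sum>(set N)) v"
    using infinite_field_power_neq[OF inf v] .
  let ?t = "\<lambda>i. if i = v then s else 1"
  have "mon_eval ?t \<sigma> = s ^ Poly_Mapping.lookup \<sigma> v" for \<sigma>
  proof -
    have "mon_eval ?t \<sigma> = (\<Prod>i\<in>insert v (Poly_Mapping.keys \<sigma>). ?t i ^ Poly_Mapping.lookup \<sigma> i)"
      by (rule mon_superset) auto
    also have "\<dots> = (\<Prod>i\<in>{v}. ?t i ^ Poly_Mapping.lookup \<sigma> i)"
      by (intro prod.mono_neutral_right) auto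
    finally show ?thesis by simp
  qed
  then have "char_of L ?t \<noteq> char_of N ?t"
    using s(2) by (simp only: char[OF LN(1)] char[OF LN(2)] not_False_eq_True)
  moreover have "?t \<in> {t. \<forall>i. t i \<noteq> 0}" using s(1) by simp
  ultimately show ?thesis by (rule bexI)
qed

text \<open>By \<open>weight_less\<close> no other Pluecker coordinate that is non-zero at \<open>P\<close> has the torus weight
  of \<open>L\<close>, so the torus isolates the contribution of \<open>L\<close> to the coordinate \<open>M\<close> of a translate
  of \<open>P\<close>.\<close>

lemma generic_initial_borel:
  fixes P :: "'k::field point"
  assumes inf: "infinite (UNIV :: 'k set)" and P: "P \<in> GP" and L: "L \<in> WT" "Var L \<notin> P"
    and max: "\<And>g M. g \<in> GL n \<Longrightarrow> M \<in> WT \<Longrightarrow> wl L M \<Longrightarrow> PB g (Var M) \<in> P"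
  shows "L \<in> borel_terms n m q lt TYPE('k)"
proof -
  have max1: "Var M \<in> P" if "M \<in> WT" "wl L M" for M
    using max[OF one_GL that] that(1) by (simp only: pullback_one carrier_CR vars_in_Var mem_Collect_eq)
  have vanish: "wedge_coeff u L M = 0"
    if u: "u \<in> GL n" "upper_triangular u" and M: "M \<in> WT" "wl L M" for u :: "'k mat" and M
  proof -
    \<comment> \<open>The other coordinates that are non-zero at \<open>P\<close>. Those that vanish
      there contribute only elements of \<open>P\<close>.\<close>
    let ?J = "{N \<in> WT. Var N \<notin> P} - {L}"
    let ?v = "\<lambda>N. Poly_Mapping.single 0 (wedge_coeff u N M) * Var N :: (wedge_trm, 'k) mpoly"
    have "?v L \<in> P"
    proof (rule point_character_coefficient[OF P, where \<chi> = char_of and J = ?J])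
      show "char_of i (\<lambda>j. a j * t j) = char_of i a * char_of i t" for i and a t :: "nat \<Rightarrow> 'k"
        by (simp add: char_of_def mon_eval_mult prod.distrib)
      show "char_of L (\<lambda>_. 1 :: 'k) = 1" by (simp add: char_of_def mon_eval_def)
      show "finite ?J" using finite_WT by simp
      show "L \<notin> ?J" by simp
      show "\<exists>a\<in>{t. \<forall>i. t i \<noteq> (0 :: 'k)}. char_of N a \<noteq> char_of L a" if N: "N \<in> ?J" for N
      proof (rule char_of_distinct[OF inf])
        show "N \<in> WT" "L \<in> WT" using N L by auto
        have "lt (\<Sum>(set N)) (\<Sum>(set L))"
          using weight_less[OF P L max1, of N] N by auto
        moreover have "\<Sum>(set L) \<in> S_terms n"
          using WT_D(2)[OF L(1)] terms_S_terms by (intro S_terms_sum) auto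
        ultimately show "\<Sum>(set N) \<noteq> \<Sum>(set L)" using lt_irrefl by auto
      qed
      fix t :: "nat \<Rightarrow> 'k" assume "t \<in> {t. \<forall>i. t i \<noteq> 0}"
      then have t: "torus t \<in> GL n" by (intro torus_GL) auto
      \<comment> \<open>Maximality is applied to every torus translate of \<open>u\<close>
        simultaneously; this provides a relation between the characters for each
        \<open>t\<close>.\<close>
      have "PB (torus t * u) (Var M) \<in> P"
        using max[OF mult_GL[OF t u(1)] M] .
      also have "PB (torus t * u) (Var M) =
          (\<Sum>N\<in>WT. Poly_Mapping.single 0 (char_of N t) * ?v N)"
        unfolding pullback_eq subst_Var pform_eq[OF M(1)]
        by (intro sum.cong refl) (simp add: wedge_coeff_torus_mult GL_carrier[OF u(1)] mult_single flip: mult.assoc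
            del: Suc_eq_plus1 One_nat_def)
      also have "\<dots> = (\<Sum>N\<in>{N \<in> WT. Var N \<in> P}. Poly_Mapping.single 0 (char_of N t) * ?v N) +
          (\<Sum>N\<in>{N \<in> WT. Var N \<notin> P}. Poly_Mapping.single 0 (char_of N t) * ?v N)"
        using finite_WT by (subst sum.union_disjoint[symmetric]) (auto intro!: sum.cong)
      finally have sum: "(\<Sum>N\<in>{N \<in> WT. Var N \<in> P}. Poly_Mapping.single 0 (char_of N t) * ?v N) +
          (\<Sum>N\<in>{N \<in> WT. Var N \<notin> P}. Poly_Mapping.single 0 (char_of N t) * ?v N) \<in> P" .
      have "(\<Sum>N\<in>{N \<in> WT. Var N \<in> P}. Poly_Mapping.single 0 (char_of N t) * ?v N) \<in> P"
        by (intro point_sum[OF P] point_const_mult[OF P]) simp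
      from point_diff[OF P sum this]
      have "(\<Sum>N\<in>{N \<in> WT. Var N \<notin> P}. Poly_Mapping.single 0 (char_of N t) * ?v N) \<in> P" by simp
      moreover have "insert L ?J = {N \<in> WT. Var N \<notin> P}" using L by blast
      ultimately show "(\<Sum>N\<in>insert L ?J. Poly_Mapping.single 0 (char_of N t) * ?v N) \<in> P" by simp
    qed
    then show ?thesis using point_const_mult_cancel[OF P] L(2) by blast
  qed
  have "act_wedge n m q lt u L \<in> range (Poly_Mapping.single L)"
    if u: "u \<in> GL n" "upper_triangular u" for u :: "'k mat"
  proof -
    \<comment> \<open>Triangularity leaves only \<open>M\<close> above \<open>L\<close> to be
      excluded, and those are covered by \<open>vanish\<close>.\<close>
    have "wedge_coeff u L M = 0" if "M \<in> WT" "M \<noteq> L" for M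
      using wedge_coeff_upper[OF GL_carrier[OF u(1)] u(2) L(1) that(1)] vanish[OF u that(1)] that(2) by blast
    then have "act_wedge n m q lt u L = Poly_Mapping.single L (wedge_coeff u L L)"
      using L(1) by (intro poly_mapping_eqI) (auto simp: lookup_act_wedge lookup_single when_def)
    then show ?thesis by blast
  qed
  then show ?thesis using L(1) by (simp add: borel_terms_def)
qed

text \<open>The coefficient is polynomial in \<open>s\<close> along the line \<open>g + s\<close>, which lies in the big cell
  for almost all \<open>s\<close>; hence \<open>g\<close> itself need not be invertible.\<close>

lemma borel_wedge_coeff_vanish:
  fixes g :: "'k::field mat"
  assumes inf: "infinite (UNIV :: 'k set)" and L: "L \<in> borel_terms n m q lt TYPE('k)"
    and N: "N \<in> WT" "wl L N" and g: "g \<in> carrier_mat (n + 1) (n + 1)"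
  shows "wedge_coeff g L N = 0"
proof -
  have LW: "L \<in> WT" using L by (simp add: borel_terms_def)
  \<comment> \<open>The characteristic matrix of \<open>- g\<close> is \<open>g\<close> plus the
    indeterminate times the identity, so \<open>?p\<close> is the coefficient along the whole
    line.\<close>
  let ?G = "char_poly_matrix (- g)"
  let ?p = "wedge_coeff ?G L N"
  have eval: "poly ?p s = wedge_coeff (g + s \<cdot>\<^sub>m 1\<^sub>m (n + 1)) L N" for s
  proof -
    have ev: "comm_ring_hom (\<lambda>p. poly p s)" by unfold_locales auto
    have "map_mat (\<lambda>p. poly p s) ?G = g + s \<cdot>\<^sub>m 1\<^sub>m (n + 1)"
      using g by (intro eq_matI) (auto simp: char_poly_matrix_def)
    then have "poly (term_coeff n ?G \<sigma> \<tau>) s = term_coeff n (g + s \<cdot>\<^sub>m 1\<^sub>m (n + 1)) \<sigma> \<tau>"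
      if "\<sigma> \<in> S_terms n" for \<sigma> \<tau>
      using comm_ring_hom.term_coeff_hom[OF ev, of ?G n \<sigma> \<tau>] g that by simp
    then show ?thesis
      unfolding wedge_coeff_def comm_ring_hom.hom_plucker_coord[OF ev] using WT_D(5)[OF LW]
      by (intro plucker_coord_cong) auto
  qed
  have zero: "wedge_coeff h L N = 0" if "upper_lower_decomposable (n + 1) h" for h :: "'k mat"
  proof -
    obtain u l where u: "u \<in> carrier_mat (n + 1) (n + 1)" "upper_triangular u" "det u \<noteq> 0"
      and l: "l \<in> carrier_mat (n + 1) (n + 1)" "\<And>i j. i < j \<Longrightarrow> j < n + 1 \<Longrightarrow> l $$ (i, j) = 0"
      and h: "h = u * l"
      using \<open>upper_lower_decomposable (n + 1) h\<close> unfolding upper_lower_decomposable_def by blast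
    have "u \<in> GL n" using GL_iff_det[OF u(1)] u(3) by simp
    then obtain c where c: "act_wedge n m q lt u L = Poly_Mapping.single L c"
      using L u(2) by (auto simp: borel_terms_def)
    \<comment> \<open>The Borel property leaves \<open>M = L\<close> as the only middle index, and
      from there \<open>l\<close> cannot climb to \<open>N\<close>.\<close>
    have "wedge_coeff u L M = 0" if "M \<in> WT" "M \<noteq> L" for M
      using arg_cong[OF c, of "\<lambda>f. Poly_Mapping.lookup f M"] that
      by (simp add: lookup_act_wedge lookup_single_not_eq)
    moreover have "wedge_coeff l L N = 0"
      using wedge_coeff_lower[OF l(2) LW N(1)] N wl_asym[OF _ LW N(1)] wl_irrefl[OF LW] by blast
    ultimately have "wedge_coeff u L M * wedge_coeff l M N = 0" if "M \<in> WT" for M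
      using that by (cases "M = L") auto
    then show ?thesis
      unfolding h wedge_coeff_mult[OF l(1) u(1) LW] by (intro sum.neutral) auto
  qed
  have "?p = 0"
  proof (rule ccontr)
    assume "?p \<noteq> 0"
    then have "finite {s. poly ?p s = 0}" by (rule poly_roots_finite)
    moreover have "- {s. \<not> upper_lower_decomposable (n + 1) (g + s \<cdot>\<^sub>m 1\<^sub>m (n + 1))} \<subseteq> {s. poly ?p s = 0}"
      using zero eval by auto
    ultimately have "finite (- {s. \<not> upper_lower_decomposable (n + 1) (g + s \<cdot>\<^sub>m 1\<^sub>m (n + 1))})"
      by (rule finite_subset[rotated])
    \<comment> \<open>The good and the bad values of \<open>s\<close> would both form finite sets,
      although they cover the infinite field.\<close>
    then show False
      using shift_upper_lower_decomposable[OF g] inf finite_compl by blast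
  qed
  \<comment> \<open>The value at \<open>s = 0\<close> is the coefficient of \<open>g\<close>,
    whether or not \<open>0\<close> was among the good values.\<close>
  then have "wedge_coeff (g + 0 \<cdot>\<^sub>m 1\<^sub>m (n + 1)) L N = 0" using eval[of 0] by simp
  moreover have "g + 0 \<cdot>\<^sub>m 1\<^sub>m (n + 1) = g" using g by (intro eq_matI) auto
  ultimately show ?thesis by simp
qed

end

section \<open>Strata\<close>

text \<open>\<open>W\<close> is covered by the closure of the open part and the closed complement.
  The complement is proper, so irreducibility makes the closure all of \<open>W\<close>.\<close>

lemma dense_open_in_irreducible:
  assumes irr: "irreducible_in X W" and U: "openin X U" "W \<inter> U \<noteq> {}"
  shows "dense_open_in X W (W \<inter> U)"
proof -
  let ?S = "subtopology X W"
  have top: "topspace ?S = W" using irr by (auto simp: irreducible_in_def)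
  have op: "openin ?S (W \<inter> U)" using U(1) by (rule openin_subtopology_Int2)
  have cl: "closedin ?S (?S closure_of (W \<inter> U))" by (rule closedin_closure_of)
  have cl': "closedin ?S (W - W \<inter> U)"
    using closedin_diff[OF closedin_topspace op] unfolding top .
  have "W \<inter> U \<subseteq> ?S closure_of (W \<inter> U)" by (rule closure_of_subset) (unfold top, blast)
  moreover have "?S closure_of (W \<inter> U) \<subseteq> W" using closure_of_subset_topspace[of ?S] unfolding top .
  ultimately have "?S closure_of (W \<inter> U) \<union> (W - W \<inter> U) = W" by blast
  then have "?S closure_of (W \<inter> U) = W \<or> W - W \<inter> U = W"
    using irr cl cl' unfolding irreducible_in_def by blast
  then have "?S closure_of (W \<inter> U) = W" using U(2) by blast
  then show ?thesis using op unfolding dense_open_in_def top by blast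
qed

text \<open>Disjointness is needed twice, for the indexed family and for the set of its members; the
  third premise reflects that blocks of a partition are non-empty.\<close>

lemma stratificationI:
  assumes "\<And>i j. i \<in> I \<Longrightarrow> j \<in> I \<Longrightarrow> i \<noteq> j \<Longrightarrow> A i \<inter> A j = {}"
    and "(\<Union>i\<in>I. A i) = X" and "\<And>i. i \<in> I \<Longrightarrow> A i \<noteq> {}"
  shows "stratification X I A"
proof -
  have "disjoint_family_on A I" using assms(1) by (simp add: disjoint_family_on_def)
  moreover have "disjoint (A ` I)"
  proof (rule disjointI)
    fix a b assume "a \<in> A ` I" "b \<in> A ` I" "a \<noteq> b"
    then obtain i j where "i \<in> I" "j \<in> I" "a = A i" "b = A j" "i \<noteq> j" by blast
    then show "a \<inter> b = {}" using assms(1) by simp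
  qed
  ultimately show ?thesis using assms(2,3) by (auto simp: stratification_def partition_on_def)
qed

section \<open>Coordinate subspaces and orbits of charts\<close>

context grassmann_order
begin

text \<open>The point of the Grassmannian given by the span of the terms of \<open>L\<close>: the functions that
  vanish on the coordinate line through \<open>L\<close>.\<close>

definition base_point :: "wedge_trm \<Rightarrow> 'k::field point" where
  "base_point L = {f \<in> carrier CR. subst (\<lambda>M. if M = L then Var 0 else 0 :: (nat, 'k) mpoly) f = 0}"

lemma Var_base_point:
  assumes "M \<in> WT"
  shows "Var M \<in> (base_point L :: 'k::field point) \<longleftrightarrow> M \<noteq> L"
proof -
  have "Poly_Mapping.lookup (Var 0 :: (nat, 'k) mpoly) (Poly_Mapping.single 0 1) \<noteq> 0"
    by (simp add: Var_def)
  then have "(Var 0 :: (nat, 'k) mpoly) \<noteq> 0" by (metis lookup_zero)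
  then show ?thesis using assms by (simp add: base_point_def carrier_CR vars_in_Var)
qed

lemma base_point_GP:
  assumes q: "0 < q" and L: "L \<in> WT"
  shows "(base_point L :: 'k::field point) \<in> GP"
proof -
  \<comment> \<open>Restriction to the coordinate line through \<open>L\<close>. The target is a
    domain and the images are linear forms or zero, so the kernel is prime and homogeneous.\<close>
  define \<phi> where "\<phi> M = (if M = L then Var 0 else 0 :: (nat, 'k) mpoly)" for M
  have mem: "f \<in> base_point L \<longleftrightarrow> vars_in WT f \<and> subst \<phi> f = 0" for f :: "(wedge_trm, 'k) mpoly"
    by (simp add: base_point_def carrier_CR \<phi>_def[abs_def])
  have prime: "primeideal (base_point L :: 'k point) CR"
  proof (rule primeidealI)
    have ring: "ring (CR :: ((wedge_trm, 'k) mpoly) ring)" by (rule cring.axioms(1)[OF cring_CR])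
    interpret ring "CR :: ((wedge_trm, 'k) mpoly) ring" by (rule ring)
    show "ideal (base_point L :: 'k point) CR"
    proof (rule idealI[OF ring])
      show "subgroup (base_point L :: 'k point) (add_monoid CR)"
      proof (rule subgroup.intro)
        show "(base_point L :: 'k point) \<subseteq> carrier (add_monoid CR)" by (auto simp: base_point_def)
        fix x :: "(wedge_trm, 'k) mpoly" assume x: "x \<in> base_point L"
        have "\<ominus>\<^bsub>CR\<^esub> x = - x"
          using x by (intro minus_equality) (auto simp: carrier_CR CR_simps mem vars_in_uminus)
        then have "inv\<^bsub>add_monoid CR\<^esub> x = - x" by (simp add: a_inv_def)
        then show "inv\<^bsub>add_monoid CR\<^esub> x \<in> base_point L"
          using x by (simp add: mem vars_in_uminus subst.hom_uminus)
      qed (auto simp: mem CR_simps vars_in_add subst.hom_add)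
    qed (auto simp: mem CR_simps carrier_CR vars_in_mult subst.hom_mult)
    show "cring (CR :: ((wedge_trm, 'k) mpoly) ring)" by (rule cring_CR)
    have "(1 :: (wedge_trm, 'k) mpoly) \<in> carrier CR" "(1 :: (wedge_trm, 'k) mpoly) \<notin> base_point L"
      by (simp_all add: mem carrier_CR)
    then show "carrier CR \<noteq> (base_point L :: 'k point)" by blast
    fix a b :: "(wedge_trm, 'k) mpoly"
    assume "a \<in> carrier CR" "b \<in> carrier CR" "a \<otimes>\<^bsub>CR\<^esub> b \<in> base_point L"
    then show "a \<in> base_point L \<or> b \<in> base_point L"
      by (simp add: mem CR_simps carrier_CR subst.hom_mult)
  qed
  have "hom_component d f \<in> base_point L" if "f \<in> base_point L" for f :: "(wedge_trm, 'k) mpoly" and d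
  proof -
    have hom: "homogeneous 1 (\<phi> M)" for M
      by (cases "M = L") (simp_all add: \<phi>_def del: One_nat_def, simp add: homogeneous_def)
    have "subst \<phi> (hom_component d f) = hom_component d (subst \<phi> f)"
      by (rule hom_component_subst[symmetric]) (rule hom)
    moreover have "hom_component d 0 = (0 :: (nat, 'k) mpoly)" by (simp add: hom_component_def)
    moreover have "vars_in WT (hom_component d f)"
      using that by (auto simp: mem vars_in_def in_keys_iff lookup_hom_component split: if_splits)
    ultimately show ?thesis using that by (simp add: mem)
  qed
  moreover have "\<not> Var ` WT \<subseteq> (base_point L :: 'k point)"
    using L Var_base_point[OF L, of L] by blast
  moreover have "PI \<subseteq> (base_point L :: 'k point)"
  proof
    fix f :: "(wedge_trm, 'k) mpoly" assume f: "f \<in> PI"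
    let ?plk = "plucker_coord q (\<lambda>i \<tau>. Var (i, \<tau>) :: (nat \<times> trm, 'k) mpoly)"
    \<comment> \<open>Specialises the generic matrix to the identity in the columns of
      \<open>L\<close>, with row \<open>0\<close> scaled by the variable: the minor at
      \<open>L\<close> becomes \<open>Var 0\<close> and all others vanish. Positivity of
      \<open>q\<close> ensures that row \<open>0\<close> exists.\<close>
    let ?\<psi> = "\<lambda>(i, \<tau>). if \<tau> = L ! i then (if i = 0 then Var 0 else 1) else 0 :: (nat, 'k) mpoly"
    have "\<phi> M = subst ?\<psi> (?plk M)" if "M \<in> WT" for M
    proof -
      have "(\<Prod>i<q. if i = 0 then Var 0 else 1) = (Var 0 :: (nat, 'k) mpoly)"
        using q by (simp add: prod.delta)
      then show ?thesis
        using plucker_coord_delta[OF L that, of "\<lambda>i. if i = 0 then Var 0 else 1 :: (nat, 'k) mpoly"]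
        by (simp add: subst.hom_plucker_coord \<phi>_def)
    qed
    then have "subst \<phi> f = subst ?\<psi> (subst ?plk f)"
      unfolding subst_subst using f
      by (intro subst_cong) (auto simp: plucker_ideal_def carrier_CR vars_in_def)
    then show "f \<in> base_point L" using f by (simp add: mem plucker_ideal_def carrier_CR)
  qed
  ultimately show ?thesis using prime by (auto simp: GP_eq proj_points_def)
qed

lemma UC_eq: "UC L = {P \<in> GP. \<not> {Var L} \<subseteq> P}"
  by (auto simp: U_chart_def)

lemma openin_UC: "L \<in> WT \<Longrightarrow> openin (Gr n m q lt :: 'k::field point topology) (UC L)"
  unfolding openin_Gr UC_eq by (intro exI[of _ "{Var L}"]) (simp add: carrier_CR vars_in_Var)

lemma act_point_inverse:
  fixes P :: "'k::field point"
  assumes P: "P \<in> GP" and g: "g \<in> GL n"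
  obtains h where "h \<in> GL n" "AP h (AP g P) = P"
proof -
  obtain h where h: "h \<in> GL n" "h * g = 1\<^sub>m (n + 1)" "g * h = 1\<^sub>m (n + 1)"
    using GL_inverse[OF g] .
  have "AP h (AP g P) = P"
    using act_point_act_point[OF GL_carrier[OF h(1)] GL_carrier[OF g], of P] h(3) act_point_one[OF P] by simp
  then show thesis using that h(1) by blast
qed

lemma orbit_subset: "W \<subseteq> GP \<Longrightarrow> ORB W \<subseteq> GP"
  using act_point_GP by (auto simp: orbit_def)

lemma orbit_superset: "W \<subseteq> GP \<Longrightarrow> W \<subseteq> ORB W"
proof
  fix P assume "W \<subseteq> GP" "P \<in> W"
  then have "P = AP (1\<^sub>m (n + 1)) P" using act_point_one[of P] by blast
  then show "P \<in> ORB W" unfolding orbit_def using \<open>P \<in> W\<close> one_GL by blast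
qed

lemma mem_orbit_iff:
  fixes P :: "'k::field point"
  assumes "W \<subseteq> GP"
  shows "P \<in> ORB W \<longleftrightarrow> P \<in> GP \<and> (\<exists>g\<in>GL n. AP g P \<in> W)"
proof
  assume "P \<in> ORB W"
  then obtain g V where V: "V \<in> W" "g \<in> GL n" "P = AP g V" by (auto simp: orbit_def)
  then have "V \<in> GP" using assms by blast
  then obtain h where "h \<in> GL n" "AP h (AP g V) = V" using act_point_inverse[OF _ V(2)] by blast
  then show "P \<in> GP \<and> (\<exists>g\<in>GL n. AP g P \<in> W)"
    using V act_point_GP[OF \<open>V \<in> GP\<close> V(2)] by (intro conjI bexI[of _ h]) simp_all
next
  assume "P \<in> GP \<and> (\<exists>g\<in>GL n. AP g P \<in> W)"
  then obtain g where g: "P \<in> GP" "g \<in> GL n" "AP g P \<in> W" by blast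
  then obtain h where "h \<in> GL n" "AP h (AP g P) = P" using act_point_inverse by blast
  then show "P \<in> ORB W" using g(3) unfolding orbit_def by (intro CollectI exI[of _ h] exI[of _ "AP g P"]) auto
qed

lemma UC_subset: "UC L \<subseteq> GP"
  by (auto simp: U_chart_def)

lemma orbit_UC:
  fixes P :: "'k::field point"
  assumes "L \<in> WT"
  shows "P \<in> ORB (UC L) \<longleftrightarrow> P \<in> GP \<and> (\<exists>g\<in>GL n. PB g (Var L) \<notin> P)"
proof -
  have "AP g P \<in> UC L \<longleftrightarrow> PB g (Var L) \<notin> P" if "P \<in> GP" "g \<in> GL n" for g
    using act_point_GP[OF that] mem_act_point[OF that(1)] assms
    by (simp add: U_chart_def carrier_CR vars_in_Var)
  then show ?thesis unfolding mem_orbit_iff[OF UC_subset] by blast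
qed

text \<open>A point misses every translate of the chart exactly when all pullbacks of \<Delta>_L lie
  in it, so this family of linear forms cuts out the complement.\<close>

lemma openin_orbit_UC:
  assumes "L \<in> WT"
  shows "openin (Gr n m q lt :: 'k::field point topology) (ORB (UC L))"
  unfolding openin_Gr
proof (intro exI conjI)
  show "(\<lambda>g. PB g (Var L)) ` GL n \<subseteq> carrier CR" using pullback_carrier by blast
  show "ORB (UC L) = {P \<in> GP. \<not> (\<lambda>g. PB g (Var L)) ` GL n \<subseteq> P}"
    using orbit_UC[OF assms] by auto
qed

lemma UC_meets_orbit:
  fixes P :: "'k::field point"
  assumes "P \<in> GP"
  shows "UC M \<inter> ORB {P} \<noteq> {} \<longleftrightarrow> P \<in> ORB (UC M)"
  using assms unfolding mem_orbit_iff[OF UC_subset] by (auto simp: orbit_def)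

lemma gin_singleton_iff:
  fixes P :: "'k::field point"
  assumes P: "P \<in> GP" and L: "L \<in> WT"
  shows "GIN {P} = L \<longleftrightarrow> P \<in> ORB (UC L) \<and> (\<forall>M\<in>WT. wl L M \<longrightarrow> P \<notin> ORB (UC M))"
proof -
  have sub: "ORB {P} \<subseteq> GP" "ORB {P} \<noteq> {}"
    using orbit_subset[of "{P}"] orbit_superset[of "{P}"] P by auto
  show ?thesis
    using ini_props[OF sub] ini_eqI[OF L, of "ORB {P}"] UC_meets_orbit[OF P] unfolding gin_def by blast
qed

lemma gin_singleton_WT: "P \<in> GP \<Longrightarrow> GIN {P} \<in> WT"
  using ini_props(1)[of "ORB {P}"] orbit_subset[of "{P}"] orbit_superset[of "{P}"]
  unfolding gin_def by blast

lemma ini_singleton_iff: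
  fixes P :: "'k::field point"
  assumes P: "P \<in> GP" and L: "L \<in> WT"
  shows "INI {P} = L \<longleftrightarrow> P \<in> UC L \<and> (\<forall>M\<in>WT. wl L M \<longrightarrow> P \<notin> UC M)"
  using ini_props[of "{P}"] ini_eqI[OF L, of "{P}"] P by blast

text \<open>\<open>P\<close> is replaced by a translate at which the generic initial coordinate is
  itself non-zero. Maximality survives because translates of the translate are translates of
  \<open>P\<close>.\<close>

lemma gin_singleton_borel:
  fixes P :: "'k::field point"
  assumes inf: "infinite (UNIV :: 'k set)" and P: "P \<in> GP"
  shows "GIN {P} \<in> borel_terms n m q lt TYPE('k)"
proof -
  define L where "L = GIN {P}"
  have L: "L \<in> WT" using gin_singleton_WT[OF P] by (simp add: L_def)
  have max: "P \<in> ORB (UC L)" "\<And>M. M \<in> WT \<Longrightarrow> wl L M \<Longrightarrow> P \<notin> ORB (UC M)"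
    using gin_singleton_iff[OF P L] by (auto simp: L_def)
  obtain g where g: "g \<in> GL n" "PB g (Var L) \<notin> P" using max(1) orbit_UC[OF L] by blast
  show ?thesis
    unfolding L_def[symmetric]
  proof (rule generic_initial_borel[OF inf act_point_GP[OF P g(1)] L])
    show "Var L \<notin> AP g P" using g(2) mem_act_point[OF P] by simp
    fix h :: "'k mat" and M assume h: "h \<in> GL n" and M: "M \<in> WT" "wl L M"
    have "Var M \<in> (carrier CR :: 'k point)" using M(1) by (simp add: carrier_CR vars_in_Var)
    then have "PB g (PB h (Var M)) = PB (g * h) (Var M)"
      using pullback_pullback[OF GL_carrier[OF h] GL_carrier[OF g(1)]] by blast
    moreover have "PB (g * h) (Var M) \<in> P"
      using max(2)[OF M] orbit_UC[OF M(1)] P mult_GL[OF g(1) h] by blast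
    ultimately show "PB h (Var M) \<in> AP g P"
      by (simp add: mem_act_point[OF P] pullback_carrier)
  qed
qed

lemma ini_base_point:
  assumes q: "0 < q" and L: "L \<in> WT"
  shows "INI {base_point L :: 'k::field point} = L"
  using Var_base_point[where 'k = 'k] L wl_irrefl[OF L] base_point_GP[OF q L]
  by (subst ini_singleton_iff) (auto simp: U_chart_def)

text \<open>In the pullback of a coordinate above \<open>L\<close>, the variables other than
  \<Delta>_L vanish at the coordinate subspace, and the coefficient of \<Delta>_L vanishes by the
  Borel property.\<close>

lemma gin_base_point:
  assumes inf: "infinite (UNIV :: 'k::field set)" and q: "0 < q"
    and L: "L \<in> borel_terms n m q lt TYPE('k)"
  shows "GIN {base_point L :: 'k point} = L"
proof -
  have LW: "L \<in> WT" using L by (simp add: borel_terms_def)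
  note P = base_point_GP[OF q LW, where 'k = 'k]
  have "PB g (Var M) \<in> (base_point L :: 'k point)" if g: "g \<in> GL n" and M: "M \<in> WT" "wl L M" for g M
  proof -
    have "Poly_Mapping.single 0 (wedge_coeff g N M) * Var N \<in> (base_point L :: 'k point)" if "N \<in> WT" for N
    proof (cases "N = L")
      case True
      then show ?thesis
        using borel_wedge_coeff_vanish[OF inf L M GL_carrier[OF g]] point_zero[OF P] by simp
    next
      case False
      then show ?thesis using point_const_mult[OF P] Var_base_point[OF that] by blast
    qed
    then show ?thesis
      unfolding pullback_eq subst_Var pform_eq[OF M(1)] by (rule point_sum[OF P])
  qed
  moreover have "base_point L \<in> ORB (UC L :: 'k point set)"
    using orbit_superset[OF UC_subset] P Var_base_point[OF LW] by (auto simp: U_chart_def)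
  ultimately show ?thesis
    using gin_singleton_iff[OF P LW] orbit_UC by blast
qed

end

section \<open>The two decompositions and their generic strata\<close>

context grassmann_order
begin

abbreviation "VS \<equiv> V_stratum n m q lt"
abbreviation "US \<equiv> U_stratum n m q lt"

lemma V_stratum_eq:
  assumes L: "L \<in> WT"
  shows "(VS L :: 'k::field point set) = UC L - (\<Union>L' \<in> {L' \<in> WT. wl L L'}. UC L')"
proof (rule Set.set_eqI)
  fix P :: "'k point"
  show "P \<in> VS L \<longleftrightarrow> P \<in> UC L - (\<Union>L' \<in> {L' \<in> WT. wl L L'}. UC L')"
  proof (cases "P \<in> GP")
    case True
    then show ?thesis using ini_singleton_iff[OF True L] by (auto simp: V_stratum_def)
  next
    case False
    then show ?thesis using UC_subset by (auto simp: V_stratum_def)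
  qed
qed

text \<open>\<open>gin\<close> is a maximum over all wedge terms, whereas only orbits for Borel
  terms are removed here. Nothing is lost, since the maximum at each point is itself Borel.\<close>

lemma U_stratum_eq:
  assumes inf: "infinite (UNIV :: 'k::field set)" and L: "L \<in> borel_terms n m q lt TYPE('k)"
  shows "(US L :: 'k point set) =
    ORB (UC L) - (\<Union>L' \<in> {L' \<in> borel_terms n m q lt TYPE('k). wl L L'}. ORB (UC L'))"
proof (rule Set.set_eqI)
  fix P :: "'k point"
  have LW: "L \<in> WT" using L by (simp add: borel_terms_def)
  have BW: "M \<in> WT" if "M \<in> borel_terms n m q lt TYPE('k)" for M
    using that by (simp add: borel_terms_def)
  show "P \<in> US L \<longleftrightarrow> P \<in> ORB (UC L) - (\<Union>L' \<in> {L' \<in> borel_terms n m q lt TYPE('k). wl L L'}. ORB (UC L'))"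
  proof (cases "P \<in> GP")
    case True
    let ?M = "GIN {P}"
    have M: "?M \<in> borel_terms n m q lt TYPE('k)" by (rule gin_singleton_borel[OF inf True])
    have max: "P \<in> ORB (UC ?M)" "\<And>N. N \<in> WT \<Longrightarrow> wl ?M N \<Longrightarrow> P \<notin> ORB (UC N)"
      using gin_singleton_iff[OF True BW[OF M]] by auto
    show ?thesis
    proof
      assume "P \<in> US L"
      then have "?M = L" by (simp add: U_stratum_def)
      then show "P \<in> ORB (UC L) - (\<Union>L' \<in> {L' \<in> borel_terms n m q lt TYPE('k). wl L L'}. ORB (UC L'))"
        using max BW by auto
    next
      assume *: "P \<in> ORB (UC L) - (\<Union>L' \<in> {L' \<in> borel_terms n m q lt TYPE('k). wl L L'}. ORB (UC L'))"
      have "\<not> wl L ?M" using * M max(1) by blast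
      moreover have "\<not> wl ?M L" using * max(2)[OF LW] by blast
      ultimately have "?M = L" using wl_total[OF BW[OF M] LW] by blast
      then show "P \<in> US L" using True by (simp add: U_stratum_def)
    qed
  next
    case False
    then show ?thesis using orbit_subset[OF UC_subset[of L]] by (auto simp: U_stratum_def)
  qed
qed

lemma locally_closed_diff:
  assumes "openin X U" "openin X V" "U \<subseteq> topspace X"
  shows "locally_closed_in X (U - V)"
proof -
  have "U - V = U \<inter> (topspace X - V)" using assms(3) by blast
  then show ?thesis unfolding locally_closed_in_def using assms by blast
qed

lemma locally_closed_V_stratum:
  "L \<in> WT \<Longrightarrow> locally_closed_in (Gr n m q lt :: 'k::field point topology) (VS L)"
  unfolding V_stratum_eq
  by (intro locally_closed_diff openin_UC openin_Union UC_subset) (auto intro: openin_UC)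

lemma locally_closed_U_stratum:
  assumes inf: "infinite (UNIV :: 'k::field set)" and L: "L \<in> borel_terms n m q lt TYPE('k)"
  shows "locally_closed_in (Gr n m q lt :: 'k point topology) (US L)"
  unfolding U_stratum_eq[OF assms] using L
  by (intro locally_closed_diff openin_orbit_UC openin_Union orbit_subset[OF UC_subset])
    (auto simp: borel_terms_def intro: openin_orbit_UC)

lemma stratification_V:
  assumes "0 < q"
  shows "stratification (GP :: 'k::field point set) WT VS"
proof (rule stratificationI)
  show "(\<Union>L\<in>WT. VS L) = (GP :: 'k point set)"
  proof (intro equalityI subsetI)
    fix P :: "'k point" assume P: "P \<in> GP"
    have "INI {P} \<in> WT" using ini_props(1)[of "{P}"] P by blast
    moreover have "P \<in> VS (INI {P})" using P by (simp add: V_stratum_def)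
    ultimately show "P \<in> (\<Union>L\<in>WT. VS L)" by blast
  qed (auto simp: V_stratum_def)
  fix L assume L: "L \<in> WT"
  \<comment> \<open>Each stratum contains the coordinate subspace of its own term.\<close>
  have "base_point L \<in> (VS L :: 'k point set)"
    using base_point_GP[OF assms L] ini_base_point[OF assms L] by (simp add: V_stratum_def)
  then show "(VS L :: 'k point set) \<noteq> {}" by blast
qed (auto simp: V_stratum_def)

lemma stratification_U:
  assumes inf: "infinite (UNIV :: 'k::field set)" and "0 < q"
  shows "stratification (GP :: 'k point set) (borel_terms n m q lt TYPE('k)) US"
proof (rule stratificationI)
  show "(\<Union>L\<in>borel_terms n m q lt TYPE('k). US L) = (GP :: 'k point set)"
  proof (intro equalityI subsetI)
    fix P :: "'k point" assume P: "P \<in> GP"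
    then have "P \<in> US (GIN {P})" by (simp add: U_stratum_def)
    then show "P \<in> (\<Union>L\<in>borel_terms n m q lt TYPE('k). US L)"
      using gin_singleton_borel[OF inf P] by blast
  qed (auto simp: U_stratum_def)
  fix L assume L: "L \<in> borel_terms n m q lt TYPE('k)"
  then have "L \<in> WT" by (simp add: borel_terms_def)
  then have "base_point L \<in> (US L :: 'k point set)"
    using base_point_GP[OF assms(2)] gin_base_point[OF assms L] by (simp add: U_stratum_def)
  then show "(US L :: 'k point set) \<noteq> {}" by blast
qed (auto simp: U_stratum_def)

context
  fixes W :: "'k::field point set"
  assumes W: "W \<subseteq> GP" "W \<noteq> {}"
begin

lemma V_stratum_ini_inter: "W \<inter> VS (INI W) = W \<inter> UC (INI W)"
  unfolding V_stratum_eq[OF ini_props(1)[OF W]] using ini_props(3)[OF W] by blast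

lemma V_stratum_above_ini:
  assumes "L \<in> WT" "wl (INI W) L"
  shows "W \<inter> VS L = {}"
  unfolding V_stratum_eq[OF assms(1)] using ini_props(3)[OF W assms] by blast

lemma V_stratum_dense:
  assumes "irreducible_in (Gr n m q lt) W"
  shows "dense_open_in (Gr n m q lt) W (W \<inter> VS (INI W))"
  unfolding V_stratum_ini_inter using assms openin_UC[OF ini_props(1)[OF W]] ini_props(2)[OF W]
  by (intro dense_open_in_irreducible) (auto simp: Int_commute)

context
  assumes st: "stable n m q lt W"
begin

lemma stable_act_point: "g \<in> GL n \<Longrightarrow> P \<in> W \<Longrightarrow> AP g P \<in> W"
  using st by (auto simp: stable_def)

lemma stable_orbit: "ORB W = W"
  using orbit_superset[OF W(1)] stable_act_point by (auto simp: orbit_def)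

lemma stable_gin: "GIN W = INI W"
  by (simp add: gin_def stable_orbit)

lemma stable_not_above:
  assumes P: "P \<in> W" and M: "M \<in> WT" "wl (INI W) M"
  shows "P \<notin> ORB (UC M)"
proof
  assume "P \<in> ORB (UC M)"
  then obtain g where "g \<in> GL n" "AP g P \<in> UC M" using mem_orbit_iff[OF UC_subset] by blast
  then show False using stable_act_point[OF _ P] ini_props(3)[OF W M] by blast
qed

text \<open>Translates of points of \<open>W\<close> remain in \<open>W\<close>, where no chart
  above \<open>INI W\<close> occurs. Membership in the stratum thus reduces to reaching the chart of
  \<open>INI W\<close>.\<close>

lemma stable_U_stratum_inter: "W \<inter> US (INI W) = W \<inter> ORB (UC (INI W))"
proof -
  have "P \<in> US (INI W) \<longleftrightarrow> P \<in> ORB (UC (INI W))" if P: "P \<in> W" for P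
    using gin_singleton_iff[OF _ ini_props(1)[OF W], of P] stable_not_above[OF P] P W(1)
    by (auto simp: U_stratum_def)
  then show ?thesis by blast
qed

text \<open>A group element moving a point of \<open>W\<close> into the chart keeps it in
  \<open>W\<close>, and inside \<open>W\<close> the chart and the stratum of \<open>INI W\<close>
  coincide.\<close>

lemma stable_orbit_V_stratum_inter: "W \<inter> ORB (VS (INI W)) = W \<inter> ORB (UC (INI W))"
proof -
  have "VS (INI W) \<subseteq> GP" by (auto simp: V_stratum_def)
  then have "P \<in> ORB (VS (INI W)) \<longleftrightarrow> P \<in> ORB (UC (INI W))" if P: "P \<in> W" for P
    unfolding mem_orbit_iff[OF UC_subset] mem_orbit_iff[OF \<open>VS (INI W) \<subseteq> GP\<close>]
    using V_stratum_ini_inter stable_act_point[OF _ P] by blast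
  then show ?thesis by blast
qed

lemma stable_U_stratum_dense:
  assumes "irreducible_in (Gr n m q lt) W"
  shows "dense_open_in (Gr n m q lt) W (W \<inter> US (INI W))"
  unfolding stable_U_stratum_inter
proof (rule dense_open_in_irreducible[OF assms openin_orbit_UC[OF ini_props(1)[OF W]]])
  show "W \<inter> ORB (UC (INI W)) \<noteq> {}"
    using ini_props(2)[OF W] orbit_superset[OF UC_subset[of "INI W"]] by blast
qed

lemma stable_U_stratum_above:
  assumes "L \<in> WT" "wl (INI W) L"
  shows "W \<inter> US L = {}"
proof -
  have "P \<notin> US L" if P: "P \<in> W" for P
    using gin_singleton_iff[OF _ assms(1), of P] stable_not_above[OF P assms] P W(1)
    by (auto simp: U_stratum_def)
  then show ?thesis by blast
qed

end

end

end

theorem proposition3p3: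
  fixes n m q :: nat
    and lt :: "trm \<Rightarrow> trm \<Rightarrow> bool"
  assumes "infinite (UNIV :: 'k::field set)"
    and "0 < m" and "0 < q"
    and "term_order n lt"
    and "\<And>i j. i < j \<Longrightarrow> j \<le> n \<Longrightarrow> lt (Poly_Mapping.single i 1) (Poly_Mapping.single j 1)"
  shows
    "(\<forall>L \<in> wedge_terms n m q lt.
        (V_stratum n m q lt L :: 'k point set) =
          U_chart n m q lt L -
          (\<Union>L' \<in> {L' \<in> wedge_terms n m q lt. wedge_less q lt L L'}. U_chart n m q lt L'))
     \<and>
     (\<forall>L \<in> borel_terms n m q lt TYPE('k).
        (U_stratum n m q lt L :: 'k point set) =
          orbit n m q lt (U_chart n m q lt L) -
          (\<Union>L' \<in> {L' \<in> borel_terms n m q lt TYPE('k). wedge_less q lt L L'}.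
             orbit n m q lt (U_chart n m q lt L')))
     \<and>
     (stratification (topspace (Gr n m q lt :: 'k point topology))
        (wedge_terms n m q lt) (V_stratum n m q lt)
      \<and> (\<forall>L \<in> wedge_terms n m q lt.
            locally_closed_in (Gr n m q lt :: 'k point topology) (V_stratum n m q lt L))
      \<and> stratification (topspace (Gr n m q lt :: 'k point topology))
        (borel_terms n m q lt TYPE('k)) (U_stratum n m q lt)
      \<and> (\<forall>L \<in> borel_terms n m q lt TYPE('k).
            locally_closed_in (Gr n m q lt :: 'k point topology) (U_stratum n m q lt L)))
     \<and>
     (\<forall>W :: 'k point set. closedin (Gr n m q lt) W \<and> irreducible_in (Gr n m q lt) W \<longrightarrow>
        (dense_open_in (Gr n m q lt) W (W \<inter> V_stratum n m q lt (ini n m q lt W))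
         \<and> (\<forall>L \<in> wedge_terms n m q lt.
               wedge_less q lt (ini n m q lt W) L \<longrightarrow> W \<inter> V_stratum n m q lt L = {}))
        \<and>
        (stable n m q lt W \<longrightarrow>
           W \<inter> U_stratum n m q lt (gin n m q lt W)
             = W \<inter> orbit n m q lt (V_stratum n m q lt (gin n m q lt W))
         \<and> W \<inter> orbit n m q lt (V_stratum n m q lt (gin n m q lt W))
             = W \<inter> orbit n m q lt (V_stratum n m q lt (ini n m q lt W))
         \<and> dense_open_in (Gr n m q lt) W (W \<inter> U_stratum n m q lt (gin n m q lt W))
         \<and> (\<forall>L \<in> borel_terms n m q lt TYPE('k).
               wedge_less q lt (gin n m q lt W) L \<longrightarrow> W \<inter> U_stratum n m q lt L = {})))"
proof -
  have inf: "infinite (UNIV :: 'k set)" and q: "0 < q" by fact+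
  interpret grassmann_order n m q lt by unfold_locales fact+
  have WT_borel: "L \<in> WT" if "L \<in> borel_terms n m q lt TYPE('k)" for L
    using that by (simp add: borel_terms_def)
  have irr: "W \<subseteq> GP \<and> W \<noteq> {}" if "irreducible_in (Gr n m q lt) W" for W :: "'k point set"
    using that by (simp add: irreducible_in_def)
  show ?thesis
  proof (intro conjI allI ballI impI, goal_cases)
    case (1 L)
    then show ?case by (rule V_stratum_eq)
  next
    case (2 L)
    then show ?case by (rule U_stratum_eq[OF inf])
  next
    case 3
    show ?case by (rule stratification_V[OF q])
  next
    case (4 L)
    then show ?case by (rule locally_closed_V_stratum)
  next
    case 5
    show ?case by (rule stratification_U[OF inf q])
  next
    case (6 L)
    then show ?case by (rule locally_closed_U_stratum[OF inf])
  next
    case (7 W)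
    then show ?case using irr V_stratum_dense by blast
  next
    case (8 W L)
    then show ?case using irr V_stratum_above_ini by blast
  next
    case (9 W)
    then have W: "W \<subseteq> GP" "W \<noteq> {}" using irr by blast+
    \<comment> \<open>Both sides equal the intersection of \<open>W\<close> with the orbit of the
      chart of \<open>INI W\<close>; stability identifies \<open>gin\<close> with
      \<open>ini\<close>.\<close>
    show ?case
      using stable_U_stratum_inter[OF W 9(2)] stable_orbit_V_stratum_inter[OF W 9(2)]
      by (simp add: stable_gin[OF W 9(2)])
  next
    case (10 W)
    then have W: "W \<subseteq> GP" "W \<noteq> {}" using irr by blast+
    show ?case by (simp add: stable_gin[OF W 10(2)])
  next
    case (11 W)
    then have W: "W \<subseteq> GP" "W \<noteq> {}" and i: "irreducible_in (Gr n m q lt) W" using irr by blast+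
    show ?case using stable_U_stratum_dense[OF W 11(2) i] by (simp add: stable_gin[OF W 11(2)])
  next
    case (12 W L)
    then have W: "W \<subseteq> GP" "W \<noteq> {}" using irr by blast+
    show ?case using stable_U_stratum_above[OF W 12(2) WT_borel[OF 12(3)]] 12(4)
      by (simp add: stable_gin[OF W 12(2)])
  qed
qed

end
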